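(* Let $1\le p_-\le p_0\le p_+<\infty$ and let $\mathcal F$ be a collection of pairs $(f,g)$ of nonnegative measurable functions on $\mathbb R^n$. Assume that for every $(f,g)\in\mathcal F$ and every $w\in A_{p_0/p_-}\cap RH_{(p_+/p_0)'}$ we have $$\|g|L_{p_0,w}(\mathbb R^n)\|\le c_1\|f|L_{p_0,w}(\mathbb R^n)\|,$$ where $c_1$ does not depend on the pair $(f,g)$ and depends on $w$ only through its $A_{p_0}$-constant. Let $p_-<p<p_+$ (and also $p=p_-$ if $p_0=p_-$) and $w\in A_{p/p_-}\cap RH_\sigma$ with $\sigma\ge(p_+/p)'$. Then for every $(f,g)\in\mathcal F$ and every $-n/p\le r\le -n\sigma'/p_+$ we have $$\|g|L^r_p(w,\mathbb R^n)\|\le c_2\|f|L^r_p(w,\mathbb R^n)\|.$$ Furthermore, if $-n/p\le r\le -n/(p\sigma)-n/p_+$, we have $$\|g|L^r_p(\lambda,w,\mathbb R^n)\|\le c_3\|f|L^r_p(\lambda,w,\mathbb R^n)\|.$$ The constants $c_2$ and $c_3$ do not depend on the pair $(f,g)$ but may depend on the weights and the involved parameters.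
   Context: Norm inequalities are understood in $[0,\infty]$: they carry content whenever the right-hand side is finite (then the left-hand side must be finite as well). Cubes in $\mathbb R^n$ have sides parallel to the axes. A weight is a nonnegative locally integrable function; $w(E)=\int_E w$, $|E|$ is Lebesgue measure, $p'$ is the conjugate exponent, $1'=\infty$. For $0<p<\infty$, $\|f|L_{p,w}(E)\|=(\int_E|f|^pw)^{1/p}$. Muckenhoupt classes: for $1<p<\infty$ and $w>0$ a.e. locally integrable, $w\in A_p$ iff $[w]_{A_p}=\sup_Q\frac{w(Q)}{|Q|}\big(\frac{w^{1-p'}(Q)}{|Q|}\big)^{p-1}<\infty$; $w\in A_1$ iff there is $c$ with $w(Q)/|Q|\le c\,w(x)$ for a.e. $x\in Q$ and every cube $Q$ ($[w]_{A_1}$ is the least such $c$). Reverse Hölder class: for $1<\sigma<\infty$, $w\in RH_\sigma$ iff there is $c$ with $\big(|Q|^{-1}\int_Q w^\sigma\big)^{1/\sigma}\le c\,|Q|^{-1}\int_Q w$ for all cubes $Q$. (For the endpoint exponent $\infty$, arising when $p_0=p_+$, the standard convention is $w\in RH_\infty$ iff $\operatorname{ess\,sup}_Q w\le c\,|Q|^{-1}\int_Q w$ for all cubes $Q$.) Morrey spaces: for $0<p<\infty$, $-n/p\le r<0$ and a weight $w$, the spaces $L^r_p(w,\mathbb R^n)$ and $L^r_p(\lambda,w,\mathbb R^n)$ consist of the (classes of) measurable complex functions $f$ on $\mathbb R^n$ for which, respectively, the following quasinorms are finite (suprema over all cubes; here $\lambda$ is just a label for the second type of space): $$\|f|L^r_p(w,\mathbb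 R^n)\|=\sup_Q w(Q)^{-(1/p+r/n)}\|f|L_{p,w}(Q)\|,\qquad \|f|L^r_p(\lambda,w,\mathbb R^n)\|=\sup_Q |Q|^{-(1/p+r/n)}\|f|L_{p,w}(Q)\|.$$ *)

theory Defs
  imports "HOL-Analysis.Analysis" "HOL-Probability.Essential_Supremum"
begin

definition conj_exponent :: "ereal \<Rightarrow> ereal" where
  "conj_exponent p = (if p = 1 then \<infinity> else if p = \<infinity> then 1 else p / (p - 1))"

text \<open>Real powers on \<open>[0,\<infinity>]\<close>, so that norms and averages may take the value \<open>\<infinity>\<close>.\<close>

definition ennreal_powr :: "ennreal \<Rightarrow> real \<Rightarrow> ennreal"  (infixr "epowr" 80) where
  "x epowr a =
     (if a = 0 then 1
      else if x = 0 then (if a > 0 then 0 else top)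
      else if x = top then (if a > 0 then top else 0)
      else ennreal (enn2real x powr a))"

definition cubes :: "(real ^ 'n) set set" where
  "cubes = {cbox a (a + (\<chi> i. l)) | a l. l > 0}"

definition weight :: "(real ^ 'n \<Rightarrow> real) \<Rightarrow> bool" where
  "weight w \<longleftrightarrow> (\<forall>x. 0 \<le> w x) \<and> w \<in> borel_measurable lebesgue \<and>
     (\<forall>K. compact K \<longrightarrow> set_integrable lebesgue K w)"

text \<open>\<open>w(E)\<close>, computed in \<open>[0,\<infinity>]\<close>: powers of a weight need not be locally integrable.\<close>

definition wmeas :: "(real ^ 'n \<Rightarrow> real) \<Rightarrow> (real ^ 'n) set \<Rightarrow> ennreal" where
  "wmeas w E = (\<integral>\<^sup>+x\<in>E. ennreal (w x) \<partial>lebesgue)"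

definition avg :: "(real ^ 'n \<Rightarrow> real) \<Rightarrow> (real ^ 'n) set \<Rightarrow> ennreal" where
  "avg w Q = wmeas w Q / emeasure lebesgue Q"

definition A1_bound :: "(real ^ 'n \<Rightarrow> real) \<Rightarrow> real \<Rightarrow> bool" where
  "A1_bound w c \<longleftrightarrow> (\<forall>Q\<in>cubes. AE x in lebesgue. x \<in> Q \<longrightarrow> avg w Q \<le> ennreal (c * w x))"

text \<open>The constant \<open>[w]\<close> of the class \<open>A\<^sub>p\<close>, for \<open>1 \<le> p < \<infinity>\<close>.\<close>

definition muckenhoupt_const :: "real \<Rightarrow> (real ^ 'n \<Rightarrow> real) \<Rightarrow> ennreal" where
  "muckenhoupt_const p w =
     (if p = 1 then (INF c \<in> {c. 0 \<le> c \<and> A1_bound w c}. ennreal c)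
      else (SUP Q\<in>cubes. avg w Q * avg (\<lambda>x. w x powr (1 - p / (p - 1))) Q epowr (p - 1)))"

definition muckenhoupt :: "real \<Rightarrow> (real ^ 'n \<Rightarrow> real) set" where
  "muckenhoupt p = {w. weight w \<and> (AE x in lebesgue. 0 < w x) \<and>
     (if p = 1 then \<exists>c\<ge>0. A1_bound w c else muckenhoupt_const p w < top)}"

definition reverse_holder :: "ereal \<Rightarrow> (real ^ 'n \<Rightarrow> real) set" where
  "reverse_holder \<sigma> = {w. weight w \<and> (\<exists>c::real. c \<ge> 0 \<and> (\<forall>Q\<in>cubes.
     (if \<sigma> = \<infinity> then esssup (restrict_space lebesgue Q) (\<lambda>x. ennreal (w x))
      else avg (\<lambda>x. w x powr real_of_ereal \<sigma>) Q epowr (1 / real_of_ereal \<sigma>))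
     \<le> ennreal c * avg w Q))}"

definition Lpw_norm ::
  "real \<Rightarrow> (real ^ 'n \<Rightarrow> real) \<Rightarrow> (real ^ 'n) set \<Rightarrow> (real ^ 'n \<Rightarrow> 'b::real_normed_vector) \<Rightarrow> ennreal"
where
  "Lpw_norm p w E f = (\<integral>\<^sup>+x\<in>E. ennreal (norm (f x) powr p * w x) \<partial>lebesgue) epowr (1 / p)"

definition morrey_norm ::
  "real \<Rightarrow> real \<Rightarrow> (real ^ 'n \<Rightarrow> real) \<Rightarrow> (real ^ 'n \<Rightarrow> 'b::real_normed_vector) \<Rightarrow> ennreal"
where
  "morrey_norm r p w f =
     (SUP Q\<in>cubes. wmeas w Q epowr (- (1 / p + r / real CARD('n))) * Lpw_norm p w Q f)"

text \<open>The variant labelled \<open>\<lambda>\<close>, normalised by Lebesgue measure instead of by \<open>w\<close>.\<close>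

definition morrey_lambda_norm ::
  "real \<Rightarrow> real \<Rightarrow> (real ^ 'n \<Rightarrow> real) \<Rightarrow> (real ^ 'n \<Rightarrow> 'b::real_normed_vector) \<Rightarrow> ennreal"
where
  "morrey_lambda_norm r p w f =
     (SUP Q\<in>cubes. emeasure lebesgue Q epowr (- (1 / p + r / real CARD('n))) * Lpw_norm p w Q f)"

end

theory Submission
  imports Defs
begin

text \<open>
  For a fixed cube \<open>Q\<close> the integral of \<open>g\<^sup>p w\<close> over \<open>Q\<close> is at most its integral over the whole space
  against \<open>w \<phi>\<close>, where \<open>\<phi>\<close> equals \<open>1\<close> on \<open>Q\<close> and \<open>(\<psi>(Q) / \<psi>(2\<^sup>iQ))\<^sup>\<theta>\<close> on the \<open>i\<close>-th annulus \<open>2\<^sup>iQ - 2\<^sup>i\<^sup>-\<^sup>1Q\<close>; here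
  \<open>\<psi>\<close> is Lebesgue measure or \<open>w\<close>. The weights \<open>w \<phi>\<close> lie in \<open>A\<^sub>p\<^sub>/\<^sub>p\<^sub>- \<inter> RH\<^sub>(\<^sub>p\<^sub>+\<^sub>/\<^sub>p\<^sub>)\<^sub>'\<close> with constants independent of
  \<open>Q\<close>, so the global weighted inequality applies to them, and summing over the annuli gives the Morrey
  bound as soon as \<open>\<theta> > 1 + r p / n\<close>. The endpoint values of \<open>r\<close> are reached because \<open>w\<^sup>\<sigma>\<close> is reverse
  doubling, which leaves room for a slightly larger \<open>\<theta>\<close>.

  The global inequality for the exponent \<open>p\<close> comes from limited-range extrapolation. With
  \<open>W = v\<^sup>(\<^sup>p\<^sup>+\<^sup>/\<^sup>p\<^sup>)\<^sup>'\<close>, a Muckenhoupt weight, the Rubio de Francia algorithm turns a function of \<open>L\<^sup>\<tau>(W)\<close>, or of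
  the dual space, into an \<open>A\<^sub>1\<close> majorant \<open>h\<close>; a suitable power of \<open>h\<close> times a power of \<open>v\<close> is a weight for
  the exponent \<open>p\<^sub>0\<close>, and Hoelder's inequality passes between \<open>p\<^sub>0\<close> and \<open>p\<close>. In the parametrisation by two
  exponents used here, lowering and raising the exponent differ only by \<open>v \<mapsto> 1 / v\<close>.
\<close>

subsection \<open>Hoelder's inequality\<close>

text \<open>The two-exponent form is natural because A_q together with RH_sigma is a single
  Muckenhoupt condition on the power W = v^(1/a), of index 1 + b/a, with dual weight N = v^(-1/b),
  where a = 1/sigma and b = q - 1. The exponent p corresponds to a = 1 - p/p_+ and b = p/p_- - 1,
  and this one-parameter family is what extrapolation preserves. The weights fed into the global
  inequality change with the cube, so every estimate has to be uniform over all weights with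
  constant at most K; this is why constants are quantified before weights throughout. The hypothesis
  offers only an arbitrary function of the A_p0 constant, so this uniformity has to be produced
  before extrapolation starts. One comparison, of W(Q) with W(E) for a subset E of Q, does double
  duty: with a subcube it gives the doubling behind the maximal theorem, with the complement of a
  subcube the reverse doubling behind the endpoint values of r. If p = p_+, then all exponents
  coincide and r = -n/p; the Morrey norms are then the global norm, and this case is treated
  apart.\<close>

lemma young_scaled:
  fixes u v x y :: real
  assumes "0 \<le> u" "0 \<le> v" "0 < x" "0 < y" "0 \<le> \<alpha>" "0 \<le> \<beta>" "\<alpha> + \<beta> = 1"
  shows "u powr \<alpha> * v powr \<beta> \<le> x powr \<alpha> * y powr \<beta> * (\<alpha> * (u / x) + \<beta> * (v / y))"
proof (cases "u = 0 \<or> v = 0")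
  case False
  then have "(u / x) powr \<alpha> * (v / y) powr \<beta> \<le> \<alpha> * (u / x) + \<beta> * (v / y)"
    using assms by (intro Youngs_inequality_0) auto
  then have "x powr \<alpha> * y powr \<beta> * ((u / x) powr \<alpha> * (v / y) powr \<beta>)
      \<le> x powr \<alpha> * y powr \<beta> * (\<alpha> * (u / x) + \<beta> * (v / y))"
    by (intro mult_left_mono) auto
  then show ?thesis using assms by (simp add: powr_divide)
qed (use assms in auto)

text \<open>Young's inequality for \<open>u / x\<close> and \<open>v / y\<close> is linear in
  \<open>u\<close> and \<open>v\<close>, so it integrates directly against any positive upper bounds
  \<open>x\<close> and \<open>y\<close>. There is no normalisation by exact norms, hence no separate
  case of a vanishing norm, and the exponents 0 and 1 are included.\<close>

lemma nn_integral_Holder_bound: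
  fixes u v :: "'a \<Rightarrow> real"
  assumes [measurable]: "u \<in> borel_measurable M" "v \<in> borel_measurable M"
    and nonneg: "\<And>z. 0 \<le> u z" "\<And>z. 0 \<le> v z"
    and bound: "(\<integral>\<^sup>+z. u z \<partial>M) \<le> ennreal x" "(\<integral>\<^sup>+z. v z \<partial>M) \<le> ennreal y"
    and xy: "0 < x" "0 < y" and ab: "0 \<le> \<alpha>" "0 \<le> \<beta>" "\<alpha> + \<beta> = 1"
  shows "(\<integral>\<^sup>+z. ennreal (u z powr \<alpha> * v z powr \<beta>) \<partial>M) \<le> ennreal (x powr \<alpha> * y powr \<beta>)"
proof -
  let ?c = "x powr \<alpha> * y powr \<beta>"
  have "(\<integral>\<^sup>+z. ennreal (u z powr \<alpha> * v z powr \<beta>) \<partial>M)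
      \<le> (\<integral>\<^sup>+z. ennreal (?c * \<alpha> / x) * ennreal (u z) + ennreal (?c * \<beta> / y) * ennreal (v z) \<partial>M)"
  proof (intro nn_integral_mono)
    fix z
    have "u z powr \<alpha> * v z powr \<beta> \<le> ?c * (\<alpha> * (u z / x) + \<beta> * (v z / y))"
      using nonneg xy ab by (intro young_scaled)
    also have "\<dots> = ?c * \<alpha> / x * u z + ?c * \<beta> / y * v z"
      by (simp add: algebra_simps)
    finally show "ennreal (u z powr \<alpha> * v z powr \<beta>)
      \<le> ennreal (?c * \<alpha> / x) * ennreal (u z) + ennreal (?c * \<beta> / y) * ennreal (v z)"
      using nonneg xy ab by (simp flip: ennreal_mult ennreal_plus)
  qed
  also have "\<dots> = ennreal (?c * \<alpha> / x) * (\<integral>\<^sup>+z. u z \<partial>M) + ennreal (?c * \<beta> / y) * (\<integral>\<^sup>+z. v z \<partial>M)"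
    by (simp add: nn_integral_add nn_integral_cmult)
  also have "\<dots> \<le> ennreal (?c * \<alpha> / x) * ennreal x + ennreal (?c * \<beta> / y) * ennreal y"
    using bound by (intro add_mono mult_left_mono) auto
  also have "\<dots> = ennreal (?c * \<alpha> + ?c * \<beta>)"
    using xy ab by (simp flip: ennreal_mult ennreal_plus)
  also have "?c * \<alpha> + ?c * \<beta> = ?c"
    using ab by (metis mult.right_neutral distrib_left)
  finally show ?thesis .
qed

subsection \<open>Cubes and averages\<close>

text \<open>Corner and side length as data, so that coverings can run over index pairs and the
  rational ones can be enumerated.\<close>

definition cb :: "real ^ 'n \<Rightarrow> real \<Rightarrow> (real ^ 'n) set" where
  "cb a l = cbox a (a + (\<chi> i. l))"

lemma mem_cb: "x \<in> cb a l \<longleftrightarrow> (\<forall>i. a $ i \<le> x $ i \<and> x $ i \<le> a $ i + l)"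
  by (simp add: cb_def mem_box_cart)

lemma cubes_cb: "cubes = {cb a l | a l. 0 < l}"
  by (simp add: cubes_def cb_def)

lemma cb_in_cubes: "0 < l \<Longrightarrow> cb a l \<in> cubes"
  by (auto simp: cubes_cb)

lemma cubesE:
  assumes "Q \<in> cubes" obtains a l where "Q = cb a l" "0 < l"
  using assms by (auto simp: cubes_cb)

lemma sets_cb [measurable, simp]: "cb a l \<in> sets lebesgue"
  by (simp add: cb_def)

lemma measure_cb: "0 \<le> l \<Longrightarrow> measure lebesgue (cb a l :: (real ^ 'n) set) = l ^ CARD('n)"
proof -
  assume l: "0 \<le> l"
  then have "cbox a (a + (\<chi> i. l)) \<noteq> {}"
    by (auto simp: interval_ne_empty_cart)
  then show ?thesis using l
    by (simp add: cb_def content_cbox_cart)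
qed

lemma emeasure_cb: "0 \<le> l \<Longrightarrow> emeasure lebesgue (cb a l :: (real ^ 'n) set) = ennreal (l ^ CARD('n))"
  using lmeasurable_cbox[of a "a + (\<chi> i. l)"]
  by (subst measure_cb[symmetric, of l a]) (auto simp: cb_def intro!: emeasure_eq_measure2)

lemma cubes_sets [simp]: "Q \<in> cubes \<Longrightarrow> Q \<in> sets lebesgue"
  by (auto simp: cubes_cb)

lemma cubes_measure_pos: "Q \<in> cubes \<Longrightarrow> 0 < measure lebesgue Q"
  by (auto simp: cubes_cb measure_cb)

lemma cubes_emeasure: "Q \<in> cubes \<Longrightarrow> emeasure lebesgue Q = ennreal (measure lebesgue Q)"
  by (metis cubesE emeasure_cb measure_cb less_imp_le)

text \<open>A version of \<open>avg\<close> for values in [0,\<infinity>]: the Rubio de Francia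
  series is not known to be finite until its norm has been bounded.\<close>

definition mean :: "(real ^ 'n \<Rightarrow> ennreal) \<Rightarrow> (real ^ 'n) set \<Rightarrow> ennreal" where
  "mean u Q = (\<integral>\<^sup>+x\<in>Q. u x \<partial>lebesgue) / emeasure lebesgue Q"

lemma avg_mean: "avg w Q = mean (\<lambda>x. ennreal (w x)) Q"
  by (simp add: avg_def wmeas_def mean_def)

lemma mean_le_iff:
  assumes "Q \<in> cubes"
  shows "mean u Q \<le> c \<longleftrightarrow> (\<integral>\<^sup>+x\<in>Q. u x \<partial>lebesgue) \<le> c * ennreal (measure lebesgue Q)"
proof -
  let ?m = "ennreal (measure lebesgue Q)" and ?I = "\<integral>\<^sup>+x\<in>Q. u x \<partial>lebesgue"
  have m: "?m \<noteq> 0" "?m < top" using cubes_measure_pos[OF assms] by auto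
  have eq: "?I / ?m * ?m = ?I" using m by (simp add: ennreal_divide_times)
  have "?I \<le> c * ?m" if "?I / ?m \<le> c"
    using mult_right_mono[OF that, of ?m] by (simp only: eq zero_le)
  moreover have "?I \<le> c * ?m \<Longrightarrow> ?I / ?m \<le> c"
    using m by (intro divide_le_posI_ennreal) (auto simp: mult.commute zero_less_iff_neq_zero)
  ultimately show ?thesis by (auto simp: mean_def cubes_emeasure[OF assms])
qed

lemma avg_le_iff:
  assumes "Q \<in> cubes" "0 \<le> x"
  shows "avg w Q \<le> ennreal x \<longleftrightarrow> wmeas w Q \<le> ennreal (x * measure lebesgue Q)"
  using mean_le_iff[OF assms(1), of "\<lambda>x. ennreal (w x)" "ennreal x"] assms cubes_measure_pos[OF assms(1)]
  by (simp add: avg_mean wmeas_def ennreal_mult)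

lemma wmeas_avg:
  assumes "Q \<in> cubes"
  shows "wmeas w Q = avg w Q * ennreal (measure lebesgue Q)"
  using cubes_measure_pos[OF assms]
  by (simp add: avg_def cubes_emeasure[OF assms] ennreal_divide_times)

lemma avg_Holder:
  fixes u v :: "real ^ 'n \<Rightarrow> real"
  assumes Q: "Q \<in> cubes"
    and [measurable]: "u \<in> borel_measurable lebesgue" "v \<in> borel_measurable lebesgue"
    and nonneg: "\<And>z. 0 \<le> u z" "\<And>z. 0 \<le> v z"
    and bound: "avg u Q \<le> ennreal x" "avg v Q \<le> ennreal y"
    and xy: "0 < x" "0 < y" and ab: "0 \<le> \<alpha>" "0 \<le> \<beta>" "\<alpha> + \<beta> = 1"
  shows "avg (\<lambda>z. u z powr \<alpha> * v z powr \<beta>) Q \<le> ennreal (x powr \<alpha> * y powr \<beta>)"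
proof -
  let ?m = "measure lebesgue Q"
  have m: "0 < ?m" using Q by (rule cubes_measure_pos)
  have [measurable]: "Q \<in> sets lebesgue" using Q by simp
  have *: "(\<integral>\<^sup>+z. ennreal (w z * indicator Q z) \<partial>lebesgue) = wmeas w Q" for w :: "real ^ 'n \<Rightarrow> real"
    unfolding wmeas_def by (intro nn_integral_cong) (auto simp: indicator_def)
  have "(\<integral>\<^sup>+z. ennreal ((u z * indicator Q z) powr \<alpha> * (v z * indicator Q z) powr \<beta>) \<partial>lebesgue)
      \<le> ennreal ((x * ?m) powr \<alpha> * (y * ?m) powr \<beta>)"
    using bound nonneg xy ab m
    by (intro nn_integral_Holder_bound) (auto simp: * avg_le_iff[OF Q])
  also have "(\<lambda>z. (u z * indicator Q z) powr \<alpha> * (v z * indicator Q z) powr \<beta>)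
      = (\<lambda>z. (u z powr \<alpha> * v z powr \<beta>) * indicator Q z)"
    by (auto simp: indicator_def)
  also have "(x * ?m) powr \<alpha> * (y * ?m) powr \<beta> = x powr \<alpha> * y powr \<beta> * ?m powr (\<alpha> + \<beta>)"
    using xy m by (simp add: powr_mult powr_add)
  also have "\<dots> = x powr \<alpha> * y powr \<beta> * ?m"
    using ab m by simp
  finally show ?thesis
    using xy by (subst avg_le_iff[OF Q]) (auto simp: *)
qed

lemma avg_mono_AE:
  assumes "AE x in lebesgue. x \<in> Q \<longrightarrow> u x \<le> v x"
  shows "avg u Q \<le> avg v Q"
  unfolding avg_def wmeas_def using assms
  by (intro divide_right_mono_ennreal nn_integral_mono_AE) (auto simp: indicator_def elim!: eventually_mono intro: ennreal_leI)

lemma avg_cmult: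
  assumes "Q \<in> cubes" "u \<in> borel_measurable lebesgue" "0 \<le> c"
  shows "avg (\<lambda>x. c * u x) Q = ennreal c * avg u Q"
proof -
  have [measurable]: "Q \<in> sets lebesgue" "u \<in> borel_measurable lebesgue" using assms by auto
  have "wmeas (\<lambda>x. c * u x) Q = ennreal c * wmeas u Q"
    unfolding wmeas_def using assms(3)
    by (subst nn_integral_cmult[symmetric]) (auto simp: ennreal_mult' mult.assoc)
  then show ?thesis by (simp add: avg_def ennreal_times_divide)
qed

lemma avg_const_one:
  assumes "Q \<in> cubes" shows "avg (\<lambda>_. 1) Q = 1"
proof -
  have "wmeas (\<lambda>_. 1) Q = emeasure lebesgue Q" using assms by (simp add: wmeas_def)
  then show ?thesis using cubes_measure_pos[OF assms]
    by (simp add: avg_def cubes_emeasure[OF assms] ennreal_divide_self)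
qed

subsection \<open>Powers on \<open>[0,\<infinity>]\<close>\<close>

lemma epowr_ennreal: "0 \<le> x \<Longrightarrow> 0 < a \<Longrightarrow> ennreal x epowr a = ennreal (x powr a)"
  by (auto simp: ennreal_powr_def)

lemma epowr_top: "0 < a \<Longrightarrow> top epowr a = top"
  by (auto simp: ennreal_powr_def)

lemma epowr_zero: "0 < a \<Longrightarrow> 0 epowr a = 0"
  by (auto simp: ennreal_powr_def)

lemma epowr_mono: "x \<le> y \<Longrightarrow> 0 < a \<Longrightarrow> x epowr a \<le> y epowr a"
  by (cases x; cases y) (auto simp: epowr_ennreal epowr_top top_unique intro!: ennreal_leI powr_mono2)

lemma epowr_epowr: "0 < a \<Longrightarrow> 0 < b \<Longrightarrow> (x epowr a) epowr b = x epowr (a * b)"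
  by (cases x) (auto simp: epowr_ennreal epowr_top powr_powr)

lemma epowr_one [simp]: "x epowr 1 = x"
  by (cases x) (auto simp: epowr_ennreal epowr_top)

lemma epowr_mult: "0 < a \<Longrightarrow> (x * y) epowr a = x epowr a * y epowr a"
  by (cases x; cases y)
    (auto simp: epowr_ennreal epowr_top epowr_zero powr_mult ennreal_top_mult ennreal_mult_top
      simp flip: ennreal_mult)

lemma epowr_add: "0 < a \<Longrightarrow> 0 < b \<Longrightarrow> x epowr (a + b) = x epowr a * x epowr b"
  by (cases x) (auto simp: epowr_ennreal epowr_top powr_add ennreal_mult)

lemma measurable_epowr [measurable]:
  assumes [measurable]: "u \<in> borel_measurable M"
  shows "(\<lambda>x. u x epowr a) \<in> borel_measurable M"
  unfolding ennreal_powr_def by measurable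

lemma nn_integral_powr_below:
  fixes z :: ennreal
  assumes a: "-1 < a"
  shows "(\<integral>\<^sup>+s. ennreal (s powr a) * indicator {s. 0 < s \<and> ennreal s < z} s \<partial>lborel)
    = ennreal (1 / (a + 1)) * z epowr (a + 1)"
proof -
  have fin: "(\<integral>\<^sup>+s. ennreal (s powr a) * indicator {s. 0 < s \<and> ennreal s < ennreal c} s \<partial>lborel)
      = ennreal (1 / (a + 1) * c powr (a + 1))" if c: "0 \<le> c" for c
  proof -
    have "(\<integral>\<^sup>+s. ennreal (s powr a) * indicator {0..c} s \<partial>lborel) = ennreal (c powr (a+1) / (a+1))"
      by (rule nn_integral_has_integral_lebesgue'[OF _ has_integral_powr_from_0[OF a c]]) auto
    moreover have ae: "AE s in lborel. s \<noteq> 0 \<and> s \<noteq> c"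
      by (simp add: AE_conj_iff AE_lborel_singleton)
    have "(\<integral>\<^sup>+s. ennreal (s powr a) * indicator {s. 0 < s \<and> ennreal s < ennreal c} s \<partial>lborel)
        = (\<integral>\<^sup>+s. ennreal (s powr a) * indicator {0..c} s \<partial>lborel)"
      by (rule nn_integral_cong_AE, rule eventually_mono[OF ae]) (auto simp: indicator_def ennreal_less_iff)
    ultimately show ?thesis by simp
  qed
  show ?thesis
  proof (cases z)
    case (real c)
    then show ?thesis using fin[of c] a by (simp add: epowr_ennreal flip: ennreal_mult)
  next
    case top
    let ?I = "\<integral>\<^sup>+s. ennreal (s powr a) * indicator {s. 0 < s \<and> ennreal s < top} s \<partial>lborel"
    have unb: "ennreal n \<le> ?I" if n: "0 \<le> n" for n
    proof -
      \<comment> \<open>Chosen so that the integral up to \<open>c\<close> is exactly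
        \<open>n\<close>; as \<open>n\<close> is arbitrary, the full integral is infinite.\<close>
      define c where "c = ((a + 1) * n) powr (1 / (a + 1))"
      have "ennreal n = ennreal (1 / (a + 1) * c powr (a + 1))"
        using a n by (simp add: c_def powr_powr)
      also have "\<dots> = (\<integral>\<^sup>+s. ennreal (s powr a) * indicator {s. 0 < s \<and> ennreal s < ennreal c} s \<partial>lborel)"
        by (rule fin[symmetric]) (simp add: c_def)
      also have "\<dots> \<le> ?I" by (intro nn_integral_mono) (auto simp: indicator_def)
      finally show ?thesis .
    qed
    have "?I = top"
    proof (cases ?I)
      case (real r)
      then show ?thesis using unb[of "r + 1"] by auto
    qed
    then show ?thesis using a top by (simp add: epowr_top ennreal_mult_top)
  qed
qed

subsection \<open>The maximal operator of a doubling measure\<close>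

text \<open>The larger box is the concentric triple of \<open>cb b m\<close>: from a common point
  one moves by at most \<open>l \<le> m\<close> in each coordinate.\<close>

lemma cb_subset_triple:
  assumes "cb a l \<inter> cb b m \<noteq> {}" "l \<le> m"
  shows "cb a l \<subseteq> cb (b - (\<chi> i. m)) (3 * m)"
proof -
  obtain y where y: "y \<in> cb a l" "y \<in> cb b m" using assms(1) by auto
  show ?thesis
  proof
    fix x assume x: "x \<in> cb a l"
    show "x \<in> cb (b - (\<chi> i. m)) (3 * m)"
      unfolding mem_cb
    proof
      fix i
      have "a $ i \<le> y $ i" "y $ i \<le> a $ i + l" "b $ i \<le> y $ i" "y $ i \<le> b $ i + m"
        "a $ i \<le> x $ i" "x $ i \<le> a $ i + l"
        using x y by (auto simp: mem_cb)
      then show "(b - (\<chi> i. m)) $ i \<le> x $ i \<and> x $ i \<le> (b - (\<chi> i. m)) $ i + 3 * m"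
        using assms(2) by simp
    qed
  qed
qed

text \<open>Greedy selection: keep a longest cube, whose triple swallows every cube meeting it, and
  recurse on the cubes disjoint from it.\<close>

lemma vitali_cubes:
  fixes G :: "((real ^ 'n) \<times> real) set"
  assumes "finite G" "\<And>a l. (a, l) \<in> G \<Longrightarrow> 0 < l"
  shows "\<exists>H\<subseteq>G. disjoint_family_on (\<lambda>(a, l). cb a l) H \<and>
    (\<Union>(a, l)\<in>G. cb a l) \<subseteq> (\<Union>(b, m)\<in>H. cb (b - (\<chi> i. m)) (3 * m))"
  using assms
proof (induction G rule: finite_psubset_induct)
  case (psubset G)
  show ?case
  proof (cases "G = {}")
    case True
    then show ?thesis by (auto simp: disjoint_family_on_def)
  next
    case False
    have "Max (snd ` G) \<in> snd ` G" using psubset(1) False by (intro Max_in) auto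
    then obtain b m where bm: "(b, m) \<in> G" "m = Max (snd ` G)" by auto
    have le: "l \<le> m" if "(a, l) \<in> G" for a l
    proof -
      have "snd (a, l) \<in> snd ` G" using that by (rule imageI)
      then show ?thesis using psubset(1) bm(2) by simp
    qed
    have m0: "0 < m" using psubset.prems bm by auto
    define G' where "G' = {(a, l) \<in> G. cb a l \<inter> cb b m = {}}"
    have "b \<in> cb b m" using m0 by (auto simp: mem_cb)
    then have "(b, m) \<notin> G'" by (auto simp: G'_def)
    then have sub: "G' \<subset> G" using bm by (auto simp: G'_def)
    have "\<exists>H\<subseteq>G'. disjoint_family_on (\<lambda>(a, l). cb a l) H \<and>
        (\<Union>(a, l)\<in>G'. cb a l) \<subseteq> (\<Union>(b, m)\<in>H. cb (b - (\<chi> i. m)) (3 * m))"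
      using psubset.prems by (intro psubset.IH[OF sub]) (auto simp: G'_def)
    then obtain H where H: "H \<subseteq> G'"
      "disjoint_family_on (\<lambda>(a, l). cb a l) H"
      "(\<Union>(a, l)\<in>G'. cb a l) \<subseteq> (\<Union>(b, m)\<in>H. cb (b - (\<chi> i. m)) (3 * m))"
      by blast
    have "disjoint_family_on (\<lambda>(a, l). cb a l) (insert (b, m) H)"
      using H(1,2) by (fastforce simp: disjoint_family_on_def G'_def)
    moreover have "(\<Union>(a, l)\<in>G. cb a l) \<subseteq> (\<Union>(b, m)\<in>insert (b, m) H. cb (b - (\<chi> i. m)) (3 * m))"
    proof (clarify)
      fix x a l assume x: "(a, l) \<in> G" "x \<in> cb a l"
      show "x \<in> (\<Union>(b, m)\<in>insert (b, m) H. cb (b - (\<chi> i. m)) (3 * m))"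
      proof (cases "(a, l) \<in> G'")
        case True
        then show ?thesis using x H(3) by blast
      next
        case False
        then show ?thesis using cb_subset_triple[of a l b m] le[OF x(1)] x by (auto simp: G'_def)
      qed
    qed
    moreover have "insert (b, m) H \<subseteq> G" using H(1) bm by (auto simp: G'_def)
    ultimately show ?thesis by blast
  qed
qed


text \<open>The selected cubes are disjoint, so their integrals add up to at most the full integral;
  the doubling constant pays for the passage to triples.\<close>

lemma weak_type_finite:
  fixes G :: "((real ^ 'n) \<times> real) set"
  assumes G: "finite G" "\<And>a l. (a, l) \<in> G \<Longrightarrow> 0 < l"
    and M: "sets M = sets lebesgue" and [measurable]: "u \<in> borel_measurable M"
    and doubling: "\<And>a l. 0 < l \<Longrightarrow> emeasure M (cb (a - (\<chi> i. l)) (3 * l)) \<le> D * emeasure M (cb a l)"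
    and big: "\<And>a l. (a, l) \<in> G \<Longrightarrow> t * emeasure M (cb a l) \<le> (\<integral>\<^sup>+x\<in>cb a l. u x \<partial>M)"
  shows "t * emeasure M (\<Union>(a, l)\<in>G. cb a l) \<le> D * (\<integral>\<^sup>+x. u x \<partial>M)"
proof -
  have [measurable, simp]: "cb a l \<in> sets M" for a :: "real ^ 'n" and l by (simp add: M)
  obtain H where H: "H \<subseteq> G" "disjoint_family_on (\<lambda>(a, l). cb a l) H"
      "(\<Union>(a, l)\<in>G. cb a l) \<subseteq> (\<Union>(b, m)\<in>H. cb (b - (\<chi> i. m)) (3 * m))"
    using vitali_cubes[of G] G by blast
  have fH: "finite H" using H G finite_subset by blast
  have disj: "disjoint_family_on (\<lambda>i. cb (fst i) (snd i)) H"
    using H(2) by (simp add: case_prod_unfold)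
  have "emeasure M (\<Union>(a, l)\<in>G. cb a l) \<le> emeasure M (\<Union>i\<in>H. cb (fst i - (\<chi> j. snd i)) (3 * snd i))"
    using H(3) fH by (intro emeasure_mono) (auto simp: case_prod_unfold)
  also have "\<dots> \<le> (\<Sum>i\<in>H. emeasure M (cb (fst i - (\<chi> j. snd i)) (3 * snd i)))"
    using fH by (intro emeasure_subadditive_finite) auto
  also have "\<dots> \<le> (\<Sum>i\<in>H. D * emeasure M (cb (fst i) (snd i)))"
  proof (intro sum_mono doubling)
    fix i assume "i \<in> H"
    then show "0 < snd i" using H(1) G(2)[of "fst i" "snd i"] by auto
  qed
  finally have "t * emeasure M (\<Union>(a, l)\<in>G. cb a l) \<le> t * (\<Sum>i\<in>H. D * emeasure M (cb (fst i) (snd i)))"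
    by (rule mult_left_mono) simp
  also have "\<dots> = D * (\<Sum>i\<in>H. t * emeasure M (cb (fst i) (snd i)))"
    by (simp add: sum_distrib_left mult_ac)
  also have "\<dots> \<le> D * (\<Sum>i\<in>H. \<integral>\<^sup>+x\<in>cb (fst i) (snd i). u x \<partial>M)"
    using H(1) big by (intro mult_left_mono sum_mono) (auto simp: case_prod_unfold subset_eq)
  finally have le: "t * emeasure M (\<Union>(a, l)\<in>G. cb a l) \<le> D * (\<Sum>i\<in>H. \<integral>\<^sup>+x\<in>cb (fst i) (snd i). u x \<partial>M)" .
  have "(\<Sum>i\<in>H. \<integral>\<^sup>+x\<in>cb (fst i) (snd i). u x \<partial>M)
      = (\<integral>\<^sup>+x. (\<Sum>i\<in>H. u x * indicator (cb (fst i) (snd i)) x) \<partial>M)"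
    by (rule nn_integral_sum[symmetric]) auto
  also have "\<dots> = (\<integral>\<^sup>+x\<in>(\<Union>i\<in>H. cb (fst i) (snd i)). u x \<partial>M)"
    by (subst indicator_UN_disjoint[OF fH disj]) (simp add: sum_distrib_left)
  also have "\<dots> \<le> (\<integral>\<^sup>+x. u x \<partial>M)"
    by (intro nn_integral_mono) (auto simp: indicator_def)
  finally show ?thesis using le by (meson mult_left_mono order_trans zero_le)
qed

lemma weak_type_countable:
  fixes G :: "((real ^ 'n) \<times> real) set"
  assumes G: "countable G" "\<And>a l. (a, l) \<in> G \<Longrightarrow> 0 < l"
    and M: "sets M = sets lebesgue" and [measurable]: "u \<in> borel_measurable M"
    and doubling: "\<And>a l. 0 < l \<Longrightarrow> emeasure M (cb (a - (\<chi> i. l)) (3 * l)) \<le> D * emeasure M (cb a l)"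
    and big: "\<And>a l. (a, l) \<in> G \<Longrightarrow> t * emeasure M (cb a l) \<le> (\<integral>\<^sup>+x\<in>cb a l. u x \<partial>M)"
  shows "t * emeasure M (\<Union>(a, l)\<in>G. cb a l) \<le> D * (\<integral>\<^sup>+x. u x \<partial>M)"
proof (cases "G = {}")
  case False
  define f where "f = from_nat_into G"
  have range: "range f = G" using False G(1) by (simp add: f_def range_from_nat_into)
  define A where "A n = (\<Union>(a, l)\<in>f ` {..n}. cb a l)" for n
  have "A n \<in> sets M" for n by (auto simp: A_def M case_prod_unfold)
  moreover have "incseq A" unfolding incseq_def A_def by (intro allI impI UN_mono image_mono) auto
  ultimately have "emeasure M (\<Union>n. A n) = (SUP n. emeasure M (A n))"
    by (intro SUP_emeasure_incseq[symmetric]) auto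
  moreover have "(\<Union>n. A n) = (\<Union>(a, l)\<in>G. cb a l)"
    unfolding A_def range[symmetric] case_prod_unfold by auto
  moreover have "t * emeasure M (A n) \<le> D * (\<integral>\<^sup>+x. u x \<partial>M)" for n
    unfolding A_def
  proof (rule weak_type_finite)
    have sub: "f ` {..n} \<subseteq> G" using range by auto
    show "0 < l" if "(a, l) \<in> f ` {..n}" for a l using G(2) sub that by auto
    show "t * emeasure M (cb a l) \<le> (\<integral>\<^sup>+x\<in>cb a l. u x \<partial>M)" if "(a, l) \<in> f ` {..n}" for a l
      using big sub that by auto
  qed (use M doubling in auto)
  ultimately show ?thesis by (auto simp: SUP_mult_left_ennreal intro!: SUP_least)
qed simp

section \<open>Maximal operators over cubes with rational data\<close>

definition rational_cubes :: "((real ^ 'n) \<times> real) set" where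
  "rational_cubes = {(a, l). (\<forall>i. a $ i \<in> \<rat>) \<and> l \<in> \<rat> \<and> 0 < l}"

lemma countable_rational_cubes: "countable (rational_cubes :: ((real ^ 'n) \<times> real) set)"
proof -
  have "countable ({a :: real ^ 'n. \<forall>i. a $ i \<in> \<rat>} \<times> (\<rat> :: real set))"
    by (intro countable_SIGMA countable_vector countable_rat)
  then show ?thesis by (rule countable_subset[rotated]) (auto simp: rational_cubes_def)
qed

text \<open>The uncentred operator with averages taken in \<open>M\<close>. Rational cubes make the
  supremum countable and hence measurable; for Lebesgue averages over arbitrary cubes this costs a
  factor \<open>2 ^ CARD('n)\<close>.\<close>

definition maximal :: "(real ^ 'n) measure \<Rightarrow> (real ^ 'n \<Rightarrow> ennreal) \<Rightarrow> real ^ 'n \<Rightarrow> ennreal" where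
  "maximal M u x = (SUP (a, l)\<in>rational_cubes.
     indicator (cb a l) x * ((\<integral>\<^sup>+y\<in>cb a l. u y \<partial>M) / emeasure M (cb a l)))"

lemma maximal_upper:
  assumes "(a, l) \<in> rational_cubes" "x \<in> cb a l"
  shows "(\<integral>\<^sup>+y\<in>cb a l. u y \<partial>M) / emeasure M (cb a l) \<le> maximal M u x"
  unfolding maximal_def using assms by (intro SUP_upper2[OF assms(1)]) auto

lemma measurable_maximal [measurable]: "maximal M u \<in> borel_measurable lebesgue"
  unfolding maximal_def[abs_def] case_prod_unfold
  by (intro borel_measurable_SUP countable_rational_cubes) auto

text \<open>The part of \<open>u\<close> not exceeding \<open>s / 2\<close> contributes at most
  \<open>s / 2\<close> to an average, so an average above \<open>s\<close> owes at least
  \<open>s / 2\<close> to the rest. This truncated form is the one that interpolation needs.\<close>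

lemma maximal_weak_type:
  fixes u :: "real ^ 'n \<Rightarrow> ennreal"
  assumes M: "sets M = sets lebesgue" and [measurable]: "u \<in> borel_measurable M"
    and doubling: "\<And>a l. 0 < l \<Longrightarrow> emeasure M (cb (a - (\<chi> i. l)) (3 * l)) \<le> ennreal D * emeasure M (cb a l)"
    and finite: "\<And>a l. 0 < l \<Longrightarrow> emeasure M (cb a l) < top"
    and D: "0 \<le> D" and s: "0 < s"
  shows "emeasure M {x. ennreal s < maximal M u x}
    \<le> ennreal (2 * D / s) * (\<integral>\<^sup>+x. u x * indicator {x. ennreal (s / 2) < u x} x \<partial>M)"
proof -
  have [measurable, simp]: "cb a l \<in> sets M" for a :: "real ^ 'n" and l by (simp add: M)
  have space: "space M = UNIV" using sets_eq_imp_space_eq[OF M] by simp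
  have E [measurable]: "{x. ennreal (s / 2) < u x} \<in> sets M"
    using borel_measurable_pred_less[of "\<lambda>_. ennreal (s / 2)" M u] by (simp add: pred_def space)
  define u' where "u' x = u x * indicator {x. ennreal (s / 2) < u x} x" for x
  have [measurable]: "u' \<in> borel_measurable M" unfolding u'_def by measurable
  define G where "G = {(a, l) \<in> rational_cubes. ennreal (s / 2) * emeasure M (cb a l) \<le> (\<integral>\<^sup>+x\<in>cb a l. u' x \<partial>M)}"
  have "{x. ennreal s < maximal M u x} \<subseteq> (\<Union>(a, l)\<in>G. cb a l)"
  proof
    fix x assume "x \<in> {x. ennreal s < maximal M u x}"
    then obtain a l where al: "(a, l) \<in> rational_cubes"
      and *: "ennreal s < indicator (cb a l) x * ((\<integral>\<^sup>+y\<in>cb a l. u y \<partial>M) / emeasure M (cb a l))"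
      unfolding maximal_def less_SUP_iff by auto
    then have x: "x \<in> cb a l" by (cases "x \<in> cb a l") auto
    let ?m = "emeasure M (cb a l)"
    have l: "0 < l" using al by (auto simp: rational_cubes_def)
    have "?m < top" using finite l by auto
    then obtain m where m: "?m = ennreal m" "0 \<le> m" by (cases ?m) auto
    have "ennreal s * ?m \<le> (\<integral>\<^sup>+y\<in>cb a l. u y \<partial>M)"
    proof (cases "m = 0")
      case False
      with m have "0 < m" by simp
      show ?thesis
      proof (rule ccontr)
        assume "\<not> ?thesis"
        then have "(\<integral>\<^sup>+y\<in>cb a l. u y \<partial>M) / ?m \<le> ennreal s"
          using \<open>0 < m\<close> m by (intro divide_le_posI_ennreal) (auto simp: mult.commute)
        then show False using * x by simp
      qed
    qed (simp add: m)
    also have "(\<integral>\<^sup>+y\<in>cb a l. u y \<partial>M) \<le> (\<integral>\<^sup>+y. u' y * indicator (cb a l) y + ennreal (s / 2) * indicator (cb a l) y \<partial>M)"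
      by (intro nn_integral_mono) (auto simp: u'_def indicator_def)
    also have "\<dots> = (\<integral>\<^sup>+y\<in>cb a l. u' y \<partial>M) + ennreal (s / 2) * ?m"
      by (simp add: nn_integral_add nn_integral_cmult)
    finally have "ennreal (s / 2) * ?m + ennreal (s / 2) * ?m \<le> (\<integral>\<^sup>+y\<in>cb a l. u' y \<partial>M) + ennreal (s / 2) * ?m"
      using m s by (simp add: mult.commute flip: ennreal_mult ennreal_plus)
    \<comment> \<open>Cancelling a summand in [0,\<infinity>] requires it to be finite, which is
      where the finiteness of cube measures enters.\<close>
    moreover have "ennreal (s / 2) * ?m \<noteq> top" using m by (simp flip: ennreal_mult'')
    ultimately have "ennreal (s / 2) * ?m \<le> (\<integral>\<^sup>+y\<in>cb a l. u' y \<partial>M)"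
      by (subst (asm) (1 2) add.commute) (auto simp: ennreal_add_left_cancel_le add.commute)
    then show "x \<in> (\<Union>(a, l)\<in>G. cb a l)" using al x by (auto simp: G_def)
  qed
  moreover have cG: "countable G"
    by (rule countable_subset[OF _ countable_rational_cubes]) (auto simp: G_def)
  moreover have "(\<Union>(a, l)\<in>G. cb a l) \<in> sets M"
    using cG by (auto simp: case_prod_unfold)
  ultimately have "ennreal (s / 2) * emeasure M {x. ennreal s < maximal M u x}
      \<le> ennreal (s / 2) * emeasure M (\<Union>(a, l)\<in>G. cb a l)"
    by (intro mult_left_mono emeasure_mono) auto
  also have "\<dots> \<le> ennreal D * (\<integral>\<^sup>+x. u' x \<partial>M)"
    using cG by (rule weak_type_countable) (use M doubling in \<open>auto simp: G_def rational_cubes_def\<close>)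
  finally have "ennreal (2 / s) * (ennreal (s / 2) * emeasure M {x. ennreal s < maximal M u x})
      \<le> ennreal (2 / s) * (ennreal D * (\<integral>\<^sup>+x. u' x \<partial>M))"
    by (rule mult_left_mono) simp
  then show ?thesis
    using s D by (simp add: u'_def mult.assoc[symmetric] flip: ennreal_mult)
qed


text \<open>Marcinkiewicz interpolation carried out by hand: the layer-cake formula, the truncated
  weak bound at each height \<open>s\<close>, then Fubini. The inner integral of
  \<open>s powr (p - 2)\<close> up to \<open>2 * u x\<close> converges at zero because
  \<open>1 < p\<close>.\<close>

lemma maximal_strong_type:
  fixes u :: "real ^ 'n \<Rightarrow> ennreal"
  assumes M: "sets M = sets lebesgue" and sf: "sigma_finite_measure M"
    and [measurable]: "u \<in> borel_measurable M"
    and doubling: "\<And>a l. 0 < l \<Longrightarrow> emeasure M (cb (a - (\<chi> i. l)) (3 * l)) \<le> ennreal D * emeasure M (cb a l)"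
    and finite: "\<And>a l. 0 < l \<Longrightarrow> emeasure M (cb a l) < top"
    and D: "0 \<le> D" and p: "1 < p"
  shows "(\<integral>\<^sup>+x. maximal M u x epowr p \<partial>M)
    \<le> ennreal (D * p / (p - 1) * 2 powr p) * (\<integral>\<^sup>+x. u x epowr p \<partial>M)"
proof -
  interpret M: sigma_finite_measure M by fact
  interpret P: pair_sigma_finite M "lborel :: real measure" ..
  have space: "space M = UNIV" using sets_eq_imp_space_eq[OF M] by simp
  let ?m = "maximal M u"
  have [measurable]: "?m \<in> borel_measurable M"
    using measurable_maximal[of M u] by (simp add: measurable_def M sets_eq_imp_space_eq[OF M])
  have "(\<integral>\<^sup>+x. ?m x epowr p \<partial>M)
      = (\<integral>\<^sup>+x. ennreal p * (\<integral>\<^sup>+s. ennreal (s powr (p - 1)) * indicator {s. 0 < s \<and> ennreal s < ?m x} s \<partial>lborel) \<partial>M)"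
    using p by (subst nn_integral_powr_below) (auto simp: mult.assoc[symmetric] simp flip: ennreal_mult)
  also have "\<dots> = (\<integral>\<^sup>+x. (\<integral>\<^sup>+s. ennreal (p * s powr (p - 1)) * indicator {0<..} s * indicator {x. ennreal s < ?m x} x \<partial>lborel) \<partial>M)"
    using p by (subst nn_integral_cmult[symmetric])
      (auto intro!: nn_integral_cong simp: indicator_def ennreal_mult)
  also have "\<dots> = (\<integral>\<^sup>+s. (\<integral>\<^sup>+x. ennreal (p * s powr (p - 1)) * indicator {0<..} s * indicator {x. ennreal s < ?m x} x \<partial>M) \<partial>lborel)"
    by (rule P.Fubini'[symmetric]) (simp add: case_prod_unfold indicator_def)
  also have "\<dots> \<le> (\<integral>\<^sup>+s. (\<integral>\<^sup>+x. ennreal (2 * D * p * s powr (p - 2)) * indicator {0<..} s * (u x * indicator {x. ennreal (s / 2) < u x} x) \<partial>M) \<partial>lborel)"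
  proof (rule nn_integral_mono)
    fix s :: real
    have [measurable]: "{x. ennreal s < ?m x} \<in> sets M" "{x. ennreal (s / 2) < u x} \<in> sets M"
      using borel_measurable_pred_less[of "\<lambda>_. ennreal s" M ?m]
        borel_measurable_pred_less[of "\<lambda>_. ennreal (s / 2)" M u] by (simp_all add: pred_def space)
    show "(\<integral>\<^sup>+x. ennreal (p * s powr (p - 1)) * indicator {0<..} s * indicator {x. ennreal s < ?m x} x \<partial>M)
      \<le> (\<integral>\<^sup>+x. ennreal (2 * D * p * s powr (p - 2)) * indicator {0<..} s * (u x * indicator {x. ennreal (s / 2) < u x} x) \<partial>M)"
    proof (cases "0 < s")
      case True
      let ?I = "\<integral>\<^sup>+x. u x * indicator {x. ennreal (s / 2) < u x} x \<partial>M"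
      have "ennreal (p * s powr (p - 1)) * emeasure M {x. ennreal s < ?m x}
          \<le> ennreal (p * s powr (p - 1)) * (ennreal (2 * D / s) * ?I)"
        by (intro mult_left_mono maximal_weak_type) (use M doubling finite D True in auto)
      also have "\<dots> = ennreal (2 * D * p * s powr (p - 2)) * ?I"
      proof -
        have "s powr (p - 1) = s powr (p - 2) * s"
          using True by (simp add: powr_mult_base[symmetric] powr_diff power2_eq_square)
        then have "p * s powr (p - 1) * (2 * D / s) = 2 * D * p * s powr (p - 2)"
          using True by simp
        then show ?thesis using p D True by (simp add: mult.assoc[symmetric] flip: ennreal_mult)
      qed
      finally show ?thesis using True by (simp add: nn_integral_cmult)
    qed simp
  qed
  also have "\<dots> = (\<integral>\<^sup>+x. (\<integral>\<^sup>+s. ennreal (2 * D * p * s powr (p - 2)) * indicator {0<..} s * (u x * indicator {x. ennreal (s / 2) < u x} x) \<partial>lborel) \<partial>M)"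
    by (rule P.Fubini') (simp add: case_prod_unfold indicator_def)
  also have "\<dots> = (\<integral>\<^sup>+x. ennreal (2 * D * p) * u x * (\<integral>\<^sup>+s. ennreal (s powr (p - 2)) * indicator {s. 0 < s \<and> ennreal s < 2 * u x} s \<partial>lborel) \<partial>M)"
  proof (intro nn_integral_cong)
    fix x
    have iff: "ennreal (s / 2) < u x \<longleftrightarrow> ennreal s < 2 * u x" if "0 < s" for s
      using that by (cases "u x") (auto simp: ennreal_less_iff ennreal_mult_top simp flip: ennreal_mult ennreal_numeral)
    show "(\<integral>\<^sup>+s. ennreal (2 * D * p * s powr (p - 2)) * indicator {0<..} s * (u x * indicator {x. ennreal (s / 2) < u x} x) \<partial>lborel)
      = ennreal (2 * D * p) * u x * (\<integral>\<^sup>+s. ennreal (s powr (p - 2)) * indicator {s. 0 < s \<and> ennreal s < 2 * u x} s \<partial>lborel)"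
      using p D
      by (subst nn_integral_cmult[symmetric])
        (auto intro!: nn_integral_cong simp: indicator_def ennreal_mult iff mult_ac)
  qed
  also have "\<dots> = (\<integral>\<^sup>+x. ennreal (D * p / (p - 1) * 2 powr p) * u x epowr p \<partial>M)"
  proof (intro nn_integral_cong)
    fix x
    have e1: "(2 * u x) epowr (p - 1) = ennreal (2 powr (p - 1)) * u x epowr (p - 1)"
      using p epowr_ennreal[of 2 "p - 1"] by (simp add: epowr_mult)
    have e2: "u x * u x epowr (p - 1) = u x epowr p"
      using p epowr_add[of 1 "p - 1" "u x"] by simp
    have "2 * D * p * (1 / (p - 1)) * 2 powr (p - 1) = D * p / (p - 1) * 2 powr p"
      using p by (simp add: powr_diff divide_simps)
    then have e3: "ennreal (2 * D * p) * ennreal (1 / (p - 1)) * ennreal (2 powr (p - 1))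
        = ennreal (D * p / (p - 1) * 2 powr p)"
      using p D by (simp flip: ennreal_mult)
    have e4: "(\<integral>\<^sup>+s. ennreal (s powr (p - 2)) * indicator {s. 0 < s \<and> ennreal s < 2 * u x} s \<partial>lborel)
        = ennreal (1 / (p - 1)) * (2 * u x) epowr (p - 1)"
      using p nn_integral_powr_below[of "p - 2" "2 * u x"] by simp
    show "ennreal (2 * D * p) * u x * (\<integral>\<^sup>+s. ennreal (s powr (p - 2)) * indicator {s. 0 < s \<and> ennreal s < 2 * u x} s \<partial>lborel)
      = ennreal (D * p / (p - 1) * 2 powr p) * u x epowr p"
      unfolding e4 e1 e3[symmetric] e2[symmetric] by (simp only: mult_ac)
  qed
  also have "\<dots> = ennreal (D * p / (p - 1) * 2 powr p) * (\<integral>\<^sup>+x. u x epowr p \<partial>M)"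
    by (rule nn_integral_cmult) simp
  finally show ?thesis .
qed

subsection \<open>Two-sided weight classes\<close>

text \<open>\<open>mean_bound a u Q s\<close> bounds the normalised \<open>L\<^sup>1\<^sup>/\<^sup>a\<close> norm of \<open>u\<close> on \<open>Q\<close> by \<open>s\<close>, where \<open>a = 0\<close> stands for
  the essential supremum. Up to the size of the constants, \<open>A\<^sub>q \<inter> RH\<^sub>\<sigma>\<close> is then
  \<open>weight_class (1 / \<sigma>) (q - 1)\<close>, and \<open>v \<mapsto> 1 / v\<close> exchanges the two parameters.\<close>

definition mean_bound :: "real \<Rightarrow> (real ^ 'n \<Rightarrow> real) \<Rightarrow> (real ^ 'n) set \<Rightarrow> real \<Rightarrow> bool" where
  "mean_bound a u Q s \<longleftrightarrow>
     (if a = 0 then AE x in lebesgue. x \<in> Q \<longrightarrow> u x \<le> s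
      else avg (\<lambda>x. u x powr (1 / a)) Q \<le> ennreal (s powr (1 / a)))"

text \<open>Witnesses \<open>s\<close> and \<open>t\<close> instead of a product of two norms avoid
  the form 0 times infinity and let the essential supremum be handled like the other norms.
  Positivity at every point makes \<open>v \<mapsto> 1 / v\<close> an involution without exceptional
  sets.\<close>

definition weight_class :: "real \<Rightarrow> real \<Rightarrow> real \<Rightarrow> (real ^ 'n \<Rightarrow> real) set" where
  "weight_class a b K = {v. v \<in> borel_measurable lebesgue \<and> (\<forall>x. 0 < v x) \<and>
     (\<forall>Q\<in>cubes. \<exists>s t. 0 < s \<and> 0 < t \<and> s * t \<le> K \<and>
        mean_bound a v Q s \<and> mean_bound b (\<lambda>x. 1 / v x) Q t)}"

lemma weight_classD:
  assumes "v \<in> weight_class a b K"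
  shows "v \<in> borel_measurable lebesgue" "0 < v x"
  using assms by (auto simp: weight_class_def)

lemma weight_classE:
  assumes "v \<in> weight_class a b K" "Q \<in> cubes"
  obtains s t where "0 < s" "0 < t" "s * t \<le> K" "mean_bound a v Q s" "mean_bound b (\<lambda>x. 1 / v x) Q t"
  using assms by (auto simp: weight_class_def)

lemma weight_class_inverse:
  fixes v :: "real ^ 'n \<Rightarrow> real"
  assumes "v \<in> weight_class a b K"
  shows "(\<lambda>x. 1 / v x) \<in> weight_class b a K"
  unfolding weight_class_def
proof (intro CollectI conjI ballI)
  fix Q :: "(real ^ 'n) set" assume "Q \<in> cubes"
  from weight_classE[OF assms this] obtain s t where "0 < s" "0 < t" "s * t \<le> K"
    "mean_bound a v Q s" "mean_bound b (\<lambda>x. 1 / v x) Q t" .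
  then show "\<exists>s t. 0 < s \<and> 0 < t \<and> s * t \<le> K \<and>
      mean_bound b (\<lambda>x. 1 / v x) Q s \<and> mean_bound a (\<lambda>x. 1 / (1 / v x)) Q t"
    by (intro exI[of _ t] exI[of _ s]) (simp add: mult.commute[of t s])
next
  have [measurable]: "v \<in> borel_measurable lebesgue" using assms by (rule weight_classD)
  show "(\<lambda>x. 1 / v x) \<in> borel_measurable lebesgue" by measurable
  show "\<forall>x. 0 < 1 / v x" using weight_classD(2)[OF assms] by simp
qed

lemma weight_class_const_pos:
  fixes v :: "real ^ 'n \<Rightarrow> real"
  assumes "v \<in> weight_class a b K"
  shows "0 < K"
proof -
  obtain s t where "0 < s" "0 < t" "s * t \<le> K"
    using weight_classE[OF assms cb_in_cubes[of 1 "0 :: real ^ 'n"]] by (metis zero_less_one)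
  then show ?thesis by (meson mult_pos_pos less_le_trans)
qed

section \<open>Doubling properties of powers of a weight\<close>

lemma wmeas_pos:
  assumes [measurable]: "W \<in> borel_measurable lebesgue" "E \<in> sets lebesgue"
    and "\<And>x. 0 < W x" "0 < measure lebesgue E"
  shows "0 < wmeas W E"
proof (rule ccontr)
  assume "\<not> ?thesis"
  then have "AE x in lebesgue. ennreal (W x) * indicator E x = 0"
    by (subst nn_integral_0_iff_AE[symmetric]) (auto simp: wmeas_def)
  then have "AE x in lebesgue. x \<notin> E"
  proof eventually_elim
    case (elim x)
    then show ?case using assms(3)[of x] by (auto simp: indicator_def)
  qed
  then have "emeasure lebesgue E = 0"
    by (subst (asm) AE_iff_measurable[of E]) auto
  then show False using assms(4) by (simp add: measure_def del: emeasure_completion)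
qed

lemma wmeas_mono: "A \<subseteq> B \<Longrightarrow> wmeas u A \<le> wmeas u B"
  unfolding wmeas_def by (intro nn_integral_mono) (auto simp: indicator_def)

lemma wmeas_class_finite:
  assumes v: "v \<in> weight_class a b K" and a: "0 < a" and Q: "Q \<in> cubes"
  shows "wmeas (\<lambda>x. v x powr (1 / a)) Q < top" "0 < wmeas (\<lambda>x. v x powr (1 / a)) Q"
proof -
  have [measurable]: "v \<in> borel_measurable lebesgue" using v by (rule weight_classD)
  obtain s where "mean_bound a v Q s" using weight_classE[OF v Q] by metis
  then have "wmeas (\<lambda>x. v x powr (1 / a)) Q \<le> ennreal (s powr (1 / a) * measure lebesgue Q)"
    using a Q by (simp add: mean_bound_def avg_le_iff)
  then show "wmeas (\<lambda>x. v x powr (1 / a)) Q < top"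
    by (rule le_less_trans) simp
  show "0 < wmeas (\<lambda>x. v x powr (1 / a)) Q"
    using weight_classD(2)[OF v] Q cubes_measure_pos[OF Q]
    by (intro wmeas_pos) (auto simp: weight_classD(2)[OF v, THEN less_imp_neq, THEN not_sym])
qed

text \<open>With W = v^(1/a) and N = v^(-1/b) the product W^a N^b is 1, so the indicator of
  \<open>E\<close> splits as (W 1_E)^(a/(a+b)) N^(b/(a+b)) and Hoelder bounds |E|/|Q| by a power of
  W(E). A subcube for \<open>E\<close> yields doubling, the complement of a subcube yields reverse
  doubling.\<close>

lemma weight_class_subset:
  fixes v :: "real ^ 'n \<Rightarrow> real"
  assumes v: "v \<in> weight_class a b K" and ab: "0 < a" "0 < b"
    and Q: "Q \<in> cubes" and E: "E \<subseteq> Q" "E \<in> sets lebesgue" "0 < measure lebesgue E"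
  shows "wmeas (\<lambda>x. v x powr (1 / a)) Q
    \<le> ennreal (K powr (1 / a) * (measure lebesgue Q / measure lebesgue E) powr (1 + b / a)) * wmeas (\<lambda>x. v x powr (1 / a)) E"
proof -
  note [measurable] = weight_classD(1)[OF v] E(2)
  have [measurable]: "Q \<in> sets lebesgue" using Q by simp
  note v0 = weight_classD(2)[OF v]
  let ?W = "\<lambda>x. v x powr (1 / a)" and ?N = "\<lambda>x. (1 / v x) powr (1 / b)"
  let ?m = "measure lebesgue Q" and ?e = "measure lebesgue E"
  have m: "0 < ?m" using Q by (rule cubes_measure_pos)
  have eE: "emeasure lebesgue E = ennreal ?e"
  proof (rule emeasure_eq_ennreal_measure)
    have "emeasure lebesgue E \<le> emeasure lebesgue Q" using E(1) by (intro emeasure_mono) auto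
    then show "emeasure lebesgue E \<noteq> top" by (auto simp: cubes_emeasure[OF Q] top_unique)
  qed
  have K: "0 < K" using v by (rule weight_class_const_pos)
  obtain s t where st: "0 < s" "0 < t" "s * t \<le> K"
    and s: "avg ?W Q \<le> ennreal (s powr (1 / a))" and t: "avg ?N Q \<le> ennreal (t powr (1 / b))"
    using weight_classE[OF v Q] ab by (auto simp: mean_bound_def)
  have "wmeas ?W E \<le> wmeas ?W Q" using E(1) by (rule wmeas_mono)
  then have "wmeas ?W E < top" using wmeas_class_finite(1)[OF v ab(1) Q] by (rule le_less_trans)
  then obtain y where y: "wmeas ?W E = ennreal y" "0 \<le> y" by (cases "wmeas ?W E") auto
  have "0 < wmeas ?W E"
    using E by (intro wmeas_pos) (auto simp: v0[THEN less_imp_neq, THEN not_sym])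
  with y have y0: "0 < y" by simp
  have 1: "wmeas (\<lambda>x. ?W x * indicator E x) Q = wmeas ?W E"
    unfolding wmeas_def using E(1) by (intro nn_integral_cong) (auto simp: indicator_def)
  have "avg (\<lambda>z. (?W z * indicator E z) powr (a / (a + b)) * ?N z powr (b / (a + b))) Q
      \<le> ennreal ((y / ?m) powr (a / (a + b)) * (t powr (1 / b)) powr (b / (a + b)))"
    using Q t y0 m st ab v0
    by (intro avg_Holder) (simp_all add: avg_le_iff 1 y add_divide_distrib[symmetric] less_imp_le)
  also have "avg (\<lambda>z. (?W z * indicator E z) powr (a / (a + b)) * ?N z powr (b / (a + b))) Q
      = avg (indicator E) Q"
  proof (rule arg_cong[where f = "\<lambda>u. avg u Q"], rule ext)
    fix z
    have "?W z powr (a / (a + b)) * ?N z powr (b / (a + b)) = 1"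
      using ab v0[of z] by (simp add: powr_powr powr_divide)
    then show "(?W z * indicator E z) powr (a / (a + b)) * ?N z powr (b / (a + b)) = indicator E z"
      by (auto simp: indicator_def)
  qed
  finally have "wmeas (indicator E) Q \<le> ennreal ((y / ?m) powr (a / (a + b)) * (t powr (1 / b)) powr (b / (a + b)) * ?m)"
    using Q by (subst (asm) avg_le_iff) auto
  also have "wmeas (indicator E) Q = ennreal ?e"
  proof -
    have "wmeas (indicator E) Q = (\<integral>\<^sup>+x. indicator E x \<partial>lebesgue)"
      unfolding wmeas_def using E(1) by (intro nn_integral_cong) (auto simp: indicator_def)
    then show ?thesis by (simp add: eE)
  qed
  finally have "?e \<le> (y / ?m) powr (a / (a + b)) * (t powr (1 / b)) powr (b / (a + b)) * ?m"
    by (rule ennreal_le_iff[THEN iffD1, rotated]) (use m in auto)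
  then have "?e / ?m \<le> (y / ?m) powr (a / (a + b)) * t powr (1 / (a + b))"
    using m ab st by (simp add: powr_powr divide_le_eq)
  \<comment> \<open>The power \<open>1 + b / a\<close>, that is \<open>(a + b) / a\<close>, makes
    the bound linear in \<open>y\<close> and turns the other factor into
    \<open>t powr (1 / a)\<close>, ready to be paired with \<open>s powr (1 / a)\<close>.\<close>
  then have "(?e / ?m) powr (1 + b / a) \<le> ((y / ?m) powr (a / (a + b)) * t powr (1 / (a + b))) powr (1 + b / a)"
    using E m ab by (intro powr_mono2) (auto simp: add_pos_pos)
  also have "\<dots> = (y / ?m) powr ((a / (a + b)) * (1 + b / a)) * t powr ((1 / (a + b)) * (1 + b / a))"
    using y0 m st by (simp add: powr_mult powr_powr)
  also have "(a / (a + b)) * (1 + b / a) = 1" using ab by (simp add: divide_simps add_nonneg_eq_0_iff)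
  also have "(1 / (a + b)) * (1 + b / a) = 1 / a" using ab by (simp add: divide_simps add_nonneg_eq_0_iff)
  finally have le: "(?e / ?m) powr (1 + b / a) \<le> (y / ?m) * t powr (1 / a)" using y0 m by simp
  have "s powr (1 / a) * ?m \<le> K powr (1 / a) * (?m / ?e) powr (1 + b / a) * y"
  proof -
    have "s powr (1 / a) * t powr (1 / a) \<le> K powr (1 / a)"
      using st ab by (subst powr_mult[symmetric]) (auto intro!: powr_mono2)
    moreover have "s powr (1 / a) * (?e / ?m) powr (1 + b / a) \<le> s powr (1 / a) * ((y / ?m) * t powr (1 / a))"
      using le by (intro mult_left_mono) auto
    ultimately have "s powr (1 / a) * (?e / ?m) powr (1 + b / a) \<le> (y / ?m) * K powr (1 / a)"
      using y0 m by (smt (verit, best) divide_nonneg_nonneg mult.commute mult.left_commute mult_left_mono)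
    then have "s powr (1 / a) * (?e / ?m) powr (1 + b / a) * (?m / ?e) powr (1 + b / a)
        \<le> (y / ?m) * K powr (1 / a) * (?m / ?e) powr (1 + b / a)"
      by (rule mult_right_mono) simp
    moreover have "(?e / ?m) powr (1 + b / a) * (?m / ?e) powr (1 + b / a) = 1"
      using E m by (subst powr_mult[symmetric]) auto
    ultimately show ?thesis using m by (simp add: mult.assoc field_simps)
  qed
  moreover have "wmeas ?W Q \<le> ennreal (s powr (1 / a) * ?m)" using s Q by (simp add: avg_le_iff)
  ultimately show ?thesis
    using y0 y(1) by (auto simp: ennreal_leI intro: order_trans simp flip: ennreal_mult')
qed

subsection \<open>The maximal operator on Muckenhoupt weights\<close>

lemma sigma_finite_lebesgue: "sigma_finite_measure (lebesgue :: 'a::euclidean_space measure)"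
proof
  obtain A :: "'a set set" where A: "countable A" "A \<subseteq> sets lborel" "\<Union>A = space lborel"
      "\<forall>a\<in>A. emeasure lborel a \<noteq> \<infinity>"
    using lborel.sigma_finite_countable by auto
  show "\<exists>A::'a set set. countable A \<and> A \<subseteq> sets lebesgue \<and> \<Union>A = space lebesgue \<and> (\<forall>a\<in>A. emeasure lebesgue a \<noteq> \<infinity>)"
    using A by (intro exI[of _ A]) (auto simp: subset_eq emeasure_completion)
qed

definition weight_measure :: "(real ^ 'n \<Rightarrow> real) \<Rightarrow> (real ^ 'n) measure" where
  "weight_measure W = density lebesgue (\<lambda>x. ennreal (W x))"

lemma sets_weight_measure [simp, measurable_cong]: "sets (weight_measure W) = sets lebesgue"
  by (simp add: weight_measure_def)

lemma sigma_finite_weight_measure: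
  assumes [measurable]: "W \<in> borel_measurable lebesgue"
  shows "sigma_finite_measure (weight_measure W)"
  unfolding weight_measure_def
  by (subst sigma_finite_measure.sigma_finite_iff_density_finite[OF sigma_finite_lebesgue]) auto

lemma emeasure_weight_measure:
  assumes "W \<in> borel_measurable lebesgue" "E \<in> sets lebesgue"
  shows "emeasure (weight_measure W) E = wmeas W E"
  using assms by (simp add: weight_measure_def wmeas_def emeasure_density)

lemma nn_integral_weight_measure:
  assumes "W \<in> borel_measurable lebesgue" "u \<in> borel_measurable lebesgue"
  shows "(\<integral>\<^sup>+x. u x \<partial>weight_measure W) = (\<integral>\<^sup>+x. u x * ennreal (W x) \<partial>lebesgue)"
  using assms by (simp add: weight_measure_def nn_integral_density mult.commute)

lemma cb_triple: "0 \<le> l \<Longrightarrow> cb a l \<subseteq> cb (a - (\<chi> i. l)) (3 * l)"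
  by (auto simp: mem_cb) (smt (verit))+

text \<open>A cube inside its concentric triple has measure ratio \<open>3 ^ CARD('n)\<close>, so
  \<open>weight_class_subset\<close> supplies the doubling constant.\<close>

lemma maximal_weight_measure_strong:
  fixes v :: "real ^ 'n \<Rightarrow> real"
  assumes v: "v \<in> weight_class a b K" and ab: "0 < a" "0 < b" and p: "1 < p"
    and [measurable]: "u \<in> borel_measurable lebesgue"
  defines "W \<equiv> \<lambda>x. v x powr (1 / a)"
  shows "(\<integral>\<^sup>+x. maximal (weight_measure W) u x epowr p * ennreal (W x) \<partial>lebesgue)
    \<le> ennreal (K powr (1 / a) * (3 ^ CARD('n)) powr (1 + b / a) * p / (p - 1) * 2 powr p)
        * (\<integral>\<^sup>+x. u x epowr p * ennreal (W x) \<partial>lebesgue)"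
proof -
  note [measurable] = weight_classD(1)[OF v] measurable_maximal
  have [measurable]: "W \<in> borel_measurable lebesgue" unfolding W_def by measurable
  let ?M = "weight_measure W"
  have "(\<integral>\<^sup>+x. maximal ?M u x epowr p \<partial>?M) \<le> ennreal (K powr (1 / a) * (3 ^ CARD('n)) powr (1 + b / a) * p / (p - 1) * 2 powr p)
        * (\<integral>\<^sup>+x. u x epowr p \<partial>?M)"
  proof (rule maximal_strong_type)
    fix c :: "real ^ 'n" and l :: real assume l: "0 < l"
    have "measure lebesgue (cb (c - (\<chi> i. l)) (3 * l)) / measure lebesgue (cb c l) = 3 ^ CARD('n)"
      using l by (simp add: measure_cb power_mult_distrib)
    then show "emeasure ?M (cb (c - (\<chi> i. l)) (3 * l)) \<le> ennreal (K powr (1 / a) * (3 ^ CARD('n)) powr (1 + b / a)) * emeasure ?M (cb c l)"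
      using weight_class_subset[OF v ab, of "cb (c - (\<chi> i. l)) (3 * l)" "cb c l"] l
        cb_in_cubes[of "3 * l" "c - (\<chi> i. l)"] cb_triple[of l c] cubes_measure_pos[OF cb_in_cubes[OF l, of c]]
      by (simp add: emeasure_weight_measure W_def)
    show "emeasure ?M (cb c l) < top"
      using wmeas_class_finite(1)[OF v ab(1) cb_in_cubes[OF l]]
      by (simp add: emeasure_weight_measure W_def)
  qed (use p in \<open>auto intro: sigma_finite_weight_measure\<close>)
  then show ?thesis by (simp add: nn_integral_weight_measure)
qed


text \<open>Lerner's argument: with \<open>N\<close> the dual weight, \<open>(M f)\<^sup>b\<^sup>/\<^sup>a\<close> is dominated pointwise by the maximal
  operator of \<open>W\<close> applied to \<open>(M\<^sub>N (f / N))\<^sup>b\<^sup>/\<^sup>a / W\<close>, and both weighted operators are bounded because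
  the measures are doubling.\<close>

theorem maximal_weighted_bound:
  fixes v :: "real ^ 'n \<Rightarrow> real"
  assumes v: "v \<in> weight_class a b K" and ab: "0 < a" "0 < b"
    and f [measurable]: "f \<in> borel_measurable lebesgue"
  defines "W \<equiv> \<lambda>x. v x powr (1 / a)"
    and "C \<equiv> K powr (1 / a * (1 + a / b))
      * (K powr (1 / a) * (3 ^ CARD('n)) powr (1 + b / a) * (1 + a / b) / (a / b) * 2 powr (1 + a / b))
      * (K powr (1 / b) * (3 ^ CARD('n)) powr (1 + a / b) * (1 + b / a) / (b / a) * 2 powr (1 + b / a))"
  shows "(\<integral>\<^sup>+x. maximal lebesgue f x epowr (1 + b / a) * ennreal (W x) \<partial>lebesgue)
    \<le> ennreal C * (\<integral>\<^sup>+x. f x epowr (1 + b / a) * ennreal (W x) \<partial>lebesgue)"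
proof -
  note [measurable] = weight_classD(1)[OF v] measurable_maximal
  note v0 = weight_classD(2)[OF v]
  have K: "0 < K" using v by (rule weight_class_const_pos)
  define N where "N x = (1 / v x) powr (1 / b)" for x
  have [measurable]: "W \<in> borel_measurable lebesgue" "N \<in> borel_measurable lebesgue"
    unfolding W_def N_def by measurable
  have WN: "0 < W x" "0 < N x" for x using v0[of x] by (simp_all add: W_def N_def)
  define m where "m = maximal (weight_measure N) (\<lambda>x. f x * ennreal (1 / N x))"
  define G where "G x = m x epowr (b / a) * ennreal (1 / W x)" for x
  have [measurable]: "m \<in> borel_measurable lebesgue" unfolding m_def by measurable
  have [measurable]: "G \<in> borel_measurable lebesgue" unfolding G_def by measurable
  let ?MG = "maximal (weight_measure W) G"
  have ba: "b / a * (a / b) = 1" using ab by simp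
  have point: "maximal lebesgue f x epowr (b / a) \<le> ennreal (K powr (1 / a)) * ?MG x" for x
  proof -
    have "indicator (cb c l) x * ((\<integral>\<^sup>+y\<in>cb c l. f y \<partial>lebesgue) / emeasure lebesgue (cb c l))
        \<le> (ennreal (K powr (1 / a)) * ?MG x) epowr (a / b)" if cl: "(c, l) \<in> rational_cubes" for c l
    proof (cases "x \<in> cb c l")
      case True
      let ?Q = "cb c l" and ?I = "\<integral>\<^sup>+y\<in>cb c l. f y \<partial>lebesgue"
      have Q: "?Q \<in> cubes" using cl by (auto simp: rational_cubes_def intro: cb_in_cubes)
      define q where "q = measure lebesgue ?Q"
      have q: "0 < q" using Q cubes_measure_pos by (simp add: q_def)
      obtain s t where st: "0 < s" "0 < t" "s * t \<le> K"
        and mb: "mean_bound a v ?Q s" "mean_bound b (\<lambda>x. 1 / v x) ?Q t"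
        by (rule weight_classE[OF v Q])
      have s: "avg W ?Q \<le> ennreal (s powr (1 / a))" and t: "avg N ?Q \<le> ennreal (t powr (1 / b))"
        using mb ab by (simp_all add: mean_bound_def W_def N_def[abs_def])
      obtain \<omega> where \<omega>: "wmeas W ?Q = ennreal \<omega>" "0 < \<omega>"
        using wmeas_class_finite[OF v ab(1) Q, folded W_def] by (cases "wmeas W ?Q") auto
      obtain \<nu> where \<nu>: "wmeas N ?Q = ennreal \<nu>" "0 < \<nu>"
        using wmeas_class_finite[OF weight_class_inverse[OF v] ab(2) Q, folded N_def] by (cases "wmeas N ?Q") auto
      have \<omega>s: "\<omega> \<le> s powr (1 / a) * q" and \<nu>t: "\<nu> \<le> t powr (1 / b) * q"
        using s t q Q by (auto simp: avg_le_iff \<omega> \<nu> q_def)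
      \<comment> \<open>The average of \<open>f / N\<close> over the cube in the measure of
        \<open>N\<close>, hence at most \<open>m\<close> at every point of the cube.\<close>
      define A where "A = ?I / ennreal \<nu>"
      have I: "?I = A * ennreal \<nu>" using \<nu> by (simp add: A_def ennreal_divide_times)
      have fN: "f y * ennreal (1 / N y) * ennreal (N y) = f y" for y
        using WN(2)[of y] by (simp add: mult.assoc flip: ennreal_mult)
      have fN': "(\<integral>\<^sup>+y\<in>?Q. f y * ennreal (1 / N y) \<partial>weight_measure N) = ?I"
        by (subst nn_integral_weight_measure) (auto intro!: nn_integral_cong simp: indicator_def fN)
      have Am: "A \<le> m y" if "y \<in> ?Q" for y
        using maximal_upper[OF cl that, where u = "\<lambda>x. f x * ennreal (1 / N x)" and M = "weight_measure N"]
        by (simp add: m_def A_def fN' emeasure_weight_measure \<nu>)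
      have "A epowr (b / a) * ennreal q = (\<integral>\<^sup>+y\<in>?Q. A epowr (b / a) \<partial>lebesgue)"
        using Q by (simp add: nn_integral_cmult_indicator q_def cubes_emeasure del: emeasure_completion)
      also have "\<dots> \<le> (\<integral>\<^sup>+y\<in>?Q. G y \<partial>weight_measure W)"
      proof (subst nn_integral_weight_measure, simp, simp, rule nn_integral_mono)
        fix y
        have "G y * ennreal (W y) = m y epowr (b / a)"
          using WN(1)[of y] by (simp add: G_def mult.assoc flip: ennreal_mult)
        then show "A epowr (b / a) * indicator ?Q y \<le> G y * indicator ?Q y * ennreal (W y)"
          using ab Am[of y] by (auto simp: indicator_def intro!: epowr_mono)
      qed
      finally have "A epowr (b / a) * ennreal q / ennreal \<omega> \<le> (\<integral>\<^sup>+y\<in>?Q. G y \<partial>weight_measure W) / ennreal \<omega>"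
        by (rule divide_right_mono_ennreal)
      also have "\<dots> \<le> ?MG x"
        using maximal_upper[OF cl True, where u = G and M = "weight_measure W"] by (simp add: emeasure_weight_measure \<omega>)
      finally have MG: "A epowr (b / a) * ennreal (q / \<omega>) \<le> ?MG x"
        using q \<omega> by (simp add: divide_ennreal flip: ennreal_times_divide)
      \<comment> \<open>The class condition is brought into Muckenhoupt form: (\<nu>/q)^(b/a)
        (\<omega>/q) is at most K^(1/a).\<close>
      have "(\<nu> / q) powr (b / a) \<le> (t powr (1 / b)) powr (b / a)"
        using \<nu>t q \<nu> ab by (intro powr_mono2) (auto simp: divide_le_eq)
      also have "\<dots> = t powr (1 / a)" using ab by (simp add: powr_powr)
      also have "\<dots> \<le> (K / s) powr (1 / a)"
        using st ab by (intro powr_mono2) (auto simp: field_simps)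
      also have "\<dots> = K powr (1 / a) / s powr (1 / a)" using K st by (simp add: powr_divide)
      also have "\<dots> \<le> K powr (1 / a) * (q / \<omega>)"
      proof -
        have "1 / s powr (1 / a) \<le> q / \<omega>" using \<omega>s \<omega> q st by (simp add: field_simps)
        then show ?thesis using mult_left_mono[of "1 / s powr (1 / a)" "q / \<omega>" "K powr (1 / a)"] by simp
      qed
      finally have le: "(\<nu> / q) powr (b / a) \<le> K powr (1 / a) * (q / \<omega>)" .
      have "(A * ennreal (\<nu> / q)) epowr (b / a) = A epowr (b / a) * ennreal ((\<nu> / q) powr (b / a))"
        using ab \<nu> q by (simp add: epowr_mult epowr_ennreal)
      also have "\<dots> \<le> A epowr (b / a) * ennreal (K powr (1 / a) * (q / \<omega>))"
        using le by (intro mult_left_mono ennreal_leI) auto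
      also have "\<dots> = ennreal (K powr (1 / a)) * (A epowr (b / a) * ennreal (q / \<omega>))"
      proof -
        have "ennreal (K powr (1 / a) * (q / \<omega>)) = ennreal (K powr (1 / a)) * ennreal (q / \<omega>)"
          using q \<omega> by (intro ennreal_mult) auto
        then show ?thesis by (simp only: mult_ac)
      qed
      also have "\<dots> \<le> ennreal (K powr (1 / a)) * ?MG x" using MG by (rule mult_left_mono) simp
      finally have "((A * ennreal (\<nu> / q)) epowr (b / a)) epowr (a / b) \<le> (ennreal (K powr (1 / a)) * ?MG x) epowr (a / b)"
        using ab by (intro epowr_mono) auto
      then have "A * ennreal (\<nu> / q) \<le> (ennreal (K powr (1 / a)) * ?MG x) epowr (a / b)"
        using ab by (subst (asm) epowr_epowr) (auto simp: ba)
      moreover have "?I / emeasure lebesgue ?Q = A * ennreal (\<nu> / q)"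
        using q \<nu> by (simp only: I cubes_emeasure[OF Q] q_def[symmetric]) (simp add: divide_ennreal flip: ennreal_times_divide)
      ultimately show ?thesis using True by simp
    qed simp
    then have "maximal lebesgue f x \<le> (ennreal (K powr (1 / a)) * ?MG x) epowr (a / b)"
      unfolding maximal_def by (auto intro!: SUP_least)
    then have "maximal lebesgue f x epowr (b / a) \<le> ((ennreal (K powr (1 / a)) * ?MG x) epowr (a / b)) epowr (b / a)"
      using ab by (intro epowr_mono) auto
    then show ?thesis using ab by (auto simp: epowr_epowr)
  qed
  define C1 where "C1 = K powr (1 / a) * (3 ^ CARD('n)) powr (1 + b / a) * (1 + a / b) / (a / b) * 2 powr (1 + a / b)"
  define C2 where "C2 = K powr (1 / b) * (3 ^ CARD('n)) powr (1 + a / b) * (1 + b / a) / (b / a) * 2 powr (1 + b / a)"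
  have C12: "0 \<le> C1" "0 \<le> C2" using ab by (auto simp: C1_def C2_def)
  have exps: "b / a * (1 + a / b) = 1 + b / a" "b * (1 + a / b) / a = 1 + b / a"
    using ab by (simp_all add: field_simps)
  have "(\<integral>\<^sup>+x. maximal lebesgue f x epowr (1 + b / a) * ennreal (W x) \<partial>lebesgue)
      \<le> (\<integral>\<^sup>+x. ennreal (K powr (1 / a * (1 + a / b))) * (?MG x epowr (1 + a / b) * ennreal (W x)) \<partial>lebesgue)"
  proof (rule nn_integral_mono)
    fix x
    have "maximal lebesgue f x epowr (1 + b / a) = (maximal lebesgue f x epowr (b / a)) epowr (1 + a / b)"
      using ab by (subst epowr_epowr) (auto simp: exps add_pos_pos)
    also have "\<dots> \<le> (ennreal (K powr (1 / a)) * ?MG x) epowr (1 + a / b)"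
      using ab by (intro epowr_mono point) (auto simp: add_pos_pos)
    also have "\<dots> = ennreal (K powr (1 / a * (1 + a / b))) * ?MG x epowr (1 + a / b)"
      using ab by (simp add: epowr_mult add_pos_pos epowr_ennreal powr_powr)
    finally show "maximal lebesgue f x epowr (1 + b / a) * ennreal (W x)
        \<le> ennreal (K powr (1 / a * (1 + a / b))) * (?MG x epowr (1 + a / b) * ennreal (W x))"
      by (simp only: mult.assoc[symmetric]) (rule mult_right_mono, auto)
  qed
  also have "\<dots> = ennreal (K powr (1 / a * (1 + a / b))) * (\<integral>\<^sup>+x. ?MG x epowr (1 + a / b) * ennreal (W x) \<partial>lebesgue)"
    by (rule nn_integral_cmult) simp
  also have "\<dots> \<le> ennreal (K powr (1 / a * (1 + a / b))) * (ennreal C1 * (\<integral>\<^sup>+x. G x epowr (1 + a / b) * ennreal (W x) \<partial>lebesgue))"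
    using maximal_weight_measure_strong[OF v ab, of "1 + a / b" G] ab
    by (intro mult_left_mono) (auto simp: C1_def W_def add_pos_pos)
  also have "(\<integral>\<^sup>+x. G x epowr (1 + a / b) * ennreal (W x) \<partial>lebesgue) = (\<integral>\<^sup>+x. m x epowr (1 + b / a) * ennreal (N x) \<partial>lebesgue)"
  proof (rule nn_integral_cong)
    fix x
    \<comment> \<open>As \<open>1 + a / b\<close> is conjugate to \<open>1 + b / a\<close>, the
      factor \<open>1 / W x\<close> in \<open>G\<close> changes the measure from \<open>W\<close> to
      its dual weight \<open>N\<close>.\<close>
    have "(1 / W x) powr (1 + a / b) * W x = N x"
      using v0[of x] ab unfolding W_def N_def
      by (simp add: powr_divide powr_powr powr_add[symmetric] powr_minus_divide[symmetric] powr_diff[symmetric] field_simps)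
    then show "G x epowr (1 + a / b) * ennreal (W x) = m x epowr (1 + b / a) * ennreal (N x)"
      using ab WN(1)[of x] by (simp add: G_def epowr_mult epowr_epowr exps epowr_ennreal add_pos_pos mult.assoc flip: ennreal_mult)
  qed
  also have "\<dots> \<le> ennreal C2 * (\<integral>\<^sup>+x. (f x * ennreal (1 / N x)) epowr (1 + b / a) * ennreal (N x) \<partial>lebesgue)"
    using maximal_weight_measure_strong[OF weight_class_inverse[OF v] ab(2,1), of "1 + b / a" "\<lambda>x. f x * ennreal (1 / N x)"] ab
    by (simp add: C2_def N_def[abs_def] m_def add_pos_pos)
  also have "(\<integral>\<^sup>+x. (f x * ennreal (1 / N x)) epowr (1 + b / a) * ennreal (N x) \<partial>lebesgue)
      = (\<integral>\<^sup>+x. f x epowr (1 + b / a) * ennreal (W x) \<partial>lebesgue)"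
  proof (rule nn_integral_cong)
    fix x
    \<comment> \<open>Dually N^(1-p) = W for p = 1 + b/a, so the second weighted bound returns to
      the original measure.\<close>
    have "(1 / N x) powr (1 + b / a) * N x = W x"
      using v0[of x] ab unfolding W_def N_def
      by (simp add: powr_divide powr_powr powr_add[symmetric] powr_minus_divide[symmetric] powr_diff[symmetric] field_simps)
    then show "(f x * ennreal (1 / N x)) epowr (1 + b / a) * ennreal (N x) = f x epowr (1 + b / a) * ennreal (W x)"
      using ab WN(2)[of x] by (simp add: epowr_mult epowr_ennreal add_pos_pos mult.assoc flip: ennreal_mult)
  qed
  finally have "(\<integral>\<^sup>+x. maximal lebesgue f x epowr (1 + b / a) * ennreal (W x) \<partial>lebesgue)
    \<le> ennreal (K powr (1 / a * (1 + a / b))) * (ennreal C1 * (ennreal C2 * (\<integral>\<^sup>+x. f x epowr (1 + b / a) * ennreal (W x) \<partial>lebesgue)))"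
    by (auto simp: mult_left_mono)
  also have "\<dots> = ennreal C * (\<integral>\<^sup>+x. f x epowr (1 + b / a) * ennreal (W x) \<partial>lebesgue)"
    using C12 unfolding C_def C1_def[symmetric] C2_def[symmetric]
    by (simp add: ennreal_mult mult.assoc)
  finally show ?thesis .
qed

subsection \<open>The Rubio de Francia algorithm\<close>

text \<open>\<open>maximal\<close> sees only rational cubes, so a general cube has to be enlarged to
  one of comparable length.\<close>

lemma rational_cube_cover:
  fixes a :: "real ^ 'n"
  assumes "0 < l"
  obtains a' l' where "(a', l') \<in> rational_cubes" "cb a l \<subseteq> cb a' l'" "l' \<le> 2 * l"
proof -
  have "\<exists>r\<in>\<rat>. a $ i - l / 2 < r \<and> r < a $ i" for i
    using assms by (intro Rats_dense_in_real) auto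
  then obtain r where r: "\<And>i. r i \<in> \<rat>" "\<And>i. a $ i - l / 2 < r i" "\<And>i. r i < a $ i" by metis
  \<comment> \<open>Lowering the corner by less than \<open>l / 2\<close> is absorbed by any length
    above \<open>3 * l / 2\<close>; the bound \<open>2 * l\<close> leaves room for a
    rational.\<close>
  obtain l' where l': "l' \<in> \<rat>" "3 * l / 2 < l'" "l' < 2 * l"
    using Rats_dense_in_real[of "3 * l / 2" "2 * l"] assms by auto
  show ?thesis
  proof (rule that[of "\<chi> i. r i" l'])
    show "cb a l \<subseteq> cb (\<chi> i. r i) l'"
    proof
      fix x assume x: "x \<in> cb a l"
      show "x \<in> cb (\<chi> i. r i) l'" unfolding mem_cb
      proof
        fix i
        show "(\<chi> i. r i) $ i \<le> x $ i \<and> x $ i \<le> (\<chi> i. r i) $ i + l'"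
          using x r(2,3)[of i] l' by (auto simp: mem_cb dest!: spec[of _ i])
      qed
    qed
  qed (use r l' assms in \<open>auto simp: rational_cubes_def\<close>)
qed

lemma mean_le_maximal:
  fixes h :: "real ^ 'n \<Rightarrow> ennreal"
  assumes Q: "Q \<in> cubes" "x \<in> Q"
  shows "mean h Q \<le> ennreal (2 ^ CARD('n)) * maximal lebesgue h x"
proof -
  obtain a l where al: "Q = cb a l" "0 < l" using Q by (auto elim: cubesE)
  obtain a' l' where r: "(a', l') \<in> rational_cubes" "cb a l \<subseteq> cb a' l'" "l' \<le> 2 * l"
    using rational_cube_cover[OF al(2)] by metis
  have l': "0 < l'" using r by (auto simp: rational_cubes_def)
  have Q': "cb a' l' \<in> cubes" using l' by (rule cb_in_cubes)
  have "(\<integral>\<^sup>+y\<in>Q. h y \<partial>lebesgue) \<le> (\<integral>\<^sup>+y\<in>cb a' l'. h y \<partial>lebesgue)"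
    using r(2) al by (intro nn_integral_mono) (auto simp: indicator_def)
  also have "\<dots> \<le> maximal lebesgue h x * ennreal (measure lebesgue (cb a' l'))"
    using mean_le_iff[OF Q', of h "maximal lebesgue h x"] maximal_upper[OF r(1), of x lebesgue h] r(2) Q al
    by (auto simp: mean_def)
  also have "\<dots> \<le> maximal lebesgue h x * ennreal (2 ^ CARD('n) * measure lebesgue Q)"
  proof (intro mult_left_mono ennreal_leI)
    have "l' ^ CARD('n) \<le> (2 * l) ^ CARD('n)" using l' r(3) by (intro power_mono) auto
    then show "measure lebesgue (cb a' l') \<le> 2 ^ CARD('n) * measure lebesgue Q"
      using l' al by (simp add: measure_cb power_mult_distrib)
  qed simp
  also have "\<dots> = ennreal (2 ^ CARD('n)) * maximal lebesgue h x * ennreal (measure lebesgue Q)"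
    by (simp add: ennreal_mult mult_ac)
  finally show ?thesis using mean_le_iff[OF Q(1)] by auto
qed

text \<open>Monotone convergence inside each average, then a termwise bound by the suprema. It lets
  the operator act on the whole Rubio de Francia series.\<close>

lemma maximal_suminf:
  fixes u :: "nat \<Rightarrow> real ^ 'n \<Rightarrow> ennreal"
  assumes [measurable]: "\<And>k. u k \<in> borel_measurable lebesgue"
  shows "maximal lebesgue (\<lambda>y. \<Sum>k. ennreal (c k) * u k y) x \<le> (\<Sum>k. ennreal (c k) * maximal lebesgue (u k) x)"
  unfolding maximal_def
proof (rule SUP_least, clarify)
  fix a :: "real ^ 'n" and l assume al: "(a, l) \<in> rational_cubes"
  have "(\<integral>\<^sup>+y\<in>cb a l. (\<Sum>k. ennreal (c k) * u k y) \<partial>lebesgue) = (\<integral>\<^sup>+y. (\<Sum>k. ennreal (c k) * (u k y * indicator (cb a l) y)) \<partial>lebesgue)"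
    by (intro nn_integral_cong) (simp flip: ennreal_suminf_multc mult.assoc)
  also have "\<dots> = (\<Sum>k. ennreal (c k) * (\<integral>\<^sup>+y\<in>cb a l. u k y \<partial>lebesgue))"
    by (subst nn_integral_suminf) (auto simp: nn_integral_cmult)
  finally have "indicator (cb a l) x * ((\<integral>\<^sup>+y\<in>cb a l. (\<Sum>k. ennreal (c k) * u k y) \<partial>lebesgue) / emeasure lebesgue (cb a l))
     = (\<Sum>k. ennreal (c k) * (indicator (cb a l) x * ((\<integral>\<^sup>+y\<in>cb a l. u k y \<partial>lebesgue) / emeasure lebesgue (cb a l))))"
    by (simp add: ennreal_times_divide mult_ac flip: ennreal_suminf_divide ennreal_suminf_cmult)
  also have "\<dots> \<le> (\<Sum>k. ennreal (c k) * maximal lebesgue (u k) x)"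
    unfolding maximal_def using al
    by (intro suminf_le mult_left_mono) (auto intro!: SUP_upper2[OF al])
  finally show "indicator (cb a l) x * ((\<integral>\<^sup>+y\<in>cb a l. (\<Sum>k. ennreal (c k) * u k y) \<partial>lebesgue) / emeasure lebesgue (cb a l))
     \<le> (\<Sum>k. ennreal (c k) * (SUP (a, l)\<in>rational_cubes. indicator (cb a l) x * ((\<integral>\<^sup>+y\<in>cb a l. u k y \<partial>lebesgue) / emeasure lebesgue (cb a l))))"
    by (simp add: maximal_def)
qed

lemma suminf_ennreal_half: "(\<Sum>k. ennreal ((1/2) ^ k)) = ennreal 2"
proof (rule suminf_ennreal_eq)
  show "(\<lambda>k. (1/2 :: real) ^ k) sums 2" using geometric_sums[of "1/2 :: real"] by simp
qed simp

text \<open>Bounding a series by its largest term against a geometric one replaces Minkowski's inequality.\<close>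

lemma suminf_epowr_le:
  fixes y :: "nat \<Rightarrow> ennreal"
  assumes p: "0 < p"
  shows "(\<Sum>k. y k) epowr p \<le> ennreal (2 powr p) * (\<Sum>k. (ennreal (2 ^ k) * y k) epowr p)"
proof -
  let ?S = "(\<Sum>k. (ennreal (2 ^ k) * y k) epowr p) epowr (1 / p)"
  have le: "ennreal (2 ^ k) * y k \<le> ?S" for k
  proof -
    have "(ennreal (2 ^ k) * y k) epowr p \<le> (\<Sum>k. (ennreal (2 ^ k) * y k) epowr p)"
      using sum_le_suminf[of "\<lambda>k. (ennreal (2 ^ k) * y k) epowr p" "{k}"] by (simp add: summableI)
    then have "((ennreal (2 ^ k) * y k) epowr p) epowr (1 / p) \<le> ?S" using p by (intro epowr_mono) auto
    then show ?thesis using p by (simp add: epowr_epowr)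
  qed
  have "y k \<le> ennreal ((1/2) ^ k) * ?S" for k
  proof -
    have "ennreal ((1/2) ^ k) * ennreal (2 ^ k) = ennreal ((1/2) ^ k * 2 ^ k)"
      by (rule ennreal_mult[symmetric]) auto
    also have "(1/2) ^ k * 2 ^ k = (1 :: real)" by (simp add: power_one_over)
    finally have "y k = (ennreal ((1/2) ^ k) * ennreal (2 ^ k)) * y k" by (simp only: ennreal_1 mult_1)
    also have "\<dots> = ennreal ((1/2) ^ k) * (ennreal (2 ^ k) * y k)" by (rule mult.assoc)
    also have "\<dots> \<le> ennreal ((1/2) ^ k) * ?S" using le by (rule mult_left_mono) (rule zero_le)
    finally show ?thesis .
  qed
  then have "(\<Sum>k. y k) \<le> (\<Sum>k. ennreal ((1/2) ^ k) * ?S)" by (intro suminf_le) (auto intro: summableI)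
  also have "\<dots> = (\<Sum>k. ennreal ((1/2) ^ k)) * ?S" by (rule ennreal_suminf_multc)
  also have "(\<Sum>k. ennreal ((1/2) ^ k)) = ennreal 2"
    by (rule suminf_ennreal_half)
  finally have "(\<Sum>k. y k) epowr p \<le> (ennreal 2 * ?S) epowr p" using p by (intro epowr_mono) auto
  also have "\<dots> = ennreal (2 powr p) * (\<Sum>k. (ennreal (2 ^ k) * y k) epowr p)"
    using p epowr_ennreal[of 2 p] by (simp add: epowr_mult epowr_epowr)
  finally show ?thesis .
qed

text \<open>\<open>h\<close> is the sum of \<open>c ^ k\<close> times the \<open>k\<close>-fold
  iterated maximal function of \<open>F\<close>. The term \<open>k = 0\<close> gives the majorant,
  applying the operator shifts the series at the price \<open>1 / c\<close>, and a small
  \<open>c\<close> makes the norms summable. \<open>C\<close> is fixed before the weight and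
  \<open>F\<close>.\<close>

theorem rubio_de_francia:
  fixes a b K :: real
  assumes ab: "0 < a" "0 < b"
  shows "\<exists>C>0. \<forall>v\<in>weight_class a b K. \<forall>F\<in>borel_measurable lebesgue.
    \<exists>h\<in>borel_measurable lebesgue. (\<forall>x :: real ^ 'n. F x \<le> h x) \<and>
      (\<integral>\<^sup>+x. h x epowr (1 + b / a) * ennreal (v x powr (1 / a)) \<partial>lebesgue)
        \<le> ennreal C * (\<integral>\<^sup>+x. F x epowr (1 + b / a) * ennreal (v x powr (1 / a)) \<partial>lebesgue) \<and>
      (\<forall>Q\<in>cubes. \<forall>x\<in>Q. mean h Q \<le> ennreal C * h x)"
proof -
  define p where "p = 1 + b / a"
  have p: "1 < p" using ab by (simp add: p_def)
  obtain B0 where B0: "\<And>v f. v \<in> weight_class a b K \<Longrightarrow> f \<in> borel_measurable (lebesgue :: (real ^ 'n) measure) \<Longrightarrow>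
      (\<integral>\<^sup>+x. maximal lebesgue f x epowr p * ennreal (v x powr (1 / a)) \<partial>lebesgue)
      \<le> ennreal B0 * (\<integral>\<^sup>+x. f x epowr p * ennreal (v x powr (1 / a)) \<partial>lebesgue)"
    by (rule that, rule maximal_weighted_bound[OF _ ab, folded p_def])
  \<comment> \<open>The maximum with 1 ensures \<open>2 * c < 1\<close>, hence
    \<open>(2 * c) powr p \<le> 2 * c\<close>. The factor \<open>2 ^ k\<close> from
    \<open>suminf_epowr_le\<close> and the growth \<open>B ^ k\<close> of the iterates are then
    beaten, leaving \<open>(1/2) ^ k\<close>; this is the origin of the 4 in
    \<open>c\<close>.\<close>
  define B where "B = max 1 B0"
  define c where "c = 1 / (4 * B)"
  have B: "1 \<le> B" and c: "0 < c" by (auto simp: B_def c_def)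
  let ?C = "max (2 powr p * 2) (2 ^ CARD('n) * (1 / c))"
  show ?thesis
  proof (intro exI[of _ ?C] conjI ballI)
    show "0 < ?C" by (auto simp: less_max_iff_disj)
  next
    fix v :: "real ^ 'n \<Rightarrow> real" and F :: "real ^ 'n \<Rightarrow> ennreal"
    assume v: "v \<in> weight_class a b K" and F [measurable]: "F \<in> borel_measurable lebesgue"
    note [measurable] = weight_classD(1)[OF v]
    let ?W = "\<lambda>x. ennreal (v x powr (1 / a))"
    let ?I = "\<integral>\<^sup>+x. F x epowr p * ?W x \<partial>lebesgue"
    define u where "u k = (maximal lebesgue ^^ k) F" for k
    have u_Suc: "u (Suc k) = maximal lebesgue (u k)" and u_0: "u 0 = F" for k by (simp_all add: u_def)
    have [measurable]: "u k \<in> borel_measurable lebesgue" for k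
      by (induction k) (auto simp: u_Suc u_0 intro: measurable_maximal)
    define h where "h x = (\<Sum>k. ennreal (c ^ k) * u k x)" for x
    have [measurable]: "h \<in> borel_measurable lebesgue" unfolding h_def by measurable
    have uI: "(\<integral>\<^sup>+x. u k x epowr p * ?W x \<partial>lebesgue) \<le> ennreal (B ^ k) * ?I" for k
    proof (induction k)
      case (Suc k)
      have "(\<integral>\<^sup>+x. u (Suc k) x epowr p * ?W x \<partial>lebesgue) \<le> ennreal B0 * (\<integral>\<^sup>+x. u k x epowr p * ?W x \<partial>lebesgue)"
        unfolding u_Suc by (rule B0[OF v]) simp
      also have "\<dots> \<le> ennreal B * (ennreal (B ^ k) * ?I)"
        using Suc by (intro mult_mono ennreal_leI) (auto simp: B_def)
      also have "\<dots> = ennreal (B ^ Suc k) * ?I" using B by (simp add: ennreal_mult mult.assoc)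
      finally show ?case .
    qed (simp add: u_0)
    have hI: "(\<integral>\<^sup>+x. h x epowr p * ?W x \<partial>lebesgue) \<le> ennreal (2 powr p * 2) * ?I"
    proof -
      let ?d = "\<lambda>k. (2 ^ k * c ^ k) powr p"
      have d: "?d k * B ^ k \<le> (1/2) ^ k" for k
      proof -
        have "?d k = ((2 * c) powr p) ^ k"
        proof -
          have "?d k = ((2 * c) powr real k) powr p" using c by (simp add: powr_realpow power_mult_distrib)
          also have "\<dots> = ((2 * c) powr p) powr real k" by (simp add: powr_powr mult.commute)
          finally show ?thesis using c by (simp add: powr_realpow)
        qed
        also have "(2 * c) powr p \<le> (2 * c) powr 1"
          using c B p by (intro powr_mono') (auto simp: c_def field_simps)
        then have "((2 * c) powr p) ^ k * B ^ k \<le> (2 * c) ^ k * B ^ k"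
          using c B by (intro mult_right_mono power_mono) auto
        also have "\<dots> = (1/2) ^ k" using B by (simp add: c_def flip: power_mult_distrib)
        finally show ?thesis .
      qed
      have "(\<integral>\<^sup>+x. h x epowr p * ?W x \<partial>lebesgue)
          \<le> (\<integral>\<^sup>+x. ennreal (2 powr p) * (\<Sum>k. ennreal (?d k) * (u k x epowr p * ?W x)) \<partial>lebesgue)"
      proof (rule nn_integral_mono)
        fix x
        have "h x epowr p \<le> ennreal (2 powr p) * (\<Sum>k. (ennreal (2 ^ k) * (ennreal (c ^ k) * u k x)) epowr p)"
          unfolding h_def using p by (intro suminf_epowr_le) auto
        also have "(\<lambda>k. (ennreal (2 ^ k) * (ennreal (c ^ k) * u k x)) epowr p) = (\<lambda>k. ennreal (?d k) * u k x epowr p)"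
          using p c by (intro ext) (simp add: mult.assoc[symmetric] epowr_mult epowr_ennreal flip: ennreal_mult)
        finally have "h x epowr p * ?W x \<le> ennreal (2 powr p) * (\<Sum>k. ennreal (?d k) * u k x epowr p) * ?W x"
          by (rule mult_right_mono) simp
        then show "h x epowr p * ?W x \<le> ennreal (2 powr p) * (\<Sum>k. ennreal (?d k) * (u k x epowr p * ?W x))"
          by (simp add: mult.assoc flip: ennreal_suminf_multc)
      qed
      also have "\<dots> = ennreal (2 powr p) * (\<Sum>k. ennreal (?d k) * (\<integral>\<^sup>+x. u k x epowr p * ?W x \<partial>lebesgue))"
        by (simp add: nn_integral_cmult nn_integral_suminf)
      also have "\<dots> \<le> ennreal (2 powr p) * (\<Sum>k. ennreal ((1/2) ^ k) * ?I)"
      proof (intro mult_left_mono suminf_le)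
        fix k
        have "ennreal (?d k) * (\<integral>\<^sup>+x. u k x epowr p * ?W x \<partial>lebesgue) \<le> ennreal (?d k) * (ennreal (B ^ k) * ?I)"
          by (intro mult_left_mono uI) simp
        also have "\<dots> = ennreal (?d k * B ^ k) * ?I" using B by (simp add: ennreal_mult mult.assoc)
        also have "\<dots> \<le> ennreal ((1/2) ^ k) * ?I" using d by (intro mult_right_mono ennreal_leI) auto
        finally show "ennreal (?d k) * (\<integral>\<^sup>+x. u k x epowr p * ?W x \<partial>lebesgue) \<le> ennreal ((1/2) ^ k) * ?I" .
      qed (auto intro: summableI)
      also have "(\<Sum>k. ennreal ((1/2) ^ k) * ?I) = (\<Sum>k. ennreal ((1/2) ^ k)) * ?I" by (rule ennreal_suminf_multc)
      also have "(\<Sum>k. ennreal ((1/2) ^ k)) = ennreal 2"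
        by (rule suminf_ennreal_half)
      finally show ?thesis by (simp add: ennreal_mult mult.assoc)
    qed
    show "\<exists>h\<in>borel_measurable lebesgue. (\<forall>x. F x \<le> h x) \<and>
      (\<integral>\<^sup>+x. h x epowr (1 + b / a) * ?W x \<partial>lebesgue)
        \<le> ennreal ?C * (\<integral>\<^sup>+x. F x epowr (1 + b / a) * ?W x \<partial>lebesgue) \<and>
      (\<forall>Q\<in>cubes. \<forall>x\<in>Q. mean h Q \<le> ennreal ?C * h x)"
    proof (intro bexI[of _ h] conjI allI ballI)
      fix x show "F x \<le> h x"
        using sum_le_suminf[of "\<lambda>k. ennreal (c ^ k) * u k x" "{0}"] by (simp add: summableI u_0 h_def)
    next
      have "ennreal (2 powr p * 2) * ?I \<le> ennreal ?C * ?I"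
        by (intro mult_right_mono ennreal_leI) auto
      then show "(\<integral>\<^sup>+x. h x epowr (1 + b / a) * ?W x \<partial>lebesgue)
        \<le> ennreal ?C * (\<integral>\<^sup>+x. F x epowr (1 + b / a) * ?W x \<partial>lebesgue)"
        using hI unfolding p_def[symmetric] by (rule order_trans[rotated])
    next
      fix Q :: "(real ^ 'n) set" and x assume Q: "Q \<in> cubes" "x \<in> Q"
      have "maximal lebesgue h x \<le> (\<Sum>k. ennreal (c ^ k) * u (Suc k) x)"
        unfolding h_def u_Suc by (rule maximal_suminf) simp
      also have "(\<lambda>k. ennreal (c ^ k) * u (Suc k) x) = (\<lambda>k. ennreal (1 / c) * (ennreal (c ^ Suc k) * u (Suc k) x))"
        using c by (intro ext) (simp add: mult.assoc[symmetric] flip: ennreal_mult)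
      also have "(\<Sum>k. ennreal (1 / c) * (ennreal (c ^ Suc k) * u (Suc k) x))
          = ennreal (1 / c) * (\<Sum>k. ennreal (c ^ Suc k) * u (Suc k) x)" by (rule ennreal_suminf_cmult)
      also have "\<dots> \<le> ennreal (1 / c) * h x"
      proof (intro mult_left_mono)
        show "(\<Sum>k. ennreal (c ^ Suc k) * u (Suc k) x) \<le> h x"
          unfolding h_def using suminf_offset[of "\<lambda>k. ennreal (c ^ k) * u k x" 1] by (simp add: summableI)
      qed simp
      finally have "mean h Q \<le> ennreal (2 ^ CARD('n)) * (ennreal (1 / c) * h x)"
        using mean_le_maximal[OF Q, of h] by (meson mult_left_mono order_trans zero_le)
      also have "\<dots> = ennreal (2 ^ CARD('n) * (1 / c)) * h x"
        using c by (simp add: ennreal_mult mult.assoc del: times_divide_eq_right)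
      also have "\<dots> \<le> ennreal ?C * h x" by (intro mult_right_mono ennreal_leI) auto
      finally show "mean h Q \<le> ennreal ?C * h x" .
    qed simp
  qed
qed

subsection \<open>Calculus of two-sided weight classes\<close>

lemma mean_bound_scale:
  assumes Q: "Q \<in> cubes" and [measurable]: "u' \<in> borel_measurable lebesgue"
    and u: "\<And>x. 0 \<le> u x" "\<And>x. 0 \<le> u' x"
    and le: "AE x in lebesgue. x \<in> Q \<longrightarrow> u x \<le> c * u' x"
    and bound: "mean_bound a u' Q s" and c: "0 \<le> c" and s: "0 \<le> s" and a: "0 \<le> a"
  shows "mean_bound a u Q (c * s)"
proof (cases "a = 0")
  case True
  have "AE x in lebesgue. x \<in> Q \<longrightarrow> u' x \<le> s" using bound True by (simp add: mean_bound_def)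
  with le have "AE x in lebesgue. x \<in> Q \<longrightarrow> u x \<le> c * s"
  proof eventually_elim
    case (elim x)
    then show ?case using c mult_left_mono[of "u' x" s c] by auto
  qed
  then show ?thesis using True by (simp add: mean_bound_def)
next
  case False
  have "avg (\<lambda>x. u x powr (1 / a)) Q \<le> avg (\<lambda>x. c powr (1 / a) * u' x powr (1 / a)) Q"
  proof (rule avg_mono_AE)
    show "AE x in lebesgue. x \<in> Q \<longrightarrow> u x powr (1 / a) \<le> c powr (1 / a) * u' x powr (1 / a)"
      using le
    proof eventually_elim
      case (elim x)
      show ?case
      proof
        assume "x \<in> Q"
        then have "u x powr (1 / a) \<le> (c * u' x) powr (1 / a)"
          using elim u a by (intro powr_mono2) auto
        then show "u x powr (1 / a) \<le> c powr (1 / a) * u' x powr (1 / a)"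
          using c u by (simp add: powr_mult)
      qed
    qed
  qed
  also have "\<dots> = ennreal (c powr (1 / a)) * avg (\<lambda>x. u' x powr (1 / a)) Q"
    using Q by (intro avg_cmult) auto
  also have "\<dots> \<le> ennreal (c powr (1 / a)) * ennreal (s powr (1 / a))"
    using bound False by (intro mult_left_mono) (auto simp: mean_bound_def)
  also have "\<dots> = ennreal ((c * s) powr (1 / a))"
    using c s by (simp add: powr_mult ennreal_mult)
  finally show ?thesis using False by (simp add: mean_bound_def)
qed

text \<open>Hoelder against the constant 1: the normalised norm of exponent \<open>1 / a\<close> can
  only decrease as \<open>a\<close> grows.\<close>

lemma mean_bound_mono_exponent:
  assumes Q: "Q \<in> cubes" and [measurable]: "u \<in> borel_measurable lebesgue"
    and u: "\<And>x. 0 \<le> u x" and bound: "mean_bound a u Q s" and s: "0 < s" and a: "0 \<le> a" "a \<le> a'"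
  shows "mean_bound a' u Q s"
proof (cases "a' = 0")
  case True
  then show ?thesis using bound a by auto
next
  case a': False
  have "avg (\<lambda>x. u x powr (1 / a')) Q \<le> ennreal (s powr (1 / a'))"
  proof (cases "a = 0")
    case True
    have "avg (\<lambda>x. u x powr (1 / a')) Q \<le> avg (\<lambda>_. s powr (1 / a') * 1) Q"
    proof (rule avg_mono_AE)
      have "AE x in lebesgue. x \<in> Q \<longrightarrow> u x \<le> s" using bound True by (simp add: mean_bound_def)
      then show "AE x in lebesgue. x \<in> Q \<longrightarrow> u x powr (1 / a') \<le> s powr (1 / a') * 1"
        by eventually_elim (use u a in \<open>auto intro!: powr_mono2\<close>)
    qed
    also have "\<dots> = ennreal (s powr (1 / a'))" using Q by (subst avg_cmult) (auto simp: avg_const_one)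
    finally show ?thesis .
  next
    case False
    with a have a0: "0 < a" by simp
    have "avg (\<lambda>x. (u x powr (1 / a)) powr (a / a') * 1 powr (1 - a / a')) Q
        \<le> ennreal ((s powr (1 / a)) powr (a / a') * 1 powr (1 - a / a'))"
      using Q s bound False a a0 by (intro avg_Holder) (auto simp: mean_bound_def avg_const_one)
    then show ?thesis using a0 by (simp add: powr_powr)
  qed
  then show ?thesis using a' by (simp add: mean_bound_def)
qed

text \<open>Enlarging the domain from \<open>R\<close> to \<open>Q\<close> costs a factor
  \<open>m\<close> in the average of the power, hence \<open>m powr a\<close> in the norm.\<close>

lemma mean_bound_subcube:
  assumes Q: "Q \<in> cubes" "R \<in> cubes" "R \<subseteq> Q" "measure lebesgue Q \<le> m * measure lebesgue R"
    and bound: "mean_bound a u Q s" and s: "0 \<le> s" and a: "0 \<le> a" and m: "0 < m"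
  shows "mean_bound a u R (m powr a * s)"
proof (cases "a = 0")
  case True
  then show ?thesis using bound Q(3) m by (auto simp: mean_bound_def elim!: eventually_mono)
next
  case False
  have "wmeas (\<lambda>x. u x powr (1 / a)) R \<le> wmeas (\<lambda>x. u x powr (1 / a)) Q" using Q(3) by (rule wmeas_mono)
  also have "\<dots> \<le> ennreal (s powr (1 / a) * measure lebesgue Q)"
    using bound False Q(1) by (simp add: mean_bound_def avg_le_iff)
  also have "\<dots> \<le> ennreal (s powr (1 / a) * (m * measure lebesgue R))"
    using Q(4) by (intro ennreal_leI mult_left_mono) auto
  also have "s powr (1 / a) * (m * measure lebesgue R) = (m powr a * s) powr (1 / a) * measure lebesgue R"
    using s m False by (simp add: powr_mult powr_powr)
  finally show ?thesis using False Q(2) by (simp add: mean_bound_def avg_le_iff)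
qed

text \<open>Hoelder applied to the factorisation of 1 into equal powers of \<open>v\<close> and
  \<open>1 / v\<close>. It is the device that later turns a bound on \<open>s * t\<close> into a
  bound of \<open>s\<close> by the average of \<open>v\<close>.\<close>

lemma mean_bound_inverse:
  assumes Q: "Q \<in> cubes" and [measurable]: "v \<in> borel_measurable lebesgue" and v: "\<And>x. 0 < v x"
    and bound: "mean_bound b (\<lambda>x. 1 / v x) Q t" and t: "0 < t" and b: "0 \<le> b"
    and x: "avg v Q \<le> ennreal x" "0 < x"
  shows "1 \<le> x * t"
proof -
  \<comment> \<open>Passing to a positive parameter covers the essential supremum
    \<open>b = 0\<close> without a separate case.\<close>
  define b' where "b' = b + 1"
  have b': "0 < b'" "b \<le> b'" using b by (auto simp: b'_def)
  have "mean_bound b' (\<lambda>x. 1 / v x) Q t"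
    using mean_bound_mono_exponent[OF Q _ _ bound t b b'(2)] v by (auto simp: less_imp_le)
  then have "avg (\<lambda>x. v x powr (1 / (1 + b')) * ((1 / v x) powr (1 / b')) powr (b' / (1 + b'))) Q
      \<le> ennreal (x powr (1 / (1 + b')) * (t powr (1 / b')) powr (b' / (1 + b')))"
    using Q x b' t v
    by (intro avg_Holder) (auto simp: mean_bound_def less_imp_le add_divide_distrib[symmetric])
  also have "(\<lambda>x. v x powr (1 / (1 + b')) * ((1 / v x) powr (1 / b')) powr (b' / (1 + b'))) = (\<lambda>_. 1)"
    using v b' by (intro ext) (simp add: powr_powr powr_divide less_imp_neq[THEN not_sym])
  also have "x powr (1 / (1 + b')) * (t powr (1 / b')) powr (b' / (1 + b')) = (x * t) powr (1 / (1 + b'))"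
    using x t b' by (simp add: powr_powr powr_mult)
  finally have "1 \<le> (x * t) powr (1 / (1 + b'))" using Q by (simp add: avg_const_one)
  then have "1 powr (1 + b') \<le> ((x * t) powr (1 / (1 + b'))) powr (1 + b')"
    using b' by (intro powr_mono2) auto
  then show ?thesis using b' x t by (simp add: powr_powr)
qed

lemma weight_class_mono:
  fixes v :: "real ^ 'n \<Rightarrow> real"
  assumes v: "v \<in> weight_class a b K" and "0 \<le> a" "a \<le> a'" "0 \<le> b" "b \<le> b'" "K \<le> K'"
  shows "v \<in> weight_class a' b' K'"
proof -
  note [measurable] = weight_classD(1)[OF v]
  note v0 = weight_classD(2)[OF v]
  have "\<exists>s t. 0 < s \<and> 0 < t \<and> s * t \<le> K' \<and> mean_bound a' v Q s \<and> mean_bound b' (\<lambda>x. 1 / v x) Q t"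
    if Q: "Q \<in> cubes" for Q
  proof -
    obtain s t where st: "0 < s" "0 < t" "s * t \<le> K" "mean_bound a v Q s" "mean_bound b (\<lambda>x. 1 / v x) Q t"
      by (rule weight_classE[OF v Q])
    have "mean_bound a' v Q s"
      using Q v0 st assms by (intro mean_bound_mono_exponent[of Q v a s a']) (auto simp: less_imp_le)
    moreover have "mean_bound b' (\<lambda>x. 1 / v x) Q t"
      using Q v0 st assms by (intro mean_bound_mono_exponent[of Q _ b t b']) (auto simp: less_imp_le)
    ultimately show ?thesis using st assms by (intro exI[of _ s] exI[of _ t]) auto
  qed
  then show ?thesis using v0 by (auto simp: weight_class_def)
qed

lemma weight_class_comparable:
  fixes v :: "real ^ 'n \<Rightarrow> real"
  assumes v: "v \<in> weight_class a b K" and ab: "0 \<le> a" "0 \<le> b" and c: "0 < c1" "0 < c2"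
    and [measurable]: "v' \<in> borel_measurable lebesgue" and v': "\<And>x. c1 * v x \<le> v' x" "\<And>x. v' x \<le> c2 * v x"
  shows "v' \<in> weight_class a b (c2 / c1 * K)"
proof -
  note [measurable] = weight_classD(1)[OF v]
  note v0 = weight_classD(2)[OF v]
  have v'0: "0 < v' x" for x using mult_pos_pos[OF c(1) v0[of x]] v'(1)[of x] by linarith
  have inv: "1 / v' x \<le> 1 / c1 * (1 / v x)" for x
    using v'(1)[of x] v'0[of x] v0[of x] c by (simp add: divide_left_mono)
  have "\<exists>s t. 0 < s \<and> 0 < t \<and> s * t \<le> c2 / c1 * K \<and> mean_bound a v' Q s \<and> mean_bound b (\<lambda>x. 1 / v' x) Q t"
    if Q: "Q \<in> cubes" for Q
  proof -
    obtain s t where st: "0 < s" "0 < t" "s * t \<le> K" "mean_bound a v Q s" "mean_bound b (\<lambda>x. 1 / v x) Q t"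
      by (rule weight_classE[OF v Q])
    have "mean_bound a v' Q (c2 * s)"
      using Q v0 v'0 st ab c v'(2) by (intro mean_bound_scale[of Q v v' c2 a s]) (auto simp: less_imp_le)
    moreover have "mean_bound b (\<lambda>x. 1 / v' x) Q (1 / c1 * t)"
      using Q v0 v'0 st ab c inv
      by (intro mean_bound_scale[of Q "\<lambda>x. 1 / v x" "\<lambda>x. 1 / v' x" "1 / c1" b t]) (auto simp: less_imp_le)
    moreover have "c2 * s * (1 / c1 * t) \<le> c2 / c1 * K"
      using mult_left_mono[OF st(3), of "c2 / c1"] c by (simp add: mult_ac)
    ultimately show ?thesis using st c by (intro exI[of _ "c2 * s"] exI[of _ "1 / c1 * t"]) auto
  qed
  then show ?thesis using v'0 by (auto simp: weight_class_def)
qed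

lemma AE_cube_ex:
  assumes "Q \<in> cubes" "AE x in lebesgue. x \<in> Q \<longrightarrow> P x"
  shows "\<exists>x\<in>Q. P x"
proof (rule ccontr)
  assume "\<not> ?thesis"
  with assms(2) have "AE x in lebesgue. x \<notin> Q" by (auto elim!: eventually_mono)
  then have "emeasure lebesgue Q = 0"
    using assms(1) by (subst (asm) AE_iff_measurable[of Q]) auto
  then show False using cubes_measure_pos[OF assms(1)] by (simp add: measure_def del: emeasure_completion)
qed

text \<open>A Jones-type factorisation step. On a cube \<open>h\<close> is a.e. at least its average
  divided by \<open>C\<close>, so \<open>h powr - \<delta>\<close> can be pulled out of the first
  norm as a constant. In the second norm \<open>h powr \<delta>\<close> and a power of
  \<open>1 / u\<close> are combined by Hoelder, and \<open>b0\<close> is the exponent for which the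
  two Hoelder weights add up to 1.\<close>

lemma weight_class_A1_factor:
  fixes u h :: "real ^ 'n \<Rightarrow> real"
  assumes u: "u \<in> weight_class a b K" and ab: "0 < a" "0 < b"
    and [measurable]: "h \<in> borel_measurable lebesgue" and h: "\<And>x. 0 < h x"
    and A1: "\<And>Q. Q \<in> cubes \<Longrightarrow> AE x in lebesgue. x \<in> Q \<longrightarrow> avg h Q \<le> ennreal (C * h x)" and C: "0 < C"
    and \<delta>: "0 < \<delta>" and a0: "0 \<le> a0" and b0: "b0 = \<delta> + a0 * b / a"
  shows "(\<lambda>x. h x powr - \<delta> * u x powr (a0 / a)) \<in> weight_class a0 b0 (C powr \<delta> * K powr (a0 / a))"
proof -
  note [measurable] = weight_classD(1)[OF u]
  note u0 = weight_classD(2)[OF u]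
  have K: "0 < K" using u by (rule weight_class_const_pos)
  let ?v = "\<lambda>x. h x powr - \<delta> * u x powr (a0 / a)"
  have v0: "0 < ?v x" for x using h[of x] u0[of x] by simp
  have b0pos: "0 < b0" using \<delta> a0 ab by (simp add: b0 add_pos_nonneg)
  have "\<exists>s t. 0 < s \<and> 0 < t \<and> s * t \<le> C powr \<delta> * K powr (a0 / a) \<and> mean_bound a0 ?v Q s \<and> mean_bound b0 (\<lambda>x. 1 / ?v x) Q t"
    if Q: "Q \<in> cubes" for Q
  proof -
    obtain s t where st: "0 < s" "0 < t" "s * t \<le> K"
      and sb: "mean_bound a u Q s" and tb: "mean_bound b (\<lambda>x. 1 / u x) Q t"
      by (rule weight_classE[OF u Q])
    obtain y where "avg h Q \<le> ennreal (C * h y)" using AE_cube_ex[OF Q A1[OF Q]] by auto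
    then have fin: "avg h Q < top" by (rule le_less_trans) simp
    have "0 < wmeas h Q"
      using h Q cubes_measure_pos[OF Q] by (intro wmeas_pos) (auto simp: h[THEN less_imp_neq, THEN not_sym])
    then have "0 < avg h Q" using Q cubes_emeasure[OF Q] by (simp add: avg_def ennreal_zero_less_divide)
    with fin obtain m where m: "avg h Q = ennreal m" "0 < m" by (cases "avg h Q") auto
    have "AE x in lebesgue. x \<in> Q \<longrightarrow> m / C \<le> h x"
      using A1[OF Q]
    proof eventually_elim
      case (elim x)
      have "0 \<le> C * h x" using C h[of x] by simp
      then show ?case using elim C by (auto simp: m divide_le_eq mult.commute)
    qed
    then have le: "AE x in lebesgue. x \<in> Q \<longrightarrow> ?v x \<le> (m / C) powr - \<delta> * u x powr (a0 / a)"
      by eventually_elim (use m C \<delta> in \<open>auto intro!: mult_right_mono powr_mono2'\<close>)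
    have bound1: "mean_bound a0 (\<lambda>x. u x powr (a0 / a)) Q (s powr (a0 / a))"
      using sb ab u0 a0 st by (auto simp: mean_bound_def powr_powr less_imp_neq[THEN not_sym])
    have "mean_bound a0 ?v Q ((m / C) powr - \<delta> * s powr (a0 / a))"
      using Q le bound1 a0 by (intro mean_bound_scale) (auto simp: less_imp_le[OF v0])
    moreover have "mean_bound b0 (\<lambda>x. 1 / ?v x) Q (m powr \<delta> * t powr (a0 / a))"
    proof -
      let ?\<alpha> = "\<delta> / b0" and ?\<beta> = "a0 * b / a / b0"
      have "avg (\<lambda>x. h x powr ?\<alpha> * ((1 / u x) powr (1 / b)) powr ?\<beta>) Q \<le> ennreal (m powr ?\<alpha> * (t powr (1 / b)) powr ?\<beta>)"
      proof (rule avg_Holder)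
        have "?\<alpha> + ?\<beta> = (\<delta> + a0 * b / a) / b0" by (rule add_divide_distrib[symmetric])
        then show "?\<alpha> + ?\<beta> = 1" using b0pos by (simp only: b0[symmetric]) simp
      qed (use Q m st tb ab a0 \<delta> b0pos h in \<open>auto simp: mean_bound_def less_imp_le\<close>)
      also have "(\<lambda>x. h x powr ?\<alpha> * ((1 / u x) powr (1 / b)) powr ?\<beta>) = (\<lambda>x. (1 / ?v x) powr (1 / b0))"
      proof
        fix x
        have "1 / ?v x = h x powr \<delta> * (1 / u x) powr (a0 / a)"
          using u0[of x] h[of x] by (simp add: powr_minus powr_divide field_simps)
        then show "h x powr ?\<alpha> * ((1 / u x) powr (1 / b)) powr ?\<beta> = (1 / ?v x) powr (1 / b0)"
          using u0[of x] h[of x] ab by (simp add: powr_mult powr_powr)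
      qed
      also have "m powr ?\<alpha> * (t powr (1 / b)) powr ?\<beta> = (m powr \<delta> * t powr (a0 / a)) powr (1 / b0)"
        using m st ab by (simp add: powr_mult powr_powr)
      finally show ?thesis using b0pos by (simp add: mean_bound_def)
    qed
    \<comment> \<open>The average \<open>m\<close> cancels between the two bounds, leaving only
      \<open>C\<close> and \<open>K\<close>.\<close>
    moreover have "(m / C) powr - \<delta> * s powr (a0 / a) * (m powr \<delta> * t powr (a0 / a)) \<le> C powr \<delta> * K powr (a0 / a)"
    proof -
      have "(m / C) powr - \<delta> * m powr \<delta> = C powr \<delta>"
        using m C by (simp add: powr_divide powr_minus field_simps)
      moreover have "s powr (a0 / a) * t powr (a0 / a) \<le> K powr (a0 / a)"
        using st a0 ab by (subst powr_mult[symmetric]) (auto intro!: powr_mono2)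
      moreover have "(m / C) powr - \<delta> * s powr (a0 / a) * (m powr \<delta> * t powr (a0 / a))
          = ((m / C) powr - \<delta> * m powr \<delta>) * (s powr (a0 / a) * t powr (a0 / a))" by (simp only: mult_ac)
      ultimately show ?thesis by (metis mult_left_mono powr_ge_zero)
    qed
    ultimately show ?thesis using m C st
      by (intro exI[of _ "(m / C) powr - \<delta> * s powr (a0 / a)"] exI[of _ "m powr \<delta> * t powr (a0 / a)"]) auto
  qed
  then show ?thesis using v0 by (auto simp: weight_class_def)
qed


subsection \<open>Extrapolation\<close>

text \<open>Serves two purposes in extrapolation: adding a multiple of \<open>\<psi>\<close> makes a
  function strictly positive at a controlled cost, and cutting a function off where it exceeds a
  multiple of \<open>\<psi>\<close> makes it integrable.\<close>

lemma positive_integrable_function: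
  obtains \<psi> :: "real ^ 'n \<Rightarrow> real" where "\<psi> \<in> borel_measurable lebesgue" "\<And>x. 0 < \<psi> x"
    "(\<integral>\<^sup>+x. \<psi> x \<partial>lebesgue) \<le> 1"
proof -
  interpret L: sigma_finite_measure "lebesgue :: (real ^ 'n) measure" by (rule sigma_finite_lebesgue)
  obtain f :: "real ^ 'n \<Rightarrow> real" where f: "f \<in> borel_measurable lebesgue" "\<And>x. 0 < f x" "integrable lebesgue f"
    using L.obtain_positive_integrable_function by metis
  note [measurable] = f(1)
  let ?c = "1 + integral\<^sup>L lebesgue f"
  have c: "0 \<le> integral\<^sup>L lebesgue f" using f(2) by (intro integral_nonneg_AE) (auto simp: less_imp_le)
  have "(\<integral>\<^sup>+x. ennreal (f x / ?c) \<partial>lebesgue) = (\<integral>\<^sup>+x. ennreal (1 / ?c) * ennreal (f x) \<partial>lebesgue)"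
    using c f(2) by (intro nn_integral_cong) (simp add: less_imp_le flip: ennreal_mult)
  also have "\<dots> = ennreal (1 / ?c) * (\<integral>\<^sup>+x. f x \<partial>lebesgue)" by (rule nn_integral_cmult) simp
  also have "(\<integral>\<^sup>+x. f x \<partial>lebesgue) = ennreal (integral\<^sup>L lebesgue f)"
    using f by (intro nn_integral_eq_integral) (auto simp: less_imp_le)
  also have "ennreal (1 / ?c) * \<dots> \<le> 1"
    using c by (simp add: divide_le_eq_1 flip: ennreal_mult)
  finally show thesis using f(2) c by (intro that[of "\<lambda>x. f x / ?c"]) auto
qed

text \<open>The algorithm for finite-valued functions: \<open>\<phi>\<close> plays the role of F^p
  W, and the majorant is finite a.e. because its weighted norm is finite.\<close>

lemma rubio_de_francia_real:
  fixes a b K :: real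
  assumes ab: "0 < a" "0 < b"
  obtains C where "0 < C"
    "\<And>v (\<phi> :: real ^ 'n \<Rightarrow> real) Y. v \<in> weight_class a b K \<Longrightarrow> \<phi> \<in> lebesgue \<rightarrow>\<^sub>M (borel :: real measure) \<Longrightarrow> (\<And>x. 0 < \<phi> x) \<Longrightarrow>
      (\<integral>\<^sup>+x. \<phi> x \<partial>lebesgue) \<le> ennreal Y \<Longrightarrow>
      \<exists>h\<in>borel_measurable lebesgue. (\<forall>x :: real ^ 'n. 0 < h x \<and> \<phi> x \<le> h x powr (1 + b / a) * v x powr (1 / a)) \<and>
        (\<integral>\<^sup>+x. h x powr (1 + b / a) * v x powr (1 / a) \<partial>lebesgue) \<le> ennreal (C * Y) \<and>
        (\<forall>Q\<in>cubes. AE x in lebesgue. x \<in> Q \<longrightarrow> avg h Q \<le> ennreal (C * h x))"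
proof -
  define p where "p = 1 + b / a"
  have p: "1 < p" using ab by (simp add: p_def)
  obtain C where C: "0 < C" and rdf: "\<And>v F. v \<in> weight_class a b K \<Longrightarrow> F \<in> borel_measurable lebesgue \<Longrightarrow>
    \<exists>h\<in>borel_measurable lebesgue. (\<forall>x :: real ^ 'n. F x \<le> h x) \<and>
      (\<integral>\<^sup>+x. h x epowr p * ennreal (v x powr (1 / a)) \<partial>lebesgue)
        \<le> ennreal C * (\<integral>\<^sup>+x. F x epowr p * ennreal (v x powr (1 / a)) \<partial>lebesgue) \<and>
      (\<forall>Q\<in>cubes. \<forall>x\<in>Q. mean h Q \<le> ennreal C * h x)"
    using rubio_de_francia[OF ab, where 'n = 'n, of K] unfolding p_def by blast
  have "\<exists>h\<in>borel_measurable lebesgue. (\<forall>x :: real ^ 'n. 0 < h x \<and> \<phi> x \<le> h x powr p * v x powr (1 / a)) \<and>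
        (\<integral>\<^sup>+x. h x powr p * v x powr (1 / a) \<partial>lebesgue) \<le> ennreal (C * Y) \<and>
        (\<forall>Q\<in>cubes. AE x in lebesgue. x \<in> Q \<longrightarrow> avg h Q \<le> ennreal (C * h x))"
    if v: "v \<in> weight_class a b K" and [measurable]: "\<phi> \<in> borel_measurable lebesgue" and \<phi>: "\<And>x. 0 < \<phi> x"
      and Y: "(\<integral>\<^sup>+x. \<phi> x \<partial>lebesgue) \<le> ennreal Y" for v \<phi> :: "real ^ 'n \<Rightarrow> real" and Y
  proof -
    note [measurable] = weight_classD(1)[OF v]
    note v0 = weight_classD(2)[OF v]
    define F where "F x = (\<phi> x / v x powr (1 / a)) powr (1 / p)" for x
    have [measurable]: "F \<in> borel_measurable lebesgue" unfolding F_def by measurable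
    have F: "0 < F x" for x using \<phi>[of x] v0[of x] by (simp add: F_def)
    have F\<phi>: "F x powr p * v x powr (1 / a) = \<phi> x" for x
      using \<phi>[of x] v0[of x] p by (simp add: F_def powr_powr)
    have "(\<integral>\<^sup>+x. ennreal (F x) epowr p * ennreal (v x powr (1 / a)) \<partial>lebesgue) = (\<integral>\<^sup>+x. \<phi> x \<partial>lebesgue)"
      using F p by (intro nn_integral_cong) (simp add: epowr_ennreal less_imp_le F\<phi> flip: ennreal_mult)
    with Y C rdf[OF v, of "\<lambda>x. ennreal (F x)"] obtain h where [measurable]: "h \<in> borel_measurable lebesgue"
      and Fh: "\<And>x. ennreal (F x) \<le> h x"
      and hI: "(\<integral>\<^sup>+x. h x epowr p * ennreal (v x powr (1 / a)) \<partial>lebesgue) \<le> ennreal C * (\<integral>\<^sup>+x. \<phi> x \<partial>lebesgue)"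
      and hA: "\<And>Q x. Q \<in> cubes \<Longrightarrow> x \<in> Q \<Longrightarrow> mean h Q \<le> ennreal C * h x"
      by auto
    have hI: "(\<integral>\<^sup>+x. h x epowr p * ennreal (v x powr (1 / a)) \<partial>lebesgue) \<le> ennreal (C * Y)"
      using order_trans[OF hI mult_left_mono[OF Y zero_le]] C by (simp add: ennreal_mult')
    have "AE x in lebesgue. h x epowr p * ennreal (v x powr (1 / a)) \<noteq> \<infinity>"
      by (rule nn_integral_noteq_infinite) (use hI in \<open>auto simp: top_unique\<close>)
    then have fin: "AE x in lebesgue. h x < top"
    proof eventually_elim
      case (elim x)
      then show ?case using v0[of x] p
        by (cases "h x = top") (auto simp: epowr_top ennreal_top_mult less_top)
    qed
    \<comment> \<open>On the null set where \<open>h\<close> is infinite \<open>F\<close> is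
      substituted, which keeps \<open>F x \<le> k x\<close> and \<open>0 < k x\<close> at every
      point.\<close>
    define k where "k x = (if h x < top then enn2real (h x) else F x)" for x
    have [measurable]: "k \<in> borel_measurable lebesgue" unfolding k_def by measurable
    have kh: "AE x in lebesgue. ennreal (k x) = h x"
      using fin by eventually_elim (simp add: k_def)
    have Fk: "F x \<le> k x" for x
      using Fh[of x] F[of x] by (cases "h x") (auto simp: k_def)
    have k: "0 < k x" for x using F[of x] Fk[of x] by simp
    show ?thesis
    proof (intro bexI[of _ k] conjI allI ballI)
      fix x
      show "0 < k x" by (rule k)
      have "F x powr p \<le> k x powr p" using F[of x] Fk[of x] p by (intro powr_mono2) auto
      then show "\<phi> x \<le> k x powr p * v x powr (1 / a)"
        unfolding F\<phi>[symmetric] by (rule mult_right_mono) simp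
    next
      have "(\<integral>\<^sup>+x. k x powr p * v x powr (1 / a) \<partial>lebesgue) = (\<integral>\<^sup>+x. h x epowr p * ennreal (v x powr (1 / a)) \<partial>lebesgue)"
      proof (rule nn_integral_cong_AE)
        show "AE x in lebesgue. ennreal (k x powr p * v x powr (1 / a)) = h x epowr p * ennreal (v x powr (1 / a))"
          using kh
        proof eventually_elim
          case (elim x)
          then show ?case using k[of x] p by (simp add: epowr_ennreal ennreal_mult flip: elim)
        qed
      qed
      then show "(\<integral>\<^sup>+x. k x powr p * v x powr (1 / a) \<partial>lebesgue) \<le> ennreal (C * Y)" using hI by simp
    next
      fix Q :: "(real ^ 'n) set" assume Q: "Q \<in> cubes"
      have "(\<integral>\<^sup>+x\<in>Q. ennreal (k x) \<partial>lebesgue) = (\<integral>\<^sup>+x\<in>Q. h x \<partial>lebesgue)"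
        using kh by (intro nn_integral_cong_AE) (auto elim!: eventually_mono)
      then have kQ: "avg k Q = mean h Q" by (simp add: avg_mean mean_def)
      show "AE x in lebesgue. x \<in> Q \<longrightarrow> avg k Q \<le> ennreal (C * k x)"
        using kh
      proof eventually_elim
        case (elim x)
        then show ?case using hA[OF Q, of x] C by (auto simp: kQ ennreal_mult')
      qed
    qed simp
  qed
  then show thesis using C by (intro that[of C]) (simp_all only: p_def)
qed

text \<open>The constant precedes the weight: one \<open>C\<close> has to serve all weights with
  constant at most \<open>K\<close>, since the weights used later vary with the cube. Both sides are
  kept as \<open>p\<close>-th powers of norms.\<close>

definition weighted_ineq ::
  "((real ^ 'n \<Rightarrow> real) \<times> (real ^ 'n \<Rightarrow> real)) set \<Rightarrow> real \<Rightarrow> real \<Rightarrow> real \<Rightarrow> bool" where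
  "weighted_ineq F p a b \<longleftrightarrow> (\<forall>K. \<exists>C>0. \<forall>v\<in>weight_class a b K. \<forall>f g. (f, g) \<in> F \<longrightarrow>
     (\<integral>\<^sup>+x. ennreal (g x powr p * v x) \<partial>lebesgue) \<le> ennreal C * (\<integral>\<^sup>+x. ennreal (f x powr p * v x) \<partial>lebesgue))"

text \<open>Collects exponents, so that the pointwise relations of extrapolation reduce to the
  linear equations \<open>e1\<close> to \<open>e4\<close>.\<close>

lemma powr_pair:
  fixes h v :: real
  assumes "0 < h" "0 < v"
  shows "(h powr \<alpha> * v powr \<beta>) powr \<gamma> * (h powr \<alpha>' * v powr \<beta>') powr \<gamma>'
    = h powr (\<alpha> * \<gamma> + \<alpha>' * \<gamma>') * v powr (\<beta> * \<gamma> + \<beta>' * \<gamma>')"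
  using assms by (simp add: powr_mult powr_powr powr_add mult_ac)

text \<open>If f^p v is at most h^\<tau> W with W = v^(1/a), then u = h^(-\<delta>) v^(a0/a)
  satisfies the same bound for f^p0 u, and Hoelder recovers the integral of g^p v from those of g^p0
  u and h^\<tau> W. The choice of \<delta> balances the powers of h, the equation for
  \<open>a0\<close> those of v, and \<open>b0\<close> is then dictated by
  \<open>weight_class_A1_factor\<close>.\<close>

lemma extrapolation_down:
  fixes F :: "((real ^ 'n \<Rightarrow> real) \<times> (real ^ 'n \<Rightarrow> real)) set"
  assumes base: "weighted_ineq F p0 a0 b0"
    and F: "\<And>f g. (f, g) \<in> F \<Longrightarrow> f \<in> borel_measurable lebesgue \<and> g \<in> borel_measurable lebesgue \<and>
        (\<forall>x. 0 \<le> f x) \<and> (\<forall>x. 0 \<le> g x)"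
    and ab: "0 < a" "0 < b" "0 \<le> a0" and p: "0 < p" "p < p0"
    and b0: "b0 = (1 + b / a) * (p0 - p) / p + a0 * b / a" and a0: "(1 - a) * p0 / p + a0 = 1"
  shows "weighted_ineq F p a b"
  unfolding weighted_ineq_def
proof
  fix K
  define \<tau> where "\<tau> = 1 + b / a"
  define \<delta> where "\<delta> = \<tau> * (p0 - p) / p"
  have \<tau>: "0 < \<tau>" using ab by (simp add: \<tau>_def add_pos_pos)
  have \<delta>: "0 < \<delta>" using \<tau> p by (simp add: \<delta>_def)
  have b0\<delta>: "b0 = \<delta> + a0 * b / a" using b0 by (simp add: \<delta>_def \<tau>_def)
  have e1: "\<tau> * (p0 / p) + - \<delta> * 1 = \<tau>" using p by (simp add: \<delta>_def field_simps)
  have e2: "(1 / a - 1) * (p0 / p) + a0 / a * 1 = 1 / a"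
  proof -
    have "(1 / a - 1) * (p0 / p) + a0 / a * 1 = ((1 - a) * p0 / p + a0) / a"
      using ab p by (simp add: field_simps)
    then show ?thesis using a0 by simp
  qed
  have e3: "- \<delta> * (p / p0) + \<tau> * (1 - p / p0) = 0" using p by (simp add: \<delta>_def field_simps)
  have e4: "a0 / a * (p / p0) + 1 / a * (1 - p / p0) = 1"
  proof -
    have s: "(1 - a0) * p / p0 = 1 - a" using a0 p by (simp add: field_simps)
    have "a0 / a * (p / p0) + 1 / a * (1 - p / p0) = (1 - (1 - a0) * p / p0) / a"
      using ab p by (simp add: field_simps)
    then show ?thesis using ab by (simp add: s)
  qed
  obtain C where C: "0 < C" and rdf:
    "\<And>v (\<phi> :: real ^ 'n \<Rightarrow> real) Y. v \<in> weight_class a b K \<Longrightarrow> \<phi> \<in> lebesgue \<rightarrow>\<^sub>M (borel :: real measure) \<Longrightarrow> (\<And>x. 0 < \<phi> x) \<Longrightarrow>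
      (\<integral>\<^sup>+x. \<phi> x \<partial>lebesgue) \<le> ennreal Y \<Longrightarrow>
      \<exists>h\<in>borel_measurable lebesgue. (\<forall>x :: real ^ 'n. 0 < h x \<and> \<phi> x \<le> h x powr \<tau> * v x powr (1 / a)) \<and>
        (\<integral>\<^sup>+x. h x powr \<tau> * v x powr (1 / a) \<partial>lebesgue) \<le> ennreal (C * Y) \<and>
        (\<forall>Q\<in>cubes. AE x in lebesgue. x \<in> Q \<longrightarrow> avg h Q \<le> ennreal (C * h x))"
    using rubio_de_francia_real[OF ab(1,2), where 'n = 'n and K = K, folded \<tau>_def] by blast
  obtain C0 where C0: "0 < C0" and base0: "\<And>v f g. v \<in> weight_class a0 b0 (C powr \<delta> * K powr (a0 / a)) \<Longrightarrow> (f, g) \<in> F \<Longrightarrow>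
     (\<integral>\<^sup>+x. ennreal (g x powr p0 * v x) \<partial>lebesgue) \<le> ennreal C0 * (\<integral>\<^sup>+x. ennreal (f x powr p0 * v x) \<partial>lebesgue)"
    using base unfolding weighted_ineq_def by meson
  let ?D = "C0 powr (p / p0) * C"
  obtain \<psi> :: "real ^ 'n \<Rightarrow> real" where [measurable]: "\<psi> \<in> borel_measurable lebesgue" and \<psi>: "\<And>x. 0 < \<psi> x"
    "(\<integral>\<^sup>+x. \<psi> x \<partial>lebesgue) \<le> 1" using positive_integrable_function[where 'n = 'n] by blast
  have main: "(\<integral>\<^sup>+x. ennreal (g x powr p * v x) \<partial>lebesgue) \<le> ennreal (?D * (X + \<epsilon>))"
    if v: "v \<in> weight_class a b K" and fg: "(f, g) \<in> F" and X: "(\<integral>\<^sup>+x. ennreal (f x powr p * v x) \<partial>lebesgue) = ennreal X"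
      and X0: "0 \<le> X" and \<epsilon>: "0 < \<epsilon>" for v f g X \<epsilon>
  proof -
    note [measurable] = weight_classD(1)[OF v]
    note v0 = weight_classD(2)[OF v]
    have [measurable]: "f \<in> borel_measurable lebesgue" "g \<in> borel_measurable lebesgue"
      and f0: "\<And>x. 0 \<le> f x" and g0: "\<And>x. 0 \<le> g x" using F[OF fg] by auto
    \<comment> \<open>The algorithm wants a strictly positive input; the extra integral of at most
      \<open>\<epsilon>\<close> disappears at the end, as \<open>\<epsilon>\<close> is
      arbitrary.\<close>
    define \<phi> where "\<phi> x = f x powr p * v x + \<epsilon> * \<psi> x" for x
    have [measurable]: "\<phi> \<in> borel_measurable lebesgue" unfolding \<phi>_def by measurable
    have \<phi>: "0 < \<phi> x" for x using v0[of x] \<psi>(1)[of x] \<epsilon> by (simp add: \<phi>_def add_nonneg_pos less_imp_le)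
    have "(\<integral>\<^sup>+x. \<phi> x \<partial>lebesgue) = (\<integral>\<^sup>+x. ennreal (f x powr p * v x) + ennreal \<epsilon> * ennreal (\<psi> x) \<partial>lebesgue)"
      unfolding \<phi>_def using v0 \<psi>(1) \<epsilon> by (intro nn_integral_cong) (simp add: less_imp_le flip: ennreal_mult)
    also have "\<dots> = ennreal X + ennreal \<epsilon> * (\<integral>\<^sup>+x. \<psi> x \<partial>lebesgue)"
      by (simp add: nn_integral_add nn_integral_cmult X)
    also have "\<dots> \<le> ennreal X + ennreal \<epsilon> * 1" using \<psi>(2) by (intro add_left_mono mult_left_mono) auto
    also have "\<dots> = ennreal (X + \<epsilon>)" using X0 \<epsilon> by simp
    finally have "(\<integral>\<^sup>+x. \<phi> x \<partial>lebesgue) \<le> ennreal (X + \<epsilon>)" .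
    from rdf[OF v _ \<phi> this] obtain h where [measurable]: "h \<in> borel_measurable lebesgue"
      and h: "\<And>x. 0 < h x" and \<phi>h: "\<And>x. \<phi> x \<le> h x powr \<tau> * v x powr (1 / a)"
      and hI: "(\<integral>\<^sup>+x. h x powr \<tau> * v x powr (1 / a) \<partial>lebesgue) \<le> ennreal (C * (X + \<epsilon>))"
      and A1: "\<And>Q. Q \<in> cubes \<Longrightarrow> AE x in lebesgue. x \<in> Q \<longrightarrow> avg h Q \<le> ennreal (C * h x)"
      by auto
    define u where "u x = h x powr - \<delta> * v x powr (a0 / a)" for x
    have [measurable]: "u \<in> borel_measurable lebesgue" unfolding u_def by measurable
    have u: "u \<in> weight_class a0 b0 (C powr \<delta> * K powr (a0 / a))"
      unfolding u_def by (rule weight_class_A1_factor[OF v ab(1,2) _ h A1 C \<delta> ab(3) b0\<delta>]) simp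
    have fu: "f x powr p0 * u x \<le> h x powr \<tau> * v x powr (1 / a)" for x
    proof -
      have "f x powr p * v x \<le> h x powr \<tau> * v x powr (1 / a)"
        using \<phi>h[of x] mult_pos_pos[OF \<epsilon> \<psi>(1)[of x]] unfolding \<phi>_def by linarith
      then have "f x powr p \<le> h x powr \<tau> * v x powr (1 / a - 1)"
        using v0[of x] by (simp add: powr_diff field_simps)
      then have "(f x powr p) powr (p0 / p) \<le> (h x powr \<tau> * v x powr (1 / a - 1)) powr (p0 / p)"
        using p by (intro powr_mono2) auto
      then have "f x powr p0 \<le> (h x powr \<tau> * v x powr (1 / a - 1)) powr (p0 / p)"
        using p by (simp add: powr_powr)
      then have "f x powr p0 * u x \<le> (h x powr \<tau> * v x powr (1 / a - 1)) powr (p0 / p) * (h x powr - \<delta> * v x powr (a0 / a)) powr 1"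
        by (simp add: u_def mult_right_mono)
      then show ?thesis by (simp only: powr_pair[OF h v0] e1 e2)
    qed
    have gu: "g x powr p * v x = (g x powr p0 * u x) powr (p / p0) * (h x powr \<tau> * v x powr (1 / a)) powr (1 - p / p0)" for x
    proof -
      have "(g x powr p0 * u x) powr (p / p0) = g x powr p * u x powr (p / p0)"
        using g0[of x] p by (simp add: powr_mult powr_powr u_def)
      moreover have "u x powr (p / p0) * (h x powr \<tau> * v x powr (1 / a)) powr (1 - p / p0) = v x"
        unfolding u_def using h[of x] v0[of x] by (simp only: powr_pair[OF h v0] e3 e4) simp
      ultimately show ?thesis by (simp only: mult.assoc)
    qed
    have pos: "0 < C * (X + \<epsilon>)" using C X0 \<epsilon> by simp
    have "(\<integral>\<^sup>+x. ennreal (f x powr p0 * u x) \<partial>lebesgue) \<le> ennreal (C * (X + \<epsilon>))"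
      using fu by (intro order_trans[OF nn_integral_mono hI] ennreal_leI)
    then have "ennreal C0 * (\<integral>\<^sup>+x. ennreal (f x powr p0 * u x) \<partial>lebesgue) \<le> ennreal (C0 * (C * (X + \<epsilon>)))"
      using C0 by (simp add: ennreal_mult' mult_left_mono)
    then have g1: "(\<integral>\<^sup>+x. ennreal (g x powr p0 * u x) \<partial>lebesgue) \<le> ennreal (C0 * (C * (X + \<epsilon>)))"
      using base0[OF u fg] by (rule order_trans[rotated])
    have "(\<integral>\<^sup>+x. ennreal (g x powr p * v x) \<partial>lebesgue)
        \<le> ennreal ((C0 * (C * (X + \<epsilon>))) powr (p / p0) * (C * (X + \<epsilon>)) powr (1 - p / p0))"
      unfolding gu using g1 hI pos C0 p v0 h
      by (intro nn_integral_Holder_bound) (auto simp: u_def)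
    also have "(C0 * (C * (X + \<epsilon>))) powr (p / p0) * (C * (X + \<epsilon>)) powr (1 - p / p0)
        = C0 powr (p / p0) * ((C * (X + \<epsilon>)) powr (p / p0) * (C * (X + \<epsilon>)) powr (1 - p / p0))"
      using C0 pos by (simp add: powr_mult)
    also have "(C * (X + \<epsilon>)) powr (p / p0) * (C * (X + \<epsilon>)) powr (1 - p / p0) = C * (X + \<epsilon>)"
      using pos by (simp flip: powr_add)
    finally show ?thesis by (simp add: mult.assoc)
  qed
  have D: "0 < ?D" using C C0 by simp
  show "\<exists>C>0. \<forall>v\<in>weight_class a b K. \<forall>f g. (f, g) \<in> F \<longrightarrow>
     (\<integral>\<^sup>+x. ennreal (g x powr p * v x) \<partial>lebesgue) \<le> ennreal C * (\<integral>\<^sup>+x. ennreal (f x powr p * v x) \<partial>lebesgue)"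
  proof (intro exI[of _ ?D] conjI ballI D allI impI)
    fix v f g :: "real ^ 'n \<Rightarrow> real" assume v: "v \<in> weight_class a b K" and fg: "(f, g) \<in> F"
    show "(\<integral>\<^sup>+x. ennreal (g x powr p * v x) \<partial>lebesgue) \<le> ennreal ?D * (\<integral>\<^sup>+x. ennreal (f x powr p * v x) \<partial>lebesgue)"
    proof (cases "\<integral>\<^sup>+x. ennreal (f x powr p * v x) \<partial>lebesgue")
      case (real X)
      have "(\<integral>\<^sup>+x. ennreal (g x powr p * v x) \<partial>lebesgue) \<le> ennreal (?D * X)"
      proof (rule ennreal_le_epsilon)
        fix e :: real assume e: "0 < e"
        have "d * (X + e / d) = d * X + e" if "0 < d" for d using that by (simp add: field_simps)
        from this[OF D] have "?D * (X + e / ?D) = ?D * X + e" .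
        then show "(\<integral>\<^sup>+x. ennreal (g x powr p * v x) \<partial>lebesgue) \<le> ennreal (?D * X) + ennreal e"
          using main[OF v fg real(2,1), of "e / ?D"] D e real(1) by simp
      qed
      then show ?thesis using real D by (simp add: ennreal_mult)
    qed (use C C0 in \<open>simp add: ennreal_mult_top\<close>)
  qed
qed


text \<open>The mirror image: the algorithm runs for \<open>1 / v\<close>, and on \<open>g\<close>
  instead of \<open>f\<close>, which replaces duality. The integral of g^p v then occurs on both
  sides, on the right with power 1 - p0/p, and is divided out; this needs it to be finite and
  positive, hence the truncations \<open>G\<close>.\<close>

lemma extrapolation_up:
  fixes F :: "((real ^ 'n \<Rightarrow> real) \<times> (real ^ 'n \<Rightarrow> real)) set"
  assumes base: "weighted_ineq F p0 a0 b0"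
    and F: "\<And>f g. (f, g) \<in> F \<Longrightarrow> f \<in> borel_measurable lebesgue \<and> g \<in> borel_measurable lebesgue \<and>
        (\<forall>x. 0 \<le> f x) \<and> (\<forall>x. 0 \<le> g x)"
    and ab: "0 < a" "0 < b" "0 \<le> b0" and p: "0 < p0" "p0 < p"
    and a0: "a0 = (1 + a / b) * (p - p0) / p + b0 * a / b" and b0: "(1 + b) * p0 / p = 1 + b0"
  shows "weighted_ineq F p a b"
  unfolding weighted_ineq_def
proof
  fix K
  define \<tau> where "\<tau> = 1 + a / b"
  define \<delta> where "\<delta> = \<tau> * (p - p0) / p"
  have \<tau>: "0 < \<tau>" using ab by (simp add: \<tau>_def add_pos_pos)
  have \<delta>: "0 < \<delta>" using \<tau> p by (simp add: \<delta>_def)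
  have a0\<delta>: "a0 = \<delta> + b0 * a / b" using a0 by (simp add: \<delta>_def \<tau>_def)
  have e1: "\<tau> * ((p - p0) / p) + 0 * 1 = \<delta>" by (simp add: \<delta>_def)
  have b0': "b0 = (1 + b) * p0 / p - 1" using b0 by simp
  have e2: "(- (1 / b) - 1) * ((p - p0) / p) + 1 * 1 = b0 / b"
    using ab p unfolding b0' by (simp add: field_simps)
  have e3: "0 * (p0 / p) + \<tau> * (1 - p0 / p) = \<delta>" using p by (simp add: \<delta>_def field_simps)
  have e4: "1 * (p0 / p) + - (1 / b) * (1 - p0 / p) = b0 / b"
    using ab p unfolding b0' by (simp add: field_simps)
  obtain C where C: "0 < C" and rdf:
    "\<And>v (\<phi> :: real ^ 'n \<Rightarrow> real) Y. v \<in> weight_class b a K \<Longrightarrow> \<phi> \<in> lebesgue \<rightarrow>\<^sub>M (borel :: real measure) \<Longrightarrow> (\<And>x. 0 < \<phi> x) \<Longrightarrow>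
      (\<integral>\<^sup>+x. \<phi> x \<partial>lebesgue) \<le> ennreal Y \<Longrightarrow>
      \<exists>h\<in>borel_measurable lebesgue. (\<forall>x :: real ^ 'n. 0 < h x \<and> \<phi> x \<le> h x powr \<tau> * v x powr (1 / b)) \<and>
        (\<integral>\<^sup>+x. h x powr \<tau> * v x powr (1 / b) \<partial>lebesgue) \<le> ennreal (C * Y) \<and>
        (\<forall>Q\<in>cubes. AE x in lebesgue. x \<in> Q \<longrightarrow> avg h Q \<le> ennreal (C * h x))"
    using rubio_de_francia_real[OF ab(2,1), where 'n = 'n and K = K, folded \<tau>_def] by blast
  obtain C0 where C0: "0 < C0" and base0: "\<And>v f g. v \<in> weight_class a0 b0 (C powr \<delta> * K powr (b0 / b)) \<Longrightarrow> (f, g) \<in> F \<Longrightarrow>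
     (\<integral>\<^sup>+x. ennreal (g x powr p0 * v x) \<partial>lebesgue) \<le> ennreal C0 * (\<integral>\<^sup>+x. ennreal (f x powr p0 * v x) \<partial>lebesgue)"
    using base unfolding weighted_ineq_def by meson
  \<comment> \<open>What remains when Y \<le> C0 X^(p0/p) (2 C Y)^(1 - p0/p) is solved for
    \<open>Y\<close>.\<close>
  define D where "D = (C0 * (2 * C) powr (1 - p0 / p)) powr (p / p0)"
  have D: "0 < D" using C C0 by (simp add: D_def)
  obtain \<psi> :: "real ^ 'n \<Rightarrow> real" where [measurable]: "\<psi> \<in> borel_measurable lebesgue" and \<psi>: "\<And>x. 0 < \<psi> x"
    "(\<integral>\<^sup>+x. \<psi> x \<partial>lebesgue) \<le> 1" using positive_integrable_function[where 'n = 'n] by blast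
  have main: "Y \<le> D * X"
    if v: "v \<in> weight_class a b K" and fg: "(f, g) \<in> F" and X: "(\<integral>\<^sup>+x. ennreal (f x powr p * v x) \<partial>lebesgue) \<le> ennreal X"
      and X0: "0 < X" and [measurable]: "G \<in> borel_measurable lebesgue" and G: "\<And>x. 0 \<le> G x" "\<And>x. G x \<le> g x"
      and Y: "(\<integral>\<^sup>+x. ennreal (G x powr p * v x) \<partial>lebesgue) = ennreal Y" "0 < Y" for v f g G :: "real ^ 'n \<Rightarrow> real" and X Y
  proof -
    note [measurable] = weight_classD(1)[OF v]
    note v0 = weight_classD(2)[OF v]
    have [measurable]: "f \<in> borel_measurable lebesgue" "g \<in> borel_measurable lebesgue"
      and f0: "\<And>x. 0 \<le> f x" and g0: "\<And>x. 0 \<le> g x" using F[OF fg] by auto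
    \<comment> \<open>Perturbing by \<open>Y * \<psi> x\<close> at most doubles the integral, so the
      bound stays proportional to \<open>Y\<close>.\<close>
    define \<phi> where "\<phi> x = G x powr p * v x + Y * \<psi> x" for x
    have [measurable]: "\<phi> \<in> borel_measurable lebesgue" unfolding \<phi>_def by measurable
    have \<phi>: "0 < \<phi> x" for x using v0[of x] \<psi>(1)[of x] Y by (simp add: \<phi>_def add_nonneg_pos less_imp_le)
    have "(\<integral>\<^sup>+x. \<phi> x \<partial>lebesgue) = (\<integral>\<^sup>+x. ennreal (G x powr p * v x) + ennreal Y * ennreal (\<psi> x) \<partial>lebesgue)"
      unfolding \<phi>_def using v0 \<psi>(1) Y(2) by (intro nn_integral_cong) (simp add: less_imp_le flip: ennreal_mult)
    also have "\<dots> = ennreal Y + ennreal Y * (\<integral>\<^sup>+x. \<psi> x \<partial>lebesgue)"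
      by (simp add: nn_integral_add nn_integral_cmult Y(1))
    also have "\<dots> \<le> ennreal Y + ennreal Y * 1" using \<psi>(2) by (intro add_left_mono mult_left_mono) auto
    also have "\<dots> = ennreal (2 * Y)" using Y(2) by (simp flip: ennreal_plus)
    finally have "(\<integral>\<^sup>+x. \<phi> x \<partial>lebesgue) \<le> ennreal (2 * Y)" .
    from rdf[OF weight_class_inverse[OF v] _ \<phi> this] obtain h where [measurable]: "h \<in> borel_measurable lebesgue"
      and h: "\<And>x. 0 < h x" and \<phi>h: "\<And>x. \<phi> x \<le> h x powr \<tau> * (1 / v x) powr (1 / b)"
      and hI: "(\<integral>\<^sup>+x. h x powr \<tau> * (1 / v x) powr (1 / b) \<partial>lebesgue) \<le> ennreal (C * (2 * Y))"
      and A1: "\<And>Q. Q \<in> cubes \<Longrightarrow> AE x in lebesgue. x \<in> Q \<longrightarrow> avg h Q \<le> ennreal (C * h x)"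
      by auto
    have inv: "(1 / v x) powr (1 / b) = v x powr - (1 / b)" for x
      using v0[of x] by (simp add: powr_divide powr_minus_divide)
    define u where "u x = h x powr \<delta> * v x powr (b0 / b)" for x
    have [measurable]: "u \<in> borel_measurable lebesgue" unfolding u_def by measurable
    have "(\<lambda>x. h x powr - \<delta> * (1 / v x) powr (b0 / b)) \<in> weight_class b0 a0 (C powr \<delta> * K powr (b0 / b))"
      by (rule weight_class_A1_factor[OF weight_class_inverse[OF v] ab(2,1) _ h A1 C \<delta> ab(3) a0\<delta>]) simp
    from weight_class_inverse[OF this] have u: "u \<in> weight_class a0 b0 (C powr \<delta> * K powr (b0 / b))"
    proof -
      have "1 / (h x powr - \<delta> * (1 / v x) powr (b0 / b)) = u x" for x
        using h[of x] v0[of x] by (simp add: u_def powr_minus powr_divide field_simps)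
      then show ?thesis using weight_class_inverse[OF \<open>_ \<in> weight_class b0 a0 _\<close>] by (simp add: u_def[abs_def])
    qed
    \<comment> \<open>Only the surplus power \<open>p - p0\<close> of \<open>G\<close> is traded for
      a power of \<open>h\<close>; the remaining power \<open>p0\<close> is bounded through
      \<open>G x \<le> g x\<close>.\<close>
    have Gu: "G x powr p * v x \<le> g x powr p0 * u x" for x
    proof -
      have "G x powr p * v x \<le> h x powr \<tau> * v x powr - (1 / b)"
        using \<phi>h[of x] mult_pos_pos[OF Y(2) \<psi>(1)[of x]] unfolding \<phi>_def inv by linarith
      then have "G x powr p \<le> h x powr \<tau> * v x powr (- (1 / b) - 1)"
        using v0[of x] by (simp add: powr_diff field_simps)
      then have "(G x powr p) powr ((p - p0) / p) \<le> (h x powr \<tau> * v x powr (- (1 / b) - 1)) powr ((p - p0) / p)"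
        using p by (intro powr_mono2) auto
      then have "(G x powr p) powr ((p - p0) / p) * (h x powr 0 * v x powr 1) powr 1
          \<le> (h x powr \<tau> * v x powr (- (1 / b) - 1)) powr ((p - p0) / p) * (h x powr 0 * v x powr 1) powr 1"
        by (rule mult_right_mono) simp
      also have "\<dots> = u x" by (simp only: powr_pair[OF h v0] e1 e2 u_def)
      finally have le: "G x powr (p - p0) * v x \<le> u x"
        using v0[of x] h[of x] p by (simp add: powr_powr)
      have "G x powr p * v x = G x powr p0 * (G x powr (p - p0) * v x)"
        by (simp flip: powr_add)
      also have "\<dots> \<le> g x powr p0 * u x"
        using le G[of x] p v0[of x] by (intro mult_mono powr_mono2) auto
      finally show ?thesis .
    qed
    have fu: "f x powr p0 * u x = (f x powr p * v x) powr (p0 / p) * (h x powr \<tau> * (1 / v x) powr (1 / b)) powr (1 - p0 / p)" for x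
    proof -
      have "(f x powr p * v x) powr (p0 / p) = f x powr p0 * (h x powr 0 * v x powr 1) powr (p0 / p)"
        using f0[of x] p h[of x] v0[of x] by (simp add: powr_mult powr_powr)
      moreover have "(h x powr 0 * v x powr 1) powr (p0 / p) * (h x powr \<tau> * (1 / v x) powr (1 / b)) powr (1 - p0 / p) = u x"
        by (simp only: inv powr_pair[OF h v0] e3 e4 u_def)
      ultimately show ?thesis by (simp only: mult.assoc)
    qed
    have pos: "0 < C * (2 * Y)" using C Y by simp
    have "(\<integral>\<^sup>+x. ennreal (f x powr p0 * u x) \<partial>lebesgue) \<le> ennreal (X powr (p0 / p) * (C * (2 * Y)) powr (1 - p0 / p))"
      unfolding fu using X hI pos p v0 h X0 by (intro nn_integral_Holder_bound) (auto simp: less_imp_le)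
    then have "ennreal C0 * (\<integral>\<^sup>+x. ennreal (f x powr p0 * u x) \<partial>lebesgue)
        \<le> ennreal (C0 * (X powr (p0 / p) * (C * (2 * Y)) powr (1 - p0 / p)))"
      using C0 by (simp add: ennreal_mult' mult_left_mono)
    then have "(\<integral>\<^sup>+x. ennreal (g x powr p0 * u x) \<partial>lebesgue) \<le> ennreal (C0 * (X powr (p0 / p) * (C * (2 * Y)) powr (1 - p0 / p)))"
      using base0[OF u fg] by (rule order_trans[rotated])
    moreover have "ennreal Y \<le> (\<integral>\<^sup>+x. ennreal (g x powr p0 * u x) \<partial>lebesgue)"
      unfolding Y(1)[symmetric] using Gu by (intro nn_integral_mono ennreal_leI)
    ultimately have "ennreal Y \<le> ennreal (C0 * (X powr (p0 / p) * (C * (2 * Y)) powr (1 - p0 / p)))"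
      by (rule order_trans[rotated])
    then have "Y \<le> C0 * (X powr (p0 / p) * (C * (2 * Y)) powr (1 - p0 / p))"
      using C0 by (subst (asm) ennreal_le_iff) auto
    also have "(C * (2 * Y)) powr (1 - p0 / p) = (2 * C) powr (1 - p0 / p) * Y powr (1 - p0 / p)"
      using C Y by (simp add: powr_mult mult_ac)
    finally have "Y \<le> (C0 * (2 * C) powr (1 - p0 / p)) * X powr (p0 / p) * Y powr (1 - p0 / p)"
      by (simp only: mult_ac)
    moreover have "Y powr (p0 / p) * Y powr (1 - p0 / p) = Y" using Y(2) by (simp flip: powr_add)
    ultimately have "Y powr (p0 / p) * Y powr (1 - p0 / p)
        \<le> (C0 * (2 * C) powr (1 - p0 / p)) * X powr (p0 / p) * Y powr (1 - p0 / p)" by (simp only:)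
    then have "Y powr (p0 / p) \<le> (C0 * (2 * C) powr (1 - p0 / p)) * X powr (p0 / p)"
      by (rule mult_right_le_imp_le) (use Y(2) in simp)
    then have "(Y powr (p0 / p)) powr (p / p0) \<le> ((C0 * (2 * C) powr (1 - p0 / p)) * X powr (p0 / p)) powr (p / p0)"
      using p by (intro powr_mono2) auto
    then show ?thesis using p Y(2) X0 C0 by (simp add: powr_powr powr_mult D_def)
  qed
  show "\<exists>C>0. \<forall>v\<in>weight_class a b K. \<forall>f g. (f, g) \<in> F \<longrightarrow>
     (\<integral>\<^sup>+x. ennreal (g x powr p * v x) \<partial>lebesgue) \<le> ennreal C * (\<integral>\<^sup>+x. ennreal (f x powr p * v x) \<partial>lebesgue)"
  proof (intro exI[of _ D] conjI ballI D allI impI)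
    fix v f g :: "real ^ 'n \<Rightarrow> real" assume v: "v \<in> weight_class a b K" and fg: "(f, g) \<in> F"
    note [measurable] = weight_classD(1)[OF v]
    note v0 = weight_classD(2)[OF v]
    have [measurable]: "f \<in> borel_measurable lebesgue" "g \<in> borel_measurable lebesgue"
      and f0: "\<And>x. 0 \<le> f x" and g0: "\<And>x. 0 \<le> g x" using F[OF fg] by auto
    show "(\<integral>\<^sup>+x. ennreal (g x powr p * v x) \<partial>lebesgue) \<le> ennreal D * (\<integral>\<^sup>+x. ennreal (f x powr p * v x) \<partial>lebesgue)"
    proof (cases "\<integral>\<^sup>+x. ennreal (f x powr p * v x) \<partial>lebesgue")
      case (real X)
      \<comment> \<open>On \<open>E N\<close> the integrand lies below an integrable multiple of
        \<open>\<psi>\<close>; these sets exhaust the space because \<open>\<psi>\<close> is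
        positive.\<close>
      define E where "E N = {x. g x powr p * v x \<le> real N * \<psi> x}" for N :: nat
      have [measurable]: "E N \<in> sets lebesgue" for N
      proof -
        have "{x \<in> space lebesgue. g x powr p * v x \<le> real N * \<psi> x} \<in> sets lebesgue" by measurable
        then show ?thesis by (simp add: E_def)
      qed
      define G where "G N x = g x * indicator (E N) x" for N x
      have [measurable]: "G N \<in> borel_measurable lebesgue" for N unfolding G_def by measurable
      have G: "G N x powr p * v x = g x powr p * v x * indicator (E N) x" for N x
        by (auto simp: G_def indicator_def)
      have trunc: "(\<integral>\<^sup>+x. ennreal (G N x powr p * v x) \<partial>lebesgue) \<le> ennreal (D * X)" for N
      proof -
        have "(\<integral>\<^sup>+x. ennreal (G N x powr p * v x) \<partial>lebesgue) \<le> (\<integral>\<^sup>+x. ennreal (real N) * ennreal (\<psi> x) \<partial>lebesgue)"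
          using \<psi>(1) by (intro nn_integral_mono)
            (auto simp: G E_def indicator_def less_imp_le simp flip: ennreal_mult intro!: ennreal_leI)
        also have "\<dots> = ennreal (real N) * (\<integral>\<^sup>+x. \<psi> x \<partial>lebesgue)" by (rule nn_integral_cmult) simp
        also have "\<dots> \<le> ennreal (real N) * 1" using \<psi>(2) by (rule mult_left_mono) simp
        finally have "(\<integral>\<^sup>+x. ennreal (G N x powr p * v x) \<partial>lebesgue) < top" by (rule le_less_trans) simp
        then obtain Y where Y: "(\<integral>\<^sup>+x. ennreal (G N x powr p * v x) \<partial>lebesgue) = ennreal Y" "0 \<le> Y"
          by (cases "\<integral>\<^sup>+x. ennreal (G N x powr p * v x) \<partial>lebesgue") auto
        show ?thesis
        proof (cases "Y = 0")
          case False
          have "Y \<le> D * X"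
          proof (rule field_le_epsilon)
            fix e :: real assume e: "0 < e"
            have "Y \<le> D * (X + e / D)"
              using False Y real e D g0
              by (intro main[OF v fg, of "X + e / D" "G N" Y]) (auto simp: G_def indicator_def add_nonneg_pos)
            also have "\<dots> = D * X + e" using D by (simp add: field_simps)
            finally show "Y \<le> D * X + e" .
          qed
          then show ?thesis by (simp add: Y ennreal_leI)
        qed (simp add: Y)
      qed
      have "(\<integral>\<^sup>+x. ennreal (g x powr p * v x) \<partial>lebesgue) = (\<integral>\<^sup>+x. (SUP N. ennreal (G N x powr p * v x)) \<partial>lebesgue)"
      proof (rule nn_integral_cong)
        fix x
        obtain N where "g x powr p * v x / \<psi> x \<le> real N" using real_arch_simple by blast
        then have "x \<in> E N" using \<psi>(1)[of x] by (simp add: E_def divide_le_eq)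
        then show "ennreal (g x powr p * v x) = (SUP N. ennreal (G N x powr p * v x))"
          using v0[of x] by (intro antisym SUP_least SUP_upper2[of N])
            (auto simp: G indicator_def less_imp_le intro!: ennreal_leI)
      qed
      also have "\<dots> = (SUP N. \<integral>\<^sup>+x. ennreal (G N x powr p * v x) \<partial>lebesgue)"
      proof (rule nn_integral_monotone_convergence_SUP)
        show "incseq (\<lambda>N x. ennreal (G N x powr p * v x))"
        proof (intro incseq_SucI le_funI ennreal_leI)
          fix N x
          have "real N * \<psi> x \<le> real (Suc N) * \<psi> x" using \<psi>(1)[of x] by (intro mult_right_mono) auto
          then show "G N x powr p * v x \<le> G (Suc N) x powr p * v x"
            unfolding G using v0[of x] by (auto simp: E_def indicator_def less_imp_le)
        qed
      qed simp
      also have "\<dots> \<le> ennreal (D * X)" using trunc by (intro SUP_least)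
      finally show ?thesis using real D by (simp add: ennreal_mult)
    qed (use D in \<open>simp add: ennreal_mult_top\<close>)
  qed
qed

subsection \<open>Relation to the Muckenhoupt and reverse Hoelder classes\<close>

lemma weight_class_weight:
  fixes v :: "real ^ 'n \<Rightarrow> real"
  assumes v: "v \<in> weight_class a b K" and a: "0 \<le> a" "a \<le> 1" and b: "0 \<le> b"
  shows "weight v"
  unfolding weight_def
proof (intro conjI allI impI)
  note [measurable] = weight_classD(1)[OF v]
  note v0 = weight_classD(2)[OF v]
  show "0 \<le> v x" for x using v0[of x] by simp
  show "v \<in> borel_measurable lebesgue" by simp
  fix S :: "(real ^ 'n) set" assume S: "compact S"
  then obtain M where M: "\<And>x. x \<in> S \<Longrightarrow> norm x \<le> M" using bounded_iff compact_imp_bounded by metis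
  define l where "l = 2 * (\<bar>M\<bar> + 1)"
  let ?Q = "cb (\<chi> i. - (\<bar>M\<bar> + 1)) l :: (real ^ 'n) set"
  have Q: "?Q \<in> cubes" by (rule cb_in_cubes) (simp add: l_def)
  have "S \<subseteq> ?Q"
  proof
    fix x assume "x \<in> S"
    then have "\<bar>x $ i\<bar> \<le> \<bar>M\<bar>" for i using M[of x] component_le_norm_cart[of x i] by linarith
    then show "x \<in> ?Q" by (auto simp: mem_cb l_def abs_le_iff) (smt (verit))+
  qed
  then have "wmeas v S \<le> wmeas v ?Q" by (rule wmeas_mono)
  also have "\<dots> < top"
    using wmeas_class_finite(1)[OF weight_class_mono[OF v a b order_refl order_refl] _ Q] v0
    by (simp add: less_imp_le)
  finally have fin: "wmeas v S < top" .
  have [measurable]: "S \<in> sets lebesgue" using S by (simp add: borel_compact)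
  show "set_integrable lebesgue S v"
    unfolding set_integrable_def
  proof (rule integrableI_nonneg)
    have "(\<integral>\<^sup>+x. ennreal (indicat_real S x *\<^sub>R v x) \<partial>lebesgue) = wmeas v S"
      unfolding wmeas_def by (intro nn_integral_cong) (auto simp: indicator_def)
    then show "(\<integral>\<^sup>+x. ennreal (indicat_real S x *\<^sub>R v x) \<partial>lebesgue) < \<infinity>" using fin by simp
  qed (use v0 in \<open>auto simp: less_imp_le\<close>)
qed

lemma weight_class_muckenhoupt_const:
  fixes v :: "real ^ 'n \<Rightarrow> real"
  assumes v: "v \<in> weight_class 1 b K" and b: "0 \<le> b"
  shows "muckenhoupt_const (1 + b) v \<le> ennreal K" and "v \<in> muckenhoupt (1 + b)"
proof -
  note [measurable] = weight_classD(1)[OF v]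
  note v0 = weight_classD(2)[OF v]
  have K: "0 < K" using v by (rule weight_class_const_pos)
  have one: "b = 0 \<Longrightarrow> A1_bound v K"
    unfolding A1_bound_def
  proof
    fix Q :: "(real ^ 'n) set" assume b: "b = 0" and Q: "Q \<in> cubes"
    obtain s t where st: "0 < s" "0 < t" "s * t \<le> K" "mean_bound 1 v Q s" "mean_bound b (\<lambda>x. 1 / v x) Q t"
      by (rule weight_classE[OF v Q])
    have s: "avg v Q \<le> ennreal s" using st(1,4) v0 by (simp add: mean_bound_def less_imp_le)
    have "AE x in lebesgue. x \<in> Q \<longrightarrow> 1 / v x \<le> t" using st(5) b by (simp add: mean_bound_def)
    then show "AE x in lebesgue. x \<in> Q \<longrightarrow> avg v Q \<le> ennreal (K * v x)"
    proof eventually_elim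
      case (elim x)
      show ?case
      proof
        assume "x \<in> Q"
        then have "1 \<le> t * v x" using elim v0[of x] by (simp add: divide_le_eq)
        then have "s * 1 \<le> s * (t * v x)" using st by (intro mult_left_mono) auto
        also have "\<dots> \<le> K * v x" using st(3) v0[of x] by (simp add: mult.assoc[symmetric] mult_right_mono)
        finally show "avg v Q \<le> ennreal (K * v x)" using s by (auto intro: order_trans ennreal_leI)
      qed
    qed
  qed
  have many: "avg v Q * avg (\<lambda>x. v x powr (1 - (1 + b) / (1 + b - 1))) Q epowr (1 + b - 1) \<le> ennreal K"
    if b0: "b \<noteq> 0" and Q: "Q \<in> cubes" for Q
  proof -
    have bpos: "0 < b" using b b0 by simp
    obtain s t where st: "0 < s" "0 < t" "s * t \<le> K" "mean_bound 1 v Q s" "mean_bound b (\<lambda>x. 1 / v x) Q t"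
      by (rule weight_classE[OF v Q])
    have s: "avg v Q \<le> ennreal s" using st(1,4) v0 by (simp add: mean_bound_def less_imp_le)
    \<comment> \<open>For p = 1 + b one has 1 - p' = -1/b, so the dual average in the Muckenhoupt
      constant is the one bounded by \<open>t\<close>.\<close>
    have "1 - (1 + b) / (1 + b - 1) = - (1 / b)" using bpos by (simp add: field_simps)
    then have eq: "(\<lambda>x. v x powr (1 - (1 + b) / (1 + b - 1))) = (\<lambda>x. (1 / v x) powr (1 / b))"
      using v0 by (intro ext) (simp add: powr_divide powr_minus_divide less_imp_le)
    have "avg (\<lambda>x. v x powr (1 - (1 + b) / (1 + b - 1))) Q epowr b \<le> ennreal (t powr (1 / b)) epowr b"
      unfolding eq using st(5) bpos by (intro epowr_mono) (auto simp: mean_bound_def)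
    also have "\<dots> = ennreal t" using st bpos by (simp add: epowr_ennreal powr_powr)
    finally have "avg v Q * avg (\<lambda>x. v x powr (1 - (1 + b) / (1 + b - 1))) Q epowr b \<le> ennreal s * ennreal t"
      using s by (intro mult_mono) auto
    also have "\<dots> \<le> ennreal K" using st by (simp add: ennreal_leI flip: ennreal_mult)
    finally show ?thesis by simp
  qed
  show const: "muckenhoupt_const (1 + b) v \<le> ennreal K"
    unfolding muckenhoupt_const_def using one many K by (auto intro!: SUP_least INF_lower)
  have "weight v" by (rule weight_class_weight[OF v]) (use b in auto)
  then show "v \<in> muckenhoupt (1 + b)"
    unfolding muckenhoupt_def using v0 one K le_less_trans[OF const] by (auto intro!: exI[of _ K])
qed

text \<open>By \<open>mean_bound_inverse\<close> the average of \<open>v\<close> times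
  \<open>t\<close> is at least 1, so \<open>s * t \<le> K\<close> becomes: \<open>s\<close> is at
  most \<open>K\<close> times the average.\<close>

lemma weight_class_reverse_holder:
  fixes v :: "real ^ 'n \<Rightarrow> real"
  assumes v: "v \<in> weight_class a b K" and a: "0 \<le> a" "a < 1" and b: "0 \<le> b"
  shows "v \<in> reverse_holder (if a = 0 then \<infinity> else ereal (1 / a))"
proof -
  note [measurable] = weight_classD(1)[OF v]
  note v0 = weight_classD(2)[OF v]
  have K: "0 < K" using v by (rule weight_class_const_pos)
  let ?\<sigma> = "if a = 0 then \<infinity> else ereal (1 / a)"
  have main: "(if ?\<sigma> = \<infinity> then esssup (restrict_space lebesgue Q) (\<lambda>x. ennreal (v x))
      else avg (\<lambda>x. v x powr real_of_ereal ?\<sigma>) Q epowr (1 / real_of_ereal ?\<sigma>)) \<le> ennreal K * avg v Q"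
    if Q: "Q \<in> cubes" for Q
  proof -
    obtain s t where st: "0 < s" "0 < t" "s * t \<le> K" "mean_bound a v Q s" "mean_bound b (\<lambda>x. 1 / v x) Q t"
      by (rule weight_classE[OF v Q])
    have m1: "mean_bound 1 v Q s"
      using Q v0 st a by (intro mean_bound_mono_exponent[of Q v a s 1]) (auto simp: less_imp_le)
    have "avg v Q \<le> ennreal s" using m1 st(1) v0 by (simp add: mean_bound_def less_imp_le)
    then have fin: "avg v Q < top" by (rule le_less_trans) simp
    have "0 < wmeas v Q"
      using Q cubes_measure_pos[OF Q] by (intro wmeas_pos) (auto intro: v0)
    then have "0 < avg v Q" using Q cubes_emeasure[OF Q] by (simp add: avg_def ennreal_zero_less_divide)
    with fin obtain y where y: "avg v Q = ennreal y" "0 < y" by (cases "avg v Q") auto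
    have "1 \<le> y * t" using Q v0 st b y by (intro mean_bound_inverse[of Q v b t y]) auto
    then have "s * 1 \<le> s * (y * t)" using st by (intro mult_left_mono) auto
    also have "\<dots> \<le> K * y" using mult_right_mono[OF st(3), of y] y by (simp add: mult_ac)
    finally have "ennreal s \<le> ennreal (K * y)" by (simp add: ennreal_leI)
    then have sK: "ennreal s \<le> ennreal K * avg v Q" using K y by (simp add: ennreal_mult)
    show ?thesis
    proof (cases "a = 0")
      case True
      have [measurable]: "Q \<in> sets lebesgue" using Q by simp
      have "AE x in lebesgue. x \<in> Q \<longrightarrow> ennreal (v x) \<le> ennreal s"
        using st(4) True by (auto simp: mean_bound_def elim!: eventually_mono intro: ennreal_leI)
      then have "esssup (restrict_space lebesgue Q) (\<lambda>x. ennreal (v x)) \<le> ennreal s"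
        by (intro esssup_I measurable_restrict_space1) (auto simp: AE_restrict_space_iff)
      then show ?thesis using sK True by auto
    next
      case False
      then have a0: "0 < a" using a by simp
      have "avg (\<lambda>x. v x powr (1 / a)) Q epowr a \<le> ennreal (s powr (1 / a)) epowr a"
        using st(4) a0 by (intro epowr_mono) (auto simp: mean_bound_def)
      also have "\<dots> = ennreal s" using a0 st by (simp add: epowr_ennreal powr_powr)
      finally show ?thesis using sK False by auto
    qed
  qed
  have w: "weight v" by (rule weight_class_weight[OF v]) (use a b in auto)
  show ?thesis
    unfolding reverse_holder_def by (intro CollectI conjI exI[of _ K] ballI main less_imp_le[OF K] w)
qed

lemma avg_weight:
  assumes w: "weight v" and v0: "\<And>x. 0 < v x" and Q: "Q \<in> cubes"
  obtains s where "avg v Q = ennreal s" "0 < s"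
proof -
  have [measurable]: "v \<in> borel_measurable lebesgue" using w by (simp add: weight_def)
  have [measurable]: "Q \<in> sets lebesgue" using Q by simp
  have "compact Q" using Q by (auto simp: cubes_def)
  then have "set_integrable lebesgue Q v" using w by (auto simp: weight_def)
  then have "(\<integral>\<^sup>+x. ennreal (norm (indicat_real Q x *\<^sub>R v x)) \<partial>lebesgue) < \<infinity>"
    unfolding set_integrable_def by (simp add: integrable_iff_bounded)
  also have "(\<integral>\<^sup>+x. ennreal (norm (indicat_real Q x *\<^sub>R v x)) \<partial>lebesgue) = wmeas v Q"
    unfolding wmeas_def using v0 by (intro nn_integral_cong) (auto simp: indicator_def less_imp_le)
  finally have "avg v Q < top"
    using cubes_measure_pos[OF Q] by (simp add: avg_def cubes_emeasure[OF Q] ennreal_divide_eq_top_iff less_top[symmetric])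
  moreover have "0 < wmeas v Q"
    using Q cubes_measure_pos[OF Q] by (intro wmeas_pos) (auto intro: v0)
  then have "0 < avg v Q" using Q cubes_emeasure[OF Q] by (simp add: avg_def ennreal_zero_less_divide)
  ultimately show thesis by (cases "avg v Q") (auto intro: that)
qed

text \<open>The bound by \<open>K\<close> is strict because the A_1 constant is an infimum:
  strictness provides an admissible \<open>c\<close> below \<open>K\<close>.\<close>

lemma muckenhoupt_const_bound:
  fixes v :: "real ^ 'n \<Rightarrow> real"
  assumes w: "weight v" and v0: "\<And>x. 0 < v x" and b: "0 \<le> b"
    and const: "muckenhoupt_const (1 + b) v < ennreal K" and Q: "Q \<in> cubes" and s: "avg v Q = ennreal s" "0 < s"
  shows "\<exists>t>0. s * t \<le> K \<and> mean_bound b (\<lambda>x. 1 / v x) Q t"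
proof (cases "b = 0")
  case True
  then obtain c where c: "0 \<le> c" "A1_bound v c" "c < K"
    using const by (auto simp: muckenhoupt_const_def INF_less_iff ennreal_less_iff)
  have A: "AE x in lebesgue. x \<in> Q \<longrightarrow> ennreal s \<le> ennreal (c * v x)"
    using c(2) Q by (auto simp: A1_bound_def s)
  have "c \<noteq> 0" using AE_cube_ex[OF Q A] s by auto
  with c have c0: "0 < c" by simp
  have "AE x in lebesgue. x \<in> Q \<longrightarrow> 1 / v x \<le> c / s"
    using A by eventually_elim (use v0 c0 s in \<open>auto simp: field_simps ennreal_le_iff less_imp_le\<close>)
  then show ?thesis using c0 s c by (intro exI[of _ "c / s"]) (auto simp: mean_bound_def True)
next
  case False
  with b have b0: "0 < b" by simp
  have [measurable]: "v \<in> borel_measurable lebesgue" using w by (simp add: weight_def)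
  let ?N = "avg (\<lambda>x. (1 / v x) powr (1 / b)) Q"
  have "1 - (1 + b) / (1 + b - 1) = - (1 / b)" using b0 by (simp add: field_simps)
  then have eq: "(\<lambda>x. v x powr (1 - (1 + b) / (1 + b - 1))) = (\<lambda>x. (1 / v x) powr (1 / b))"
    using v0 by (intro ext) (simp add: powr_divide powr_minus_divide less_imp_le)
  have "avg v Q * ?N epowr b \<le> muckenhoupt_const (1 + b) v"
    unfolding muckenhoupt_const_def eq using Q b0 by (auto intro: SUP_upper2[OF Q])
  then have le: "ennreal s * ?N epowr b \<le> ennreal K" using const s by simp
  have "?N \<noteq> top"
  proof
    assume "?N = top"
    then show False using le s b0 by (simp add: epowr_top ennreal_mult_top top_unique)
  qed
  moreover have "0 < wmeas (\<lambda>x. (1 / v x) powr (1 / b)) Q"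
    using Q cubes_measure_pos[OF Q] by (intro wmeas_pos) (auto simp: v0[THEN less_imp_neq, THEN not_sym])
  then have "0 < ?N" using Q cubes_emeasure[OF Q] by (simp add: avg_def ennreal_zero_less_divide)
  ultimately obtain y where y: "?N = ennreal y" "0 < y" by (cases ?N) auto
  have "ennreal (s * y powr b) \<le> ennreal K" using le y s b0 by (simp add: epowr_ennreal ennreal_mult)
  moreover have "0 < s * y powr b" using s y by simp
  ultimately have "s * y powr b \<le> K" by (meson ennreal_le_iff2 not_le)
  then show ?thesis using y b0 by (intro exI[of _ "y powr b"]) (auto simp: mean_bound_def powr_powr)
qed

lemma muckenhoupt_const_weight_class:
  fixes v :: "real ^ 'n \<Rightarrow> real"
  assumes w: "weight v" and v0: "\<And>x. 0 < v x" and b: "0 \<le> b"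
    and const: "muckenhoupt_const (1 + b) v < ennreal K"
  shows "v \<in> weight_class 1 b K"
proof -
  have "\<exists>s t. 0 < s \<and> 0 < t \<and> s * t \<le> K \<and> mean_bound 1 v Q s \<and> mean_bound b (\<lambda>x. 1 / v x) Q t"
    if Q: "Q \<in> cubes" for Q
  proof -
    obtain s where s: "avg v Q = ennreal s" "0 < s" by (rule avg_weight[OF w v0 Q])
    moreover obtain t where "0 < t" "s * t \<le> K" "mean_bound b (\<lambda>x. 1 / v x) Q t"
      using muckenhoupt_const_bound[OF w v0 b const Q s] by auto
    ultimately show ?thesis
      using v0 by (intro exI[of _ s] exI[of _ t]) (auto simp: mean_bound_def less_imp_le)
  qed
  moreover have "v \<in> borel_measurable lebesgue" using w by (simp add: weight_def)
  ultimately show ?thesis using v0 by (auto simp: weight_class_def)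
qed

lemma muckenhoupt_reverse_holder_weight_class:
  fixes v :: "real ^ 'n \<Rightarrow> real"
  assumes w: "weight v" and v0: "\<And>x. 0 < v x" and b: "0 \<le> b" and a: "0 < a"
    and const: "muckenhoupt_const (1 + b) v < ennreal K"
    and rh: "\<And>Q. Q \<in> cubes \<Longrightarrow> avg (\<lambda>x. v x powr (1 / a)) Q epowr a \<le> ennreal c * avg v Q"
    and c: "0 < c"
  shows "v \<in> weight_class a b (c * K)"
proof -
  have "\<exists>s t. 0 < s \<and> 0 < t \<and> s * t \<le> c * K \<and> mean_bound a v Q s \<and> mean_bound b (\<lambda>x. 1 / v x) Q t"
    if Q: "Q \<in> cubes" for Q
  proof -
    obtain s where s: "avg v Q = ennreal s" "0 < s" by (rule avg_weight[OF w v0 Q])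
    obtain t where t: "0 < t" "s * t \<le> K" "mean_bound b (\<lambda>x. 1 / v x) Q t"
      using muckenhoupt_const_bound[OF w v0 b const Q s] by auto
    have "avg (\<lambda>x. v x powr (1 / a)) Q epowr a \<le> ennreal (c * s)"
      using rh[OF Q] c s by (simp add: ennreal_mult)
    then have "(avg (\<lambda>x. v x powr (1 / a)) Q epowr a) epowr (1 / a) \<le> ennreal (c * s) epowr (1 / a)"
      using a by (intro epowr_mono) auto
    then have "mean_bound a v Q (c * s)"
      using a c s by (simp add: mean_bound_def epowr_epowr epowr_ennreal)
    then show ?thesis using t s c by (intro exI[of _ "c * s"] exI[of _ t]) (auto simp: mult.assoc)
  qed
  moreover have "v \<in> borel_measurable lebesgue" using w by (simp add: weight_def)
  ultimately show ?thesis using v0 by (auto simp: weight_class_def)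
qed


subsection \<open>Uniform constants in the extrapolation hypothesis\<close>

lemma le_of_epowr_le:
  assumes "x epowr (1 / p) \<le> ennreal c * y epowr (1 / p)" "0 < p" "0 \<le> c"
  shows "x \<le> ennreal (c powr p) * y"
proof -
  have "(x epowr (1 / p)) epowr p \<le> (ennreal c * y epowr (1 / p)) epowr p"
    using assms by (intro epowr_mono) auto
  then show ?thesis using assms by (simp add: epowr_epowr epowr_mult epowr_ennreal)
qed

lemma Lpw_norm_nonneg:
  fixes f :: "real ^ 'n \<Rightarrow> real"
  assumes "\<And>x. 0 \<le> f x"
  shows "Lpw_norm p w E f = (\<integral>\<^sup>+x\<in>E. ennreal (f x powr p * w x) \<partial>lebesgue) epowr (1 / p)"
  using assms by (simp add: Lpw_norm_def)

text \<open>The reciprocal of the conjugate exponent of y/x is \<open>1 - x / y\<close>, with 0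
  standing for the exponent infinity. This is the first parameter of the weight classes.\<close>

lemma conj_exponent_real:
  assumes "0 < x" "x \<le> y"
  shows "conj_exponent (ereal (y / x)) = (if 1 - x / y = 0 then \<infinity> else ereal (1 / (1 - x / y)))"
proof (cases "x = y")
  case False
  then have "ereal (y / x) \<noteq> 1" using assms by (simp add: one_ereal_def)
  moreover have "1 - x / y \<noteq> 0" "y / x - 1 \<noteq> 0" using assms False by (auto simp: field_simps)
  moreover have "(y / x) / (y / x - 1) = 1 / (1 - x / y)" using assms False by (simp add: field_simps)
  ultimately show ?thesis by (simp add: conj_exponent_def one_ereal_def)
qed (use assms in \<open>simp add: conj_exponent_def one_ereal_def\<close>)

text \<open>The constant \<open>c1\<close> need not be monotone, so it is not bounded on bounded sets of Muckenhoupt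
  constants. Multiplying a weight by \<open>1 + s\<close> on a small cube moves its Muckenhoupt constant
  continuously from below \<open>K + 1\<close> to above, and by the intermediate value theorem every weight is
  comparable to one whose constant is exactly \<open>K + 1\<close>.\<close>

lemma weight_with_prescribed_const:
  fixes v :: "real ^ 'n \<Rightarrow> real"
  assumes v: "v \<in> weight_class 1 b K" and b: "0 \<le> b"
  defines "S \<equiv> (K + 1) * 2 powr (1 + (b + 1)) * (K * (2 ^ CARD('n)) powr (1 + (b + 1)))"
  obtains u where "u \<in> borel_measurable lebesgue" "\<And>x. v x \<le> u x" "\<And>x. u x \<le> (1 + S) * v x"
    "muckenhoupt_const (1 + b) u = ennreal (K + 1)"
proof -
  note [measurable] = weight_classD(1)[OF v]
  note v0 = weight_classD(2)[OF v]
  have K: "0 < K" using v by (rule weight_class_const_pos)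
  have S: "0 < S" using K by (simp add: S_def)
  let ?Q = "cb 0 1 :: (real ^ 'n) set" and ?E = "cb 0 (1 / 2) :: (real ^ 'n) set"
  define w where "w s x = v x * (1 + s * indicator ?E x)" for s x
  have [measurable]: "w s \<in> borel_measurable lebesgue" for s unfolding w_def by measurable
  have w_le: "w s x \<le> w s' x" "w s' x \<le> (1 + (s' - s)) * w s x" if "0 \<le> s" "s \<le> s'" for s s' x
  proof -
    show "w s x \<le> w s' x" using that v0[of x] by (auto simp: w_def indicator_def)
    have "1 + s' \<le> (1 + (s' - s)) * (1 + s)" using that mult_nonneg_nonneg[of s "s' - s"] by (simp add: algebra_simps)
    then show "w s' x \<le> (1 + (s' - s)) * w s x"
      using that v0[of x] by (auto simp: w_def indicator_def mult.left_commute mult_le_cancel_left)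
  qed
  have w0: "w 0 = v" by (simp add: w_def fun_eq_iff)
  have w_class: "w s \<in> weight_class 1 b ((1 + s) * K)" if "0 \<le> s" for s
    using weight_class_comparable[OF v, of 1 "1 + s" "w s"] b w_le[of 0 s] that by (simp add: w0)
  have w_pos: "0 < w s x" if "0 \<le> s" for s x using w_class[OF that] by (rule weight_classD)
  let ?M = "\<lambda>s. muckenhoupt_const (1 + b) (w s)"
  have M_le: "?M s \<le> ennreal ((1 + s) * K)" if "0 \<le> s" for s
    using w_class[OF that] b by (rule weight_class_muckenhoupt_const)
  define m where "m s = enn2real (?M s)" for s
  have M: "?M s = ennreal (m s)" if "0 \<le> s" for s
    using le_less_trans[OF M_le[OF that]] by (simp add: m_def)
  have m0: "0 \<le> m s" for s by (simp add: m_def)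
  have m_le: "m s \<le> (1 + s) * K" if "0 \<le> s" for s
    using M_le[OF that] M[OF that] K that by simp
  have w_weight: "weight (w s)" if "0 \<le> s" for s
    by (rule weight_class_weight[OF w_class[OF that]]) (use b in auto)
  have in_class: "w s \<in> weight_class 1 b y" if "0 \<le> s" "m s < y" for s y
    using that m0[of s] by (intro muckenhoupt_const_weight_class w_weight w_pos b) (auto simp: M ennreal_less_iff)
  \<comment> \<open>Comparable weights have comparable constants. Membership in a class is obtained
    from a strict bound on the constant, whence the slack \<open>e\<close>.\<close>
  have ratio: "m s' \<le> c2 / c1 * m s" if s: "0 \<le> s" "0 \<le> s'" and c: "0 < c1" "0 < c2"
    and cmp: "\<And>x. c1 * w s x \<le> w s' x" "\<And>x. w s' x \<le> c2 * w s x" for s s' c1 c2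
  proof (rule field_le_epsilon)
    fix e :: real assume e: "0 < e"
    have "m s < m s + e * c1 / c2" using e c by simp
    from in_class[OF s(1) this] have "w s' \<in> weight_class 1 b (c2 / c1 * (m s + e * c1 / c2))"
      using b c cmp by (intro weight_class_comparable[where v = "w s"]) auto
    from weight_class_muckenhoupt_const(1)[OF this b]
    have "m s' \<le> c2 / c1 * (m s + e * c1 / c2)"
      using s c e m0[of s] by (simp add: M add_nonneg_nonneg)
    also have "\<dots> = c2 / c1 * m s + e" using c by (simp add: field_simps)
    finally show "m s' \<le> c2 / c1 * m s + e" .
  qed
  have lip: "\<bar>m s - m s'\<bar> \<le> (1 + S) * K * \<bar>s - s'\<bar>" if s: "0 \<le> s" "s \<le> s'" "s' \<le> S" for s s'
  proof -
    let ?d = "s' - s"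
    have "m s' \<le> (1 + ?d) / 1 * m s" using s w_le[OF s(1,2)] by (intro ratio) auto
    moreover have "m s \<le> 1 / (1 / (1 + ?d)) * m s'"
      using s w_le[OF s(1,2)] by (intro ratio) (auto simp: divide_le_eq mult.commute)
    ultimately have "m s' - m s \<le> ?d * m s" "m s - m s' \<le> ?d * m s'" by (auto simp: algebra_simps)
    moreover have "m t \<le> (1 + S) * K" if "0 \<le> t" "t \<le> S" for t
      using that K by (intro order_trans[OF m_le mult_right_mono]) auto
    then have "?d * m s \<le> ?d * ((1 + S) * K)" "?d * m s' \<le> ?d * ((1 + S) * K)"
      using s by (auto intro!: mult_left_mono)
    ultimately have "m s' - m s \<le> ?d * ((1 + S) * K)" "m s - m s' \<le> ?d * ((1 + S) * K)" by linarith+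
    then show ?thesis using s by (simp add: abs_le_iff mult.commute)
  qed
  have "((1 + S) * K)-lipschitz_on {0..S} m"
  proof (rule lipschitz_onI)
    fix s s' assume "s \<in> {0..S}" "s' \<in> {0..S}"
    then show "dist (m s) (m s') \<le> (1 + S) * K * dist s s'"
      using lip[of s s'] lip[of s' s] by (cases "s \<le> s'") (auto simp: dist_real_def abs_minus_commute)
  qed (use S K in simp)
  then have cont: "continuous_on {0..S} m" by (rule lipschitz_on_continuous_on)
  have "m 0 \<le> K + 1" using m_le[of 0] by simp
  moreover have "K + 1 \<le> m S"
  proof (rule ccontr)
    assume "\<not> K + 1 \<le> m S"
    then have "w S \<in> weight_class 1 b (K + 1)" using S by (intro in_class) auto
    \<comment> \<open>\<open>weight_class_subset\<close> wants a positive second parameter, so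
      \<open>b\<close> is raised to \<open>b + 1\<close>; this is the \<open>b + 1\<close> inside
      \<open>S\<close>.\<close>
    then have wS: "w S \<in> weight_class 1 (b + 1) (K + 1)" by (rule weight_class_mono) (use b in auto)
    have v1: "v \<in> weight_class 1 (b + 1) K" by (rule weight_class_mono[OF v]) (use b in auto)
    have Q: "?Q \<in> cubes" "?E \<subseteq> ?Q"
    proof -
      show "?Q \<in> cubes" by (rule cb_in_cubes) simp
      have "x $ i \<le> 1" if "\<forall>i. 0 \<le> x $ i \<and> x $ i \<le> 1 / 2" for x :: "real ^ 'n" and i
        using spec[OF that, of i] by simp
      then show "?E \<subseteq> ?Q" by (auto simp: mem_cb)
    qed
    have half: "(1 / 2 :: real) ^ CARD('n) \<le> 1 / 2"
      using power_decreasing[of 1 "CARD('n)" "1 / 2 :: real"] by (simp add: Suc_le_eq)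
    have mE: "measure lebesgue ?E = (1 / 2) ^ CARD('n)" and mQ: "measure lebesgue ?Q = 1" by (simp_all add: measure_cb)
    have mD: "measure lebesgue (?Q - ?E) = 1 - (1 / 2) ^ CARD('n)"
      using Q by (subst measurable_measure_Diff) (auto simp: mE mQ, simp add: cb_def)
    have pw: "(\<lambda>x. v x powr (1 / 1)) = v" "(\<lambda>x. w S x powr (1 / 1)) = w S"
      using v0 w_pos[of S] S by (auto simp: less_imp_le)
    obtain e where e: "wmeas v ?E = ennreal e" "0 < e"
      using wmeas_class_finite[OF v1 zero_less_one cb_in_cubes, of "1 / 2" 0, unfolded pw]
      by (cases "wmeas v ?E") auto
    \<comment> \<open>With the constant still below \<open>K + 1\<close>, the mass of
      \<open>w S\<close> on \<open>?Q\<close> is controlled by its mass off \<open>?E\<close>, where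
      it equals \<open>v\<close> (measure ratio at most 2), and then by \<open>v\<close> on
      \<open>?E\<close> (ratio \<open>2 ^ CARD('n)\<close>), giving \<open>S * e\<close>. But
      \<open>?E\<close> alone carries \<open>(1 + S) * e\<close>.\<close>
    have "wmeas (w S) ?Q \<le> ennreal ((K + 1) powr (1 / 1) * (measure lebesgue ?Q / measure lebesgue (?Q - ?E)) powr (1 + (b + 1) / 1)) * wmeas (w S) (?Q - ?E)"
      using weight_class_subset[OF wS _ _ Q(1), of "?Q - ?E", unfolded pw] b half by (simp add: mD)
    also have "\<dots> \<le> ennreal ((K + 1) * 2 powr (1 + (b + 1))) * wmeas v ?Q"
    proof (rule mult_mono)
      have "(1 / (1 - (1 / 2) ^ CARD('n))) powr (1 + (b + 1)) \<le> 2 powr (1 + (b + 1))"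
        using half b by (intro powr_mono2) (auto simp: field_simps)
      then show "ennreal ((K + 1) powr (1 / 1) * (measure lebesgue ?Q / measure lebesgue (?Q - ?E)) powr (1 + (b + 1) / 1)) \<le> ennreal ((K + 1) * 2 powr (1 + (b + 1)))"
        using K by (intro ennreal_leI) (simp add: mD mQ)
      show "wmeas (w S) (?Q - ?E) \<le> wmeas v ?Q"
        unfolding wmeas_def by (intro nn_integral_mono) (auto simp: w_def indicator_def)
    qed auto
    also have "wmeas v ?Q \<le> ennreal (K * (2 ^ CARD('n)) powr (1 + (b + 1))) * ennreal e"
      using weight_class_subset[OF v1 _ _ Q, unfolded pw] b K
      by (simp add: mE mQ e power_one_over)
    finally have le: "wmeas (w S) ?Q \<le> ennreal (S * e)"
      using K e by (simp add: S_def mult_left_mono ennreal_mult mult.assoc)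
    have "ennreal ((1 + S) * e) = (\<integral>\<^sup>+x\<in>?E. ennreal (w S x) \<partial>lebesgue)"
    proof -
      have "(\<integral>\<^sup>+x\<in>?E. ennreal (w S x) \<partial>lebesgue) = (\<integral>\<^sup>+x. ennreal (1 + S) * (ennreal (v x) * indicator ?E x) \<partial>lebesgue)"
      proof (rule nn_integral_cong)
        fix x
        have "ennreal (v x * (1 + S)) = ennreal (1 + S) * ennreal (v x)"
          using S v0[of x] by (subst ennreal_mult[symmetric]) (auto simp: mult.commute)
        then show "ennreal (w S x) * indicator ?E x = ennreal (1 + S) * (ennreal (v x) * indicator ?E x)"
          by (auto simp: w_def indicator_def)
      qed
      also have "\<dots> = ennreal (1 + S) * wmeas v ?E"
        unfolding wmeas_def by (rule nn_integral_cmult) simp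
      finally show ?thesis using S e by (simp add: ennreal_mult)
    qed
    also have "\<dots> \<le> wmeas (w S) ?Q" using wmeas_mono[OF Q(2)] by (simp add: wmeas_def)
    finally have "ennreal ((1 + S) * e) \<le> ennreal (S * e)" using le by (rule order_trans)
    then show False using S e by (simp add: algebra_simps)
  qed
  ultimately obtain s where s: "0 \<le> s" "s \<le> S" "m s = K + 1"
    using IVT'[of m 0 "K + 1" S] cont S by auto
  show thesis
  proof (rule that[of "w s"])
    show "v x \<le> w s x" for x using w_le(1)[of 0 s x] s by (simp add: w0)
    have "(1 + s) * v x \<le> (1 + S) * v x" for x using s v0[of x] by (intro mult_right_mono) auto
    then show "w s x \<le> (1 + S) * v x" for x using w_le(2)[of 0 s x] s by (auto simp: w0 intro: order_trans)
    show "muckenhoupt_const (1 + b) (w s) = ennreal (K + 1)" using M[OF s(1)] s by simp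
  qed simp
qed

text \<open>Each weight is replaced by a comparable one whose A_q constant is exactly
  \<open>K + 1\<close>, so that \<open>c1\<close> is evaluated at this single point for the whole
  class.\<close>

lemma weighted_ineq_base:
  fixes F :: "((real ^ 'n \<Rightarrow> real) \<times> (real ^ 'n \<Rightarrow> real)) set"
  assumes exponents: "1 \<le> m" "m \<le> q" "q \<le> P"
    and F: "\<And>f g. (f, g) \<in> F \<Longrightarrow>
        f \<in> borel_measurable lebesgue \<and> g \<in> borel_measurable lebesgue \<and>
        (\<forall>x. 0 \<le> f x) \<and> (\<forall>x. 0 \<le> g x)"
    and c1_pos: "\<And>t. c1 t > 0"
    and hyp: "\<And>f g v. (f, g) \<in> F \<Longrightarrow>
        v \<in> muckenhoupt (q / m) \<inter> reverse_holder (conj_exponent (ereal (P / q))) \<Longrightarrow>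
        Lpw_norm q v UNIV g \<le> ennreal (c1 (muckenhoupt_const q v)) * Lpw_norm q v UNIV f"
  shows "weighted_ineq F q (1 - q / P) (q / m - 1)"
  unfolding weighted_ineq_def
proof
  fix K
  let ?a = "1 - q / P" and ?b = "q / m - 1"
  have a: "0 \<le> ?a" "?a < 1" and b: "0 \<le> ?b" "?b \<le> q - 1"
    using exponents by (auto simp: divide_le_eq mult_left_mono[of 1 m q, simplified])
  define S where "S = (K + 1) * 2 powr (1 + ((q - 1) + 1)) * (K * (2 ^ CARD('n)) powr (1 + ((q - 1) + 1)))"
  let ?c = "c1 (ennreal (K + 1))"
  show "\<exists>C>0. \<forall>v\<in>weight_class ?a ?b K. \<forall>f g. (f, g) \<in> F \<longrightarrow>
     (\<integral>\<^sup>+x. ennreal (g x powr q * v x) \<partial>lebesgue) \<le> ennreal C * (\<integral>\<^sup>+x. ennreal (f x powr q * v x) \<partial>lebesgue)"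
  proof (cases "0 < K")
    case K: True
    have S: "0 < S" using K by (simp add: S_def)
    show ?thesis
    proof (intro exI[of _ "?c powr q * (1 + S)"] conjI ballI allI impI)
      show "0 < ?c powr q * (1 + S)" using c1_pos[of "ennreal (K + 1)"] S by simp
      fix v f g :: "real ^ 'n \<Rightarrow> real"
      assume v: "v \<in> weight_class ?a ?b K" and fg: "(f, g) \<in> F"
      note [measurable] = weight_classD(1)[OF v]
      note v0 = weight_classD(2)[OF v]
      have [measurable]: "f \<in> borel_measurable lebesgue" "g \<in> borel_measurable lebesgue"
        and f0: "\<And>x. 0 \<le> f x" and g0: "\<And>x. 0 \<le> g x" using F[OF fg] by auto
      \<comment> \<open>The argument of \<open>c1\<close> is the A_q constant, while membership
        concerns A_(q/m); enlarging the second parameter to \<open>q - 1\<close> passes from the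
        latter to the former.\<close>
      have v1: "v \<in> weight_class 1 (q - 1) K" by (rule weight_class_mono[OF v]) (use a b in auto)
      obtain u where [measurable]: "u \<in> borel_measurable lebesgue"
        and u: "\<And>x. v x \<le> u x" "\<And>x. u x \<le> (1 + S) * v x"
          "muckenhoupt_const (1 + (q - 1)) u = ennreal (K + 1)"
        using weight_with_prescribed_const[OF v1] exponents unfolding S_def by auto
      have uc: "u \<in> weight_class ?a ?b ((1 + S) / 1 * K)"
        by (rule weight_class_comparable[OF v]) (use a b S u in auto)
      have "u \<in> weight_class 1 ?b ((1 + S) / 1 * K)" by (rule weight_class_mono[OF uc]) (use a b in auto)
      from weight_class_muckenhoupt_const(2)[OF this b(1)] have "u \<in> muckenhoupt (q / m)" by simp
      moreover have "u \<in> reverse_holder (conj_exponent (ereal (P / q)))"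
        using weight_class_reverse_holder[OF uc a b(1)] exponents by (simp add: conj_exponent_real)
      ultimately have "Lpw_norm q u UNIV g \<le> ennreal ?c * Lpw_norm q u UNIV f"
        using hyp[OF fg, of u] u(3) by simp
      then have "(\<integral>\<^sup>+x. ennreal (g x powr q * u x) \<partial>lebesgue) \<le> ennreal (?c powr q) * (\<integral>\<^sup>+x. ennreal (f x powr q * u x) \<partial>lebesgue)"
        using exponents c1_pos[of "ennreal (K + 1)"]
        by (intro le_of_epowr_le) (auto simp: Lpw_norm_nonneg f0 g0)
      moreover have "(\<integral>\<^sup>+x. ennreal (g x powr q * v x) \<partial>lebesgue) \<le> (\<integral>\<^sup>+x. ennreal (g x powr q * u x) \<partial>lebesgue)"
        using u(1) by (intro nn_integral_mono ennreal_leI mult_left_mono) auto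
      moreover have "(\<integral>\<^sup>+x. ennreal (f x powr q * u x) \<partial>lebesgue) \<le> ennreal (1 + S) * (\<integral>\<^sup>+x. ennreal (f x powr q * v x) \<partial>lebesgue)"
      proof -
        have "(\<integral>\<^sup>+x. ennreal (f x powr q * u x) \<partial>lebesgue) \<le> (\<integral>\<^sup>+x. ennreal (1 + S) * ennreal (f x powr q * v x) \<partial>lebesgue)"
        proof (rule nn_integral_mono)
          fix x
          have "f x powr q * u x \<le> (1 + S) * (f x powr q * v x)"
            using mult_left_mono[OF u(2)[of x], of "f x powr q"] by (simp add: mult_ac)
          then show "ennreal (f x powr q * u x) \<le> ennreal (1 + S) * ennreal (f x powr q * v x)"
            using S v0[of x] by (subst ennreal_mult[symmetric]) (auto simp: ennreal_leI)
        qed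
        then show ?thesis by (simp add: nn_integral_cmult)
      qed
      ultimately have "(\<integral>\<^sup>+x. ennreal (g x powr q * v x) \<partial>lebesgue)
          \<le> ennreal (?c powr q) * (ennreal (1 + S) * (\<integral>\<^sup>+x. ennreal (f x powr q * v x) \<partial>lebesgue))"
        by (meson mult_left_mono order_trans zero_le)
      then show "(\<integral>\<^sup>+x. ennreal (g x powr q * v x) \<partial>lebesgue)
          \<le> ennreal (?c powr q * (1 + S)) * (\<integral>\<^sup>+x. ennreal (f x powr q * v x) \<partial>lebesgue)"
        using S by (subst ennreal_mult) (auto simp: mult.assoc)
    qed
  next
    case False
    then show ?thesis using weight_class_const_pos by (intro exI[of _ 1]) auto
  qed
qed

text \<open>The pairs \<open>(1 - p / P, p / m - 1)\<close> satisfy the exponent equations of both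
  extrapolation steps. Strict inequalities keep both parameters positive; at \<open>p = m\<close>
  the base exponent already equals \<open>p\<close>.\<close>

theorem limited_range_extrapolation:
  fixes F :: "((real ^ 'n \<Rightarrow> real) \<times> (real ^ 'n \<Rightarrow> real)) set"
  assumes exponents: "1 \<le> m" "m \<le> q" "q \<le> P" and p: "(m < p \<and> p < P) \<or> (p = m \<and> q = m)"
    and F: "\<And>f g. (f, g) \<in> F \<Longrightarrow>
        f \<in> borel_measurable lebesgue \<and> g \<in> borel_measurable lebesgue \<and>
        (\<forall>x. 0 \<le> f x) \<and> (\<forall>x. 0 \<le> g x)"
    and base: "weighted_ineq F q (1 - q / P) (q / m - 1)"
  shows "weighted_ineq F p (1 - p / P) (p / m - 1)"
proof -
  consider "p < q" | "p = q" | "q < p" by linarith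
  then show ?thesis
  proof cases
    case 1
    with p exponents have mp: "0 < m" "m < p" "p < P" "0 < p" "0 < P" by auto
    show ?thesis
    proof (rule extrapolation_down[OF base F])
      show "q / m - 1 = (1 + (p / m - 1) / (1 - p / P)) * (q - p) / p + (1 - q / P) * (p / m - 1) / (1 - p / P)"
        using mp by (simp add: divide_simps) (simp add: algebra_simps)
      show "(1 - (1 - p / P)) * q / p + (1 - q / P) = 1" using mp by simp
    qed (use mp 1 exponents in \<open>auto simp: divide_le_eq\<close>)
  next
    case 2
    then show ?thesis using base by simp
  next
    case 3
    with p exponents have mp: "0 < m" "m < p" "p < P" "0 < p" "0 < P" by auto
    show ?thesis
    proof (rule extrapolation_up[OF base F])
      show "1 - q / P = (1 + (1 - p / P) / (p / m - 1)) * (p - q) / p + (q / m - 1) * (1 - p / P) / (p / m - 1)"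
        using mp by (simp add: divide_simps) (simp add: algebra_simps)
      show "(1 + (p / m - 1)) * q / p = 1 + (q / m - 1)" using mp by simp
    qed (use mp 3 exponents in \<open>auto simp: divide_le_eq\<close>)
  qed
qed

subsection \<open>Concentric dilates of a cube\<close>

text \<open>Here \<open>c\<close> and \<open>l\<close> are the corner and the side of the base cube;
  the shift keeps its centre fixed while the side is multiplied by \<open>2 ^ i\<close>.\<close>

definition dilate :: "real ^ 'n \<Rightarrow> real \<Rightarrow> nat \<Rightarrow> (real ^ 'n) set" where
  "dilate c l i = cb (c - (\<chi> j. (2 ^ i - 1) * l / 2)) (2 ^ i * l)"

lemma mem_dilate: "x \<in> dilate c l i \<longleftrightarrow> (\<forall>j. \<bar>x $ j - (c $ j + l / 2)\<bar> \<le> 2 ^ i * l / 2)"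
proof -
  have "(c - (\<chi> j. (2 ^ i - 1) * l / 2)) $ j \<le> x $ j \<and> x $ j \<le> (c - (\<chi> j. (2 ^ i - 1) * l / 2)) $ j + 2 ^ i * l
      \<longleftrightarrow> \<bar>x $ j - (c $ j + l / 2)\<bar> \<le> 2 ^ i * l / 2" for j
    by (simp add: abs_le_iff field_simps) argo
  then show ?thesis unfolding dilate_def mem_cb by simp
qed

lemma dilate_0: "dilate c l 0 = cb c l"
  by (auto simp: dilate_def zero_vec_def[symmetric])

lemma dilate_cubes [simp]: "0 < l \<Longrightarrow> dilate c l i \<in> cubes"
  by (simp add: dilate_def cb_in_cubes)

lemma sets_dilate [measurable, simp]: "dilate c l i \<in> sets lebesgue"
  by (simp add: dilate_def)

lemma dilate_mono:
  assumes "0 < l" "i \<le> k" shows "dilate c l i \<subseteq> dilate c l k"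
proof -
  have "(2 :: real) ^ i * l / 2 \<le> 2 ^ k * l / 2"
    using assms by (intro divide_right_mono mult_right_mono power_increasing) auto
  then show ?thesis unfolding subset_iff mem_dilate by (meson order_trans)
qed

lemma measure_dilate: "0 < l \<Longrightarrow> measure lebesgue (dilate c l i :: (real ^ 'n) set) = (2 ^ i * l) ^ CARD('n)"
  by (simp add: dilate_def measure_cb)

lemma measure_dilate_diff:
  fixes c :: "real ^ 'n"
  assumes "0 < l" "i \<le> k"
  shows "measure lebesgue (dilate c l k) = 2 powr (real (k - i) * CARD('n)) * measure lebesgue (dilate c l i)"
proof -
  have "(2 :: real) ^ k = 2 ^ (k - i) * 2 ^ i" using assms by (simp flip: power_add)
  moreover have "(2 :: real) powr (real (k - i) * CARD('n)) = (2 ^ (k - i)) ^ CARD('n)"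
    by (simp add: powr_realpow[symmetric] powr_powr)
  ultimately show ?thesis using assms by (simp add: measure_dilate power_mult_distrib mult.assoc)
qed

lemma bounded_subset_dilate:
  fixes c :: "real ^ 'n"
  assumes "bounded R" "0 < l"
  shows "\<exists>k. R \<subseteq> dilate c l k"
proof -
  obtain M where M: "\<And>x. x \<in> R \<Longrightarrow> norm (x - (c + (\<chi> j. l / 2))) \<le> M"
  proof -
    have "bounded ((\<lambda>x. x - (c + (\<chi> j. l / 2))) ` R)" using assms(1) by (rule bounded_translation_minus)
    then show thesis using that unfolding bounded_iff by auto
  qed
  obtain k where k: "2 * M / l < 2 ^ k" using real_arch_pow[of 2 "2 * M / l"] by auto
  have "R \<subseteq> dilate c l k"
  proof
    fix x assume x: "x \<in> R"
    have "\<bar>x $ j - (c $ j + l / 2)\<bar> \<le> 2 ^ k * l / 2" for j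
    proof -
      have "\<bar>(x - (c + (\<chi> j. l / 2))) $ j\<bar> \<le> M" using M[OF x] component_le_norm_cart order_trans by blast
      moreover have "M \<le> 2 ^ k * l / 2" using k assms(2) by (simp add: field_simps)
      ultimately show ?thesis by simp
    qed
    then show "x \<in> dilate c l k" by (simp add: mem_dilate)
  qed
  then show ?thesis ..
qed

text \<open>The index of the annulus that contains \<open>x\<close>; for \<open>0 < l\<close> it
  exists because the dilates exhaust the space, and it is 0 exactly on the base cube.\<close>

definition layer :: "real ^ 'n \<Rightarrow> real \<Rightarrow> real ^ 'n \<Rightarrow> nat" where
  "layer c l x = (LEAST i. x \<in> dilate c l i)"

lemma mem_layer: "0 < l \<Longrightarrow> x \<in> dilate c l (layer c l x)"
  unfolding layer_def using bounded_subset_dilate[of "{x}" l c] by (auto intro: LeastI_ex)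

lemma layer_le_iff: "0 < l \<Longrightarrow> layer c l x \<le> i \<longleftrightarrow> x \<in> dilate c l i"
  using mem_layer[of l x c] dilate_mono[of l "layer c l x" i c] unfolding layer_def
  by (auto intro: Least_le)

lemma measurable_layer [measurable]:
  assumes "0 < l"
  shows "layer c l \<in> lebesgue \<rightarrow>\<^sub>M count_space UNIV"
proof (subst measurable_count_space_eq2_countable, safe)
  fix i
  have "layer c l -` {i} = dilate c l i - (\<Union>j<i. dilate c l j)"
    by (auto simp flip: layer_le_iff[OF assms]) (metis le_neq_implies_less lessThan_iff order_refl)
  then show "layer c l -` {i} \<inter> space lebesgue \<in> sets lebesgue" by simp
qed auto

text \<open>The gap between \<open>dilate c l (k - 2)\<close> and the outside of
  \<open>dilate c l (k - 1)\<close> is \<open>2 ^ k * l / 8\<close>. A cube with shorter side cannot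
  bridge it and so lies in the layers \<open>k - 1\<close> and \<open>k\<close>; any other is
  comparable to the smallest dilate that contains it.\<close>

lemma dilate_cube_dichotomy:
  fixes c :: "real ^ 'n"
  assumes l: "0 < l" and R: "R \<in> cubes" and k: "R \<subseteq> dilate c l k" "\<And>i. R \<subseteq> dilate c l i \<Longrightarrow> k \<le> i"
  shows "measure lebesgue (dilate c l k) \<le> 8 ^ CARD('n) * measure lebesgue R \<or>
    (\<forall>x\<in>R. k \<le> Suc (layer c l x) \<and> layer c l x \<le> k)"
proof -
  obtain r t where rt: "R = cb r t" "0 < t" using R by (auto elim: cubesE)
  show ?thesis
  proof (cases "2 ^ k * l \<le> 8 * t")
    case True
    then have "(2 ^ k * l) ^ CARD('n) \<le> (8 * t) ^ CARD('n)" using l by (intro power_mono) auto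
    then show ?thesis using l rt by (simp add: measure_dilate measure_cb power_mult_distrib)
  next
    case False
    have "k \<le> Suc (layer c l x)" if x: "x \<in> R" for x
    proof (rule ccontr)
      assume "\<not> ?thesis"
      then have k2: "layer c l x \<le> k - 2" "2 \<le> k" by auto
      then have xk: "x \<in> dilate c l (k - 2)" using l by (simp add: layer_le_iff)
      have "\<not> R \<subseteq> dilate c l (k - 1)" using k(2)[of "k - 1"] k2 by auto
      then obtain y j where y: "y \<in> R" "2 ^ (k - 1) * l / 2 < \<bar>y $ j - (c $ j + l / 2)\<bar>"
        unfolding mem_dilate subset_iff by (auto simp: not_le)
      have "\<bar>x $ j - y $ j\<bar> \<le> t"
        using x y(1) unfolding rt mem_cb by (auto simp: abs_le_iff dest!: spec[of _ j])
      moreover have "\<bar>x $ j - (c $ j + l / 2)\<bar> \<le> 2 ^ (k - 2) * l / 2" using xk by (simp add: mem_dilate)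
      moreover have "(2 :: real) ^ k = 4 * 2 ^ (k - 2)" "(2 :: real) ^ (k - 1) = 2 * 2 ^ (k - 2)"
        using k2 power_add[of "2 :: real" 2 "k - 2"] power_add[of "2 :: real" 1 "k - 2"]
        by (simp_all add: Suc_diff_Suc numeral_2_eq_2)
      ultimately show False using y(2) False by (simp add: algebra_simps) argo
    qed
    then show ?thesis using k(1) l by (auto simp: layer_le_iff)
  qed
qed


subsection \<open>Cutoff weights\<close>

text \<open>Trades the witness \<open>s\<close> for the average \<open>y\<close>, again through
  \<open>1 \<le> y * t\<close>, so that a single quantity can be compared across concentric
  cubes.\<close>

lemma weight_class_average:
  fixes w :: "real ^ 'n \<Rightarrow> real"
  assumes w: "w \<in> weight_class a b K" and a: "0 < a" "a \<le> 1" and b: "0 \<le> b" and Q: "Q \<in> cubes"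
  obtains y t where "avg w Q = ennreal y" "0 < y" "0 < t" "y * t \<le> K"
    "mean_bound b (\<lambda>x. 1 / w x) Q t" "avg (\<lambda>x. w x powr (1 / a)) Q \<le> ennreal ((K * y) powr (1 / a))"
proof -
  note [measurable] = weight_classD(1)[OF w]
  note w0 = weight_classD(2)[OF w]
  obtain s t where st: "0 < s" "0 < t" "s * t \<le> K" "mean_bound a w Q s" "mean_bound b (\<lambda>x. 1 / w x) Q t"
    by (rule weight_classE[OF w Q])
  have ww: "weight w" by (rule weight_class_weight[OF w]) (use a b in auto)
  obtain y where y: "avg w Q = ennreal y" "0 < y" by (rule avg_weight[OF ww w0 Q])
  have "mean_bound 1 w Q s"
    using Q w0 st a by (intro mean_bound_mono_exponent[of Q w a s 1]) (auto simp: less_imp_le)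
  then have "y \<le> s" using st(1) w0 y by (simp add: mean_bound_def less_imp_le)
  then have "y * t \<le> s * t" using st by (intro mult_right_mono) auto
  with st have yt: "y * t \<le> K" by linarith
  have "1 \<le> y * t" using Q w0 st b y by (intro mean_bound_inverse[of Q w b t y]) auto
  then have "s * 1 \<le> s * (y * t)" using st by (intro mult_left_mono) auto
  also have "\<dots> \<le> K * y" using mult_right_mono[OF st(3), of y] y by (simp add: mult_ac)
  finally have "s powr (1 / a) \<le> (K * y) powr (1 / a)" using st a by (intro powr_mono2) auto
  then have "avg (\<lambda>x. w x powr (1 / a)) Q \<le> ennreal ((K * y) powr (1 / a))"
    using st(4) a by (auto simp: mean_bound_def intro: order_trans ennreal_leI)
  with y yt st show thesis by (intro that)
qed

definition cutoff :: "((real ^ 'n) set \<Rightarrow> real) \<Rightarrow> real \<Rightarrow> real ^ 'n \<Rightarrow> real \<Rightarrow> nat \<Rightarrow> real" where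
  "cutoff \<psi> \<theta> c l i = (\<psi> (dilate c l 0) / \<psi> (dilate c l i)) powr \<theta>"

text \<open>A cube within two adjacent layers sees a nearly constant cutoff, by
  \<open>doubling\<close>. Any other cube is comparable to a dilate: there the cutoff is smallest on
  the outermost layer, which settles the norm of the inverse, while \<open>decay\<close> turns the
  contributions of the inner layers to the norm of the weight into a geometric series. An abstract
  \<open>\<psi>\<close> serves both kinds of Morrey space.\<close>

lemma cutoff_weight_class:
  fixes w :: "real ^ 'n \<Rightarrow> real" and \<psi> :: "(real ^ 'n) set \<Rightarrow> real"
  assumes w: "w \<in> weight_class a b K" and a: "0 < a" "a \<le> 1" and b: "0 \<le> b"
    and \<psi>: "\<And>Q. Q \<in> cubes \<Longrightarrow> 0 < \<psi> Q"
    and mono: "\<And>c l i. 0 < l \<Longrightarrow> \<psi> (dilate c l i) \<le> \<psi> (dilate c l (Suc i))"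
    and doubling: "\<And>c l i. 0 < l \<Longrightarrow> \<psi> (dilate c l (Suc i)) \<le> D * \<psi> (dilate c l i)"
    and decay: "\<And>c l i k. 0 < l \<Longrightarrow> i \<le> k \<Longrightarrow>
      (\<psi> (dilate c l k) / \<psi> (dilate c l i)) powr \<theta> * enn2real (avg w (dilate c l i))
        * 2 powr - (real (k - i) * CARD('n) * a)
      \<le> C1 * 2 powr - (real (k - i) * \<epsilon>) * enn2real (avg w (dilate c l k))"
    and \<theta>: "0 \<le> \<theta>" and \<epsilon>: "0 < \<epsilon>" and C1: "0 < C1"
  obtains K' where "\<And>c l. 0 < l \<Longrightarrow> (\<lambda>x. w x * cutoff \<psi> \<theta> c l (layer c l x)) \<in> weight_class a b K'"
proof -
  note [measurable] = weight_classD(1)[OF w]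
  note w0 = weight_classD(2)[OF w]
  have K: "0 < K" using w by (rule weight_class_const_pos)
  \<comment> \<open>Sum of the geometric series over the layers; the decay
    \<open>2 powr - \<epsilon>\<close> is raised to \<open>1 / a\<close> because integrals of
    \<open>1 / a\<close>-th powers are summed.\<close>
  define G where "G = 1 / (1 - 2 powr - (\<epsilon> / a))"
  have q: "0 < 2 powr - (\<epsilon> / a)" "2 powr - (\<epsilon> / a) < (1 :: real)"
    using \<epsilon> a by (auto simp: powr_less_one)
  then have G: "0 < G" by (simp add: G_def)
  define N where "N = (8 :: real) ^ CARD('n)"
  have N: "1 \<le> N" by (simp add: N_def)
  \<comment> \<open>The first entry is for cubes within two adjacent layers, the second for cubes
    comparable to a dilate, where \<open>N\<close> pays for the passage to a subcube in both
    norms.\<close>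
  define K' where "K' = max (max 1 (D powr \<theta>) * K) (N powr a * (K * C1 * G powr a) * N powr b * K)"
  show thesis
  proof (rule that[of K'])
    fix c :: "real ^ 'n" and l :: real assume l: "0 < l"
    let ?D = "dilate c l" and ?\<alpha> = "cutoff \<psi> \<theta> c l" and ?i = "layer c l"
    have [measurable]: "layer c l \<in> lebesgue \<rightarrow>\<^sub>M count_space UNIV" using l by (rule measurable_layer)
    have \<psi>D: "0 < \<psi> (?D i)" for i using l by (intro \<psi>) simp
    have \<alpha>: "0 < ?\<alpha> i" for i using \<psi>D[of i] \<psi>D[of 0] by (simp add: cutoff_def)
    have \<psi>mono: "\<psi> (?D i) \<le> \<psi> (?D k)" if "i \<le> k" for i k
      using that mono[OF l] by (rule lift_Suc_mono_le[rotated])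
    have \<alpha>mono: "?\<alpha> k \<le> ?\<alpha> i" if "i \<le> k" for i k
      unfolding cutoff_def using \<psi>mono[OF that] \<psi>D \<theta>
      by (intro powr_mono2 divide_left_mono) (auto simp: less_imp_le)
    have \<alpha>ratio: "?\<alpha> i = ?\<alpha> k * (\<psi> (?D k) / \<psi> (?D i)) powr \<theta>" for i k
      unfolding cutoff_def using \<psi>D[of i] \<psi>D[of 0] \<psi>D[of k] by (simp add: powr_mult[symmetric])
    have \<alpha>Suc: "?\<alpha> i \<le> D powr \<theta> * ?\<alpha> (Suc i)" for i
    proof -
      have "(\<psi> (?D (Suc i)) / \<psi> (?D i)) powr \<theta> \<le> D powr \<theta>"
        using doubling[OF l, of c i] \<psi>D[of i] \<psi>D[of "Suc i"] \<theta> by (intro powr_mono2) (auto simp: divide_le_eq)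
      then show ?thesis using \<alpha>ratio[of i "Suc i"] \<alpha>[of "Suc i"] by (simp add: mult.commute)
    qed
    define v where "v x = w x * ?\<alpha> (?i x)" for x
    have [measurable]: "v \<in> borel_measurable lebesgue" unfolding v_def by measurable
    have v0: "0 < v x" for x using w0[of x] \<alpha> by (simp add: v_def)
    have "\<exists>s t. 0 < s \<and> 0 < t \<and> s * t \<le> K' \<and> mean_bound a v R s \<and> mean_bound b (\<lambda>x. 1 / v x) R t"
      if R: "R \<in> cubes" for R
    proof -
      have "bounded R" using R by (auto simp: cubes_def)
      then have ex: "\<exists>k. R \<subseteq> ?D k" using l by (rule bounded_subset_dilate)
      define k where "k = (LEAST k. R \<subseteq> ?D k)"
      have "R \<subseteq> ?D k" unfolding k_def by (rule LeastI_ex[OF ex])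
      moreover have "k \<le> i" if "R \<subseteq> ?D i" for i unfolding k_def using that by (rule Least_le)
      ultimately have k: "R \<subseteq> ?D k" "\<And>i. R \<subseteq> ?D i \<Longrightarrow> k \<le> i" by auto
      from dilate_cube_dichotomy[OF l R k] show ?thesis
      proof
        assume small: "\<forall>x\<in>R. k \<le> Suc (?i x) \<and> ?i x \<le> k"
        obtain s t where st: "0 < s" "0 < t" "s * t \<le> K" "mean_bound a w R s" "mean_bound b (\<lambda>x. 1 / w x) R t"
          by (rule weight_classE[OF w R])
        let ?M = "max 1 (D powr \<theta>) * ?\<alpha> k"
        have "?\<alpha> (?i x) \<le> ?M" if "x \<in> R" for x
        proof -
          have "?i x = k \<or> Suc (?i x) = k" using small that by force
          then show ?thesis
          proof
            assume "?i x = k"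
            then show ?thesis using \<alpha>[of k] by simp
          next
            assume "Suc (?i x) = k"
            then have "?\<alpha> (?i x) \<le> D powr \<theta> * ?\<alpha> k" using \<alpha>Suc[of "?i x"] by simp
            also have "\<dots> \<le> ?M" using \<alpha>[of k] by (intro mult_right_mono) auto
            finally show ?thesis .
          qed
        qed
        then have "mean_bound a v R (?M * s)"
          using R v0 w0 st a \<alpha>[of k]
          by (intro mean_bound_scale[of R w v]) (auto simp: v_def less_imp_le mult.commute mult_right_mono intro!: AE_I2)
        moreover have "?\<alpha> k \<le> ?\<alpha> (?i x)" if "x \<in> R" for x using small that by (intro \<alpha>mono) auto
        then have "mean_bound b (\<lambda>x. 1 / v x) R (1 / ?\<alpha> k * t)"
          using R v0 w0 st b \<alpha>
          by (intro mean_bound_scale[of R "\<lambda>x. 1 / w x"])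
            (auto simp: v_def less_imp_le intro!: AE_I2 divide_left_mono mult_pos_pos mult_left_mono)
        moreover have "?M * s * (1 / ?\<alpha> k * t) \<le> K'"
        proof -
          have "?M * s * (1 / ?\<alpha> k * t) = max 1 (D powr \<theta>) * (s * t)" using \<alpha>[of k] by simp
          also have "\<dots> \<le> max 1 (D powr \<theta>) * K" using st by (intro mult_left_mono) auto
          finally show ?thesis by (simp add: K'_def)
        qed
        ultimately show ?thesis using st \<alpha>[of k]
          by (intro exI[of _ "?M * s"] exI[of _ "1 / ?\<alpha> k * t"]) auto
      next
        assume big: "measure lebesgue (?D k) \<le> 8 ^ CARD('n) * measure lebesgue R"
        define y where "y i = enn2real (avg w (?D i))" for i
        have av: "\<exists>t. 0 < y i \<and> 0 < t \<and> y i * t \<le> K \<and> mean_bound b (\<lambda>x. 1 / w x) (?D i) t \<and>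
          avg (\<lambda>x. w x powr (1 / a)) (?D i) \<le> ennreal ((K * y i) powr (1 / a))" for i
        proof -
          obtain y' t where *: "avg w (?D i) = ennreal y'" "0 < y'" "0 < t" "y' * t \<le> K"
            "mean_bound b (\<lambda>x. 1 / w x) (?D i) t"
            "avg (\<lambda>x. w x powr (1 / a)) (?D i) \<le> ennreal ((K * y') powr (1 / a))"
            by (rule weight_class_average[OF w a b dilate_cubes[OF l]])
          then have "y i = y'" by (simp add: y_def)
          with * show ?thesis by auto
        qed
        have y0: "0 < y i" for i using av[of i] by auto
        have W: "wmeas (\<lambda>x. w x powr (1 / a)) (?D i) \<le> ennreal ((K * y i) powr (1 / a) * measure lebesgue (?D i))" for i
          using av[of i] l by (auto simp: avg_le_iff)
        obtain t where t: "0 < t" "y k * t \<le> K" "mean_bound b (\<lambda>x. 1 / w x) (?D k) t"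
          using av[of k] by auto
        let ?s = "K * C1 * ?\<alpha> k * y k * G powr a"
        have s0: "0 < ?s" using K C1 \<alpha>[of k] y0[of k] G by simp
        have "mean_bound a v (?D k) ?s"
        proof -
          let ?m = "measure lebesgue (?D k)"
          let ?q = "2 powr - (\<epsilon> / a)"
          have m: "0 < ?m" using l by (simp add: cubes_measure_pos)
          \<comment> \<open>This is \<open>decay\<close>, multiplied by
            \<open>K * ?\<alpha> k\<close> and raised to the power \<open>1 / a\<close>;
            \<open>?x\<close> is the ratio of the measures of the two dilates.\<close>
          have term_le: "?\<alpha> i powr (1 / a) * ((K * y i) powr (1 / a) * measure lebesgue (?D i))
              \<le> (K * C1 * ?\<alpha> k * y k) powr (1 / a) * ?m * ?q ^ (k - i)" if ik: "i \<le> k" for i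
          proof -
            let ?x = "2 powr - (real (k - i) * CARD('n))"
            have mi: "measure lebesgue (?D i) = ?x * ?m"
              using measure_dilate_diff[OF l ik, of c] by (simp add: powr_minus field_simps)
            have "(\<psi> (?D k) / \<psi> (?D i)) powr \<theta> * y i * ?x powr a \<le> C1 * 2 powr - (real (k - i) * \<epsilon>) * y k"
              using decay[OF l ik, of c] by (simp add: y_def powr_powr)
            from mult_left_mono[OF this, of "K * ?\<alpha> k"]
            have "?\<alpha> i * (K * y i) * ?x powr a \<le> K * C1 * ?\<alpha> k * y k * 2 powr - (real (k - i) * \<epsilon>)"
              unfolding \<alpha>ratio[of i k] using K \<alpha>[of k] by (simp add: mult_ac)
            then have "(?\<alpha> i * (K * y i) * ?x powr a) powr (1 / a) \<le> (K * C1 * ?\<alpha> k * y k * 2 powr - (real (k - i) * \<epsilon>)) powr (1 / a)"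
              using a K \<alpha>[of i] y0[of i] by (intro powr_mono2) auto
            moreover have "(?\<alpha> i * (K * y i) * ?x powr a) powr (1 / a) = ?\<alpha> i powr (1 / a) * (K * y i) powr (1 / a) * ?x"
              using a K \<alpha>[of i] y0[of i] by (simp add: powr_mult powr_powr)
            moreover have "(2 powr - (real (k - i) * \<epsilon>)) powr (1 / a) = ?q ^ (k - i)"
              by (simp add: powr_powr powr_realpow[symmetric] mult.commute)
            moreover have "(K * C1 * ?\<alpha> k * y k * 2 powr - (real (k - i) * \<epsilon>)) powr (1 / a)
                = (K * C1 * ?\<alpha> k * y k) powr (1 / a) * (2 powr - (real (k - i) * \<epsilon>)) powr (1 / a)"
              using K C1 \<alpha>[of k] y0[of k] by (subst powr_mult) auto
            ultimately have "?\<alpha> i powr (1 / a) * (K * y i) powr (1 / a) * ?x \<le> (K * C1 * ?\<alpha> k * y k) powr (1 / a) * ?q ^ (k - i)"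
              by (simp only:)
            from mult_right_mono[OF this, of ?m] show ?thesis using m by (simp add: mi mult_ac)
          qed
          \<comment> \<open>Each layer is enlarged to the full dilate, over which the integral of
            the power of \<open>w\<close> is known.\<close>
          have "wmeas (\<lambda>x. v x powr (1 / a)) (?D k)
              \<le> (\<integral>\<^sup>+x. (\<Sum>i\<le>k. ennreal (?\<alpha> i powr (1 / a)) * (ennreal (w x powr (1 / a)) * indicator (?D i) x)) \<partial>lebesgue)"
            unfolding wmeas_def
          proof (rule nn_integral_mono)
            fix x
            show "ennreal (v x powr (1 / a)) * indicator (?D k) x
              \<le> (\<Sum>i\<le>k. ennreal (?\<alpha> i powr (1 / a)) * (ennreal (w x powr (1 / a)) * indicator (?D i) x))"
            proof (cases "x \<in> ?D k")
              case True
              then have ik: "?i x \<in> {..k}" using l by (simp add: layer_le_iff)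
              have "ennreal (v x powr (1 / a)) * indicator (?D k) x
                  = ennreal (?\<alpha> (?i x) powr (1 / a)) * (ennreal (w x powr (1 / a)) * indicator (?D (?i x)) x)"
                using True mem_layer[OF l, of x c] w0[of x] \<alpha>[of "?i x"]
                by (simp add: v_def powr_mult mult.commute flip: ennreal_mult)
              also have "\<dots> \<le> (\<Sum>i\<le>k. ennreal (?\<alpha> i powr (1 / a)) * (ennreal (w x powr (1 / a)) * indicator (?D i) x))"
                by (rule member_le_sum[OF ik]) auto
              finally show ?thesis .
            qed simp
          qed
          also have "\<dots> = (\<Sum>i\<le>k. ennreal (?\<alpha> i powr (1 / a)) * wmeas (\<lambda>x. w x powr (1 / a)) (?D i))"
            by (simp add: nn_integral_sum nn_integral_cmult wmeas_def)
          also have "\<dots> \<le> (\<Sum>i\<le>k. ennreal ((K * C1 * ?\<alpha> k * y k) powr (1 / a) * ?m * ?q ^ (k - i)))"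
          proof (rule sum_mono)
            fix i assume i: "i \<in> {..k}"
            have "ennreal (?\<alpha> i powr (1 / a)) * wmeas (\<lambda>x. w x powr (1 / a)) (?D i)
                \<le> ennreal (?\<alpha> i powr (1 / a)) * ennreal ((K * y i) powr (1 / a) * measure lebesgue (?D i))"
              by (intro mult_left_mono W) simp
            also have "\<dots> = ennreal (?\<alpha> i powr (1 / a) * ((K * y i) powr (1 / a) * measure lebesgue (?D i)))"
              by (simp add: ennreal_mult)
            also have "\<dots> \<le> ennreal ((K * C1 * ?\<alpha> k * y k) powr (1 / a) * ?m * ?q ^ (k - i))"
              using i by (intro ennreal_leI term_le) auto
            finally show "ennreal (?\<alpha> i powr (1 / a)) * wmeas (\<lambda>x. w x powr (1 / a)) (?D i)
              \<le> ennreal ((K * C1 * ?\<alpha> k * y k) powr (1 / a) * ?m * ?q ^ (k - i))" .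
          qed
          also have "\<dots> = ennreal ((K * C1 * ?\<alpha> k * y k) powr (1 / a) * ?m * (\<Sum>i\<le>k. ?q ^ (k - i)))"
            by (subst sum_ennreal) (auto simp: sum_distrib_left)
          also have "\<dots> \<le> ennreal ((K * C1 * ?\<alpha> k * y k) powr (1 / a) * ?m * G)"
          proof (intro ennreal_leI mult_left_mono)
            have "(\<Sum>i\<le>k. ?q ^ (k - i)) = (\<Sum>i\<le>k. ?q ^ i)"
              by (rule sum.reindex_bij_witness[of _ "\<lambda>i. k - i" "\<lambda>i. k - i"]) auto
            also have "\<dots> \<le> G" using q unfolding G_def
              by (subst sum_gp0) (auto simp: divide_right_mono)
            finally show "(\<Sum>i\<le>k. ?q ^ (k - i)) \<le> G" .
          qed auto
          also have "(K * C1 * ?\<alpha> k * y k) powr (1 / a) * ?m * G = ?s powr (1 / a) * ?m"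
            using a K C1 \<alpha>[of k] y0[of k] G by (simp add: powr_mult powr_powr)
          finally show ?thesis using a l by (simp add: mean_bound_def avg_le_iff)
        qed
        then have 1: "mean_bound a v R (N powr a * ?s)"
          using R k(1) big l a s0 N
          by (intro mean_bound_subcube[of "?D k" R]) (auto simp: N_def less_imp_le)
        have "?\<alpha> k \<le> ?\<alpha> (?i x)" if "x \<in> ?D k" for x using that l by (intro \<alpha>mono) (simp add: layer_le_iff)
        then have "mean_bound b (\<lambda>x. 1 / v x) (?D k) (1 / ?\<alpha> k * t)"
          using l v0 w0 t b \<alpha>
          by (intro mean_bound_scale[of "?D k" "\<lambda>x. 1 / w x"])
            (auto simp: v_def less_imp_le intro!: AE_I2 divide_left_mono mult_pos_pos mult_left_mono)
        then have 2: "mean_bound b (\<lambda>x. 1 / v x) R (N powr b * (1 / ?\<alpha> k * t))"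
          using R k(1) big l b t \<alpha>[of k] N
          by (intro mean_bound_subcube[of "?D k" R]) (auto simp: N_def less_imp_le)
        have "N powr a * ?s * (N powr b * (1 / ?\<alpha> k * t)) = N powr a * (K * C1 * G powr a) * N powr b * (y k * t)"
          using \<alpha>[of k] by (simp add: mult_ac)
        also have "\<dots> \<le> N powr a * (K * C1 * G powr a) * N powr b * K"
          using t K C1 by (intro mult_left_mono) auto
        also have "\<dots> \<le> K'" by (simp add: K'_def)
        finally show ?thesis using 1 2 s0 t N \<alpha>[of k]
          by (intro exI[of _ "N powr a * ?s"] exI[of _ "N powr b * (1 / ?\<alpha> k * t)"]) auto
      qed
    qed
    then show "(\<lambda>x. w x * ?\<alpha> (?i x)) \<in> weight_class a b K'"
      using v0 \<open>v \<in> borel_measurable lebesgue\<close> unfolding v_def[abs_def] weight_class_def by auto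
  qed
qed

subsection \<open>Morrey estimates\<close>

text \<open>Here \<open>\<eta>\<close> stands for 1 + r p / n. On the \<open>i\<close>-th dilate the
  Morrey bound of \<open>f\<close> contributes the power \<open>\<eta>\<close> of
  \<open>\<psi>\<close> and the cutoff the power \<open>- \<theta>\<close>; what remains is the
  power \<open>\<theta> - \<eta>\<close> of a ratio that decays geometrically by
  \<open>growth\<close>.\<close>

lemma cutoff_morrey_bound:
  fixes w :: "real ^ 'n \<Rightarrow> real" and \<psi> :: "(real ^ 'n) set \<Rightarrow> real"
  assumes F: "\<And>f g. (f, g) \<in> F \<Longrightarrow>
        f \<in> borel_measurable lebesgue \<and> g \<in> borel_measurable lebesgue \<and>
        (\<forall>x. 0 \<le> f x) \<and> (\<forall>x. 0 \<le> g x)"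
    and WI: "weighted_ineq F p a b"
    and w: "w \<in> weight_class a b K" and a: "0 < a" "a \<le> 1" and b: "0 \<le> b"
    and \<psi>: "\<And>Q. Q \<in> cubes \<Longrightarrow> 0 < \<psi> Q"
    and mono: "\<And>c l i. 0 < l \<Longrightarrow> \<psi> (dilate c l i) \<le> \<psi> (dilate c l (Suc i))"
    and doubling: "\<And>c l i. 0 < l \<Longrightarrow> \<psi> (dilate c l (Suc i)) \<le> D * \<psi> (dilate c l i)"
    and decay: "\<And>c l i k. 0 < l \<Longrightarrow> i \<le> k \<Longrightarrow>
      (\<psi> (dilate c l k) / \<psi> (dilate c l i)) powr \<theta> * enn2real (avg w (dilate c l i))
        * 2 powr - (real (k - i) * CARD('n) * a)
      \<le> C1 * 2 powr - (real (k - i) * \<epsilon>) * enn2real (avg w (dilate c l k))"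
    and \<epsilon>: "0 < \<epsilon>" and C1: "0 < C1"
    and growth: "\<And>c l i. 0 < l \<Longrightarrow> \<psi> (dilate c l 0) / \<psi> (dilate c l i) \<le> C2 * 2 powr - (real i * \<kappa>)"
    and \<kappa>: "0 < \<kappa>" and C2: "0 < C2" and \<eta>: "0 \<le> \<eta>" "\<eta> < \<theta>"
  obtains C where "0 < C" "\<And>f g N Q. (f, g) \<in> F \<Longrightarrow> 0 \<le> N \<Longrightarrow>
    (\<And>Q. Q \<in> cubes \<Longrightarrow> (\<integral>\<^sup>+x\<in>Q. ennreal (f x powr p * w x) \<partial>lebesgue) \<le> ennreal (N * \<psi> Q powr \<eta>)) \<Longrightarrow>
    Q \<in> cubes \<Longrightarrow> (\<integral>\<^sup>+x\<in>Q. ennreal (g x powr p * w x) \<partial>lebesgue) \<le> ennreal (C * N * \<psi> Q powr \<eta>)"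
proof -
  note [measurable] = weight_classD(1)[OF w]
  note w0 = weight_classD(2)[OF w]
  have \<theta>: "0 \<le> \<theta>" using \<eta> by simp
  obtain K' where K': "\<And>c l. 0 < l \<Longrightarrow> (\<lambda>x. w x * cutoff \<psi> \<theta> c l (layer c l x)) \<in> weight_class a b K'"
    using cutoff_weight_class[OF w a b \<psi> mono doubling decay \<theta> \<epsilon> C1] by blast
  obtain C' where C': "0 < C'" and ineq: "\<And>v f g. v \<in> weight_class a b K' \<Longrightarrow> (f, g) \<in> F \<Longrightarrow>
     (\<integral>\<^sup>+x. ennreal (g x powr p * v x) \<partial>lebesgue) \<le> ennreal C' * (\<integral>\<^sup>+x. ennreal (f x powr p * v x) \<partial>lebesgue)"
    using WI unfolding weighted_ineq_def by meson
  define q where "q = (2 :: real) powr - (\<kappa> * (\<theta> - \<eta>))"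
  have q: "0 < q" "q < 1" using \<kappa> \<eta> by (auto simp: q_def powr_less_one)
  define G where "G = C2 powr (\<theta> - \<eta>) * (1 / (1 - q))"
  have G: "0 < G" using q C2 by (simp add: G_def)
  show thesis
  proof (rule that[of "C' * G"])
    show "0 < C' * G" using C' G by simp
    fix f g :: "real ^ 'n \<Rightarrow> real" and N and Q :: "(real ^ 'n) set"
    assume fg: "(f, g) \<in> F" and N: "0 \<le> N" and Q: "Q \<in> cubes"
      and fN: "\<And>Q. Q \<in> cubes \<Longrightarrow> (\<integral>\<^sup>+x\<in>Q. ennreal (f x powr p * w x) \<partial>lebesgue) \<le> ennreal (N * \<psi> Q powr \<eta>)"
    have [measurable]: "f \<in> borel_measurable lebesgue" "g \<in> borel_measurable lebesgue" using F[OF fg] by auto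
    obtain c l where Ql: "Q = cb c l" and l: "0 < l" using Q by (auto elim: cubesE)
    let ?D = "dilate c l" and ?\<alpha> = "cutoff \<psi> \<theta> c l" and ?i = "layer c l"
    have Q0: "Q = ?D 0" by (simp add: Ql dilate_0)
    have \<psi>D: "0 < \<psi> (?D i)" for i using l by (intro \<psi>) simp
    have \<alpha>0: "?\<alpha> 0 = 1" using \<psi>D[of 0] by (simp add: cutoff_def)
    have "(\<integral>\<^sup>+x\<in>Q. ennreal (g x powr p * w x) \<partial>lebesgue) \<le> (\<integral>\<^sup>+x. ennreal (g x powr p * (w x * ?\<alpha> (?i x))) \<partial>lebesgue)"
    proof (rule nn_integral_mono)
      fix x
      have "?i x = 0" if "x \<in> Q" using that layer_le_iff[OF l, of c x 0] by (simp add: Q0)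
      then show "ennreal (g x powr p * w x) * indicator Q x \<le> ennreal (g x powr p * (w x * ?\<alpha> (?i x)))"
        using \<alpha>0 by (cases "x \<in> Q") auto
    qed
    also have "\<dots> \<le> ennreal C' * (\<integral>\<^sup>+x. ennreal (f x powr p * (w x * ?\<alpha> (?i x))) \<partial>lebesgue)"
      by (rule ineq[OF K'[OF l] fg])
    also have "(\<integral>\<^sup>+x. ennreal (f x powr p * (w x * ?\<alpha> (?i x))) \<partial>lebesgue) \<le> ennreal (N * \<psi> Q powr \<eta> * G)"
    proof -
      have "(\<integral>\<^sup>+x. ennreal (f x powr p * (w x * ?\<alpha> (?i x))) \<partial>lebesgue)
          \<le> (\<integral>\<^sup>+x. (\<Sum>i. ennreal (?\<alpha> i) * (ennreal (f x powr p * w x) * indicator (?D i) x)) \<partial>lebesgue)"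
      proof (rule nn_integral_mono)
        fix x
        have "ennreal (f x powr p * (w x * ?\<alpha> (?i x))) = ennreal (?\<alpha> (?i x)) * (ennreal (f x powr p * w x) * indicator (?D (?i x)) x)"
          using mem_layer[OF l, of x c] w0[of x] by (simp add: cutoff_def mult_ac less_imp_le flip: ennreal_mult)
        also have "\<dots> \<le> (\<Sum>i. ennreal (?\<alpha> i) * (ennreal (f x powr p * w x) * indicator (?D i) x))"
          using sum_le_suminf[of "\<lambda>i. ennreal (?\<alpha> i) * (ennreal (f x powr p * w x) * indicator (?D i) x)" "{?i x}"]
          by (simp add: summableI)
        finally show "ennreal (f x powr p * (w x * ?\<alpha> (?i x))) \<le> (\<Sum>i. ennreal (?\<alpha> i) * (ennreal (f x powr p * w x) * indicator (?D i) x))" .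
      qed
      also have "\<dots> = (\<Sum>i. ennreal (?\<alpha> i) * (\<integral>\<^sup>+x\<in>?D i. ennreal (f x powr p * w x) \<partial>lebesgue))"
        by (simp add: nn_integral_suminf nn_integral_cmult)
      also have "\<dots> \<le> (\<Sum>i. ennreal (N * \<psi> Q powr \<eta> * C2 powr (\<theta> - \<eta>) * q ^ i))"
      proof (rule suminf_le)
        fix i
        have "ennreal (?\<alpha> i) * (\<integral>\<^sup>+x\<in>?D i. ennreal (f x powr p * w x) \<partial>lebesgue) \<le> ennreal (?\<alpha> i) * ennreal (N * \<psi> (?D i) powr \<eta>)"
          using l by (intro mult_left_mono fN) auto
        also have "\<dots> = ennreal (?\<alpha> i * (N * \<psi> (?D i) powr \<eta>))" using N by (simp add: cutoff_def ennreal_mult)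
        also have "\<dots> \<le> ennreal (N * \<psi> Q powr \<eta> * C2 powr (\<theta> - \<eta>) * q ^ i)"
        proof (rule ennreal_leI)
          have "?\<alpha> i * \<psi> (?D i) powr \<eta> = \<psi> Q powr \<eta> * (\<psi> (?D 0) / \<psi> (?D i)) powr (\<theta> - \<eta>)"
            using \<psi>D[of 0] \<psi>D[of i] by (simp add: cutoff_def Q0 powr_divide powr_diff)
          also have "\<dots> \<le> \<psi> Q powr \<eta> * (C2 * 2 powr - (real i * \<kappa>)) powr (\<theta> - \<eta>)"
            using growth[OF l, of c i] \<psi>D[of 0] \<psi>D[of i] \<eta> by (intro mult_left_mono powr_mono2) auto
          also have "(C2 * 2 powr - (real i * \<kappa>)) powr (\<theta> - \<eta>) = C2 powr (\<theta> - \<eta>) * q ^ i"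
            using C2 by (simp add: q_def powr_mult powr_powr powr_realpow[symmetric] algebra_simps)
          finally have "N * (?\<alpha> i * \<psi> (?D i) powr \<eta>) \<le> N * (\<psi> Q powr \<eta> * (C2 powr (\<theta> - \<eta>) * q ^ i))"
            using N by (rule mult_left_mono)
          then show "?\<alpha> i * (N * \<psi> (?D i) powr \<eta>) \<le> N * \<psi> Q powr \<eta> * C2 powr (\<theta> - \<eta>) * q ^ i"
            by (simp only: mult_ac)
        qed
        finally show "ennreal (?\<alpha> i) * (\<integral>\<^sup>+x\<in>?D i. ennreal (f x powr p * w x) \<partial>lebesgue)
          \<le> ennreal (N * \<psi> Q powr \<eta> * C2 powr (\<theta> - \<eta>) * q ^ i)" .
      qed (auto intro: summableI)
      also have "\<dots> = ennreal (N * \<psi> Q powr \<eta> * C2 powr (\<theta> - \<eta>) * (1 / (1 - q)))"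
        using N q by (intro suminf_ennreal_eq sums_mult geometric_sums) auto
      finally show ?thesis by (simp only: G_def mult.assoc)
    qed
    then have "ennreal C' * (\<integral>\<^sup>+x. ennreal (f x powr p * (w x * ?\<alpha> (?i x))) \<partial>lebesgue) \<le> ennreal C' * ennreal (N * \<psi> Q powr \<eta> * G)"
      by (rule mult_left_mono) simp
    finally have "(\<integral>\<^sup>+x\<in>Q. ennreal (g x powr p * w x) \<partial>lebesgue) \<le> ennreal C' * ennreal (N * \<psi> Q powr \<eta> * G)" .
    also have "\<dots> = ennreal (C' * G * N * \<psi> Q powr \<eta>)"
      using C' N G by (subst ennreal_mult[symmetric]) (auto simp: mult_ac)
    finally show "(\<integral>\<^sup>+x\<in>Q. ennreal (g x powr p * w x) \<partial>lebesgue) \<le> ennreal (C' * G * N * \<psi> Q powr \<eta>)" .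
  qed
qed

text \<open>Reverse doubling of \<open>w powr (1 / a)\<close> improves the decay that the reverse Hoelder inequality alone
  gives for averages over concentric cubes; the gain \<open>\<delta>\<close> is what reaches the endpoint exponents.\<close>

lemma average_dilate_growth:
  fixes w :: "real ^ 'n \<Rightarrow> real"
  assumes w: "w \<in> weight_class a b K" and a: "0 < a" "a \<le> 1" and b: "0 \<le> b"
  obtains \<delta> where "0 < \<delta>" "\<And>c l i k. 0 < l \<Longrightarrow> i \<le> k \<Longrightarrow> enn2real (avg w (dilate c l i))
    \<le> K * 2 powr (real (k - i) * (real CARD('n) - \<delta>) * a) * enn2real (avg w (dilate c l k))"
proof -
  note [measurable] = weight_classD(1)[OF w]
  note w0 = weight_classD(2)[OF w]
  have K: "0 < K" using w by (rule weight_class_const_pos)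
  \<comment> \<open>The reverse doubling below uses \<open>weight_class_subset\<close>, which wants
    a positive second parameter.\<close>
  have w': "w \<in> weight_class a (b + 1) K" by (rule weight_class_mono[OF w]) (use a b in auto)
  let ?W = "\<lambda>x. w x powr (1 / a)"
  let ?e = "1 - (1 / 2) ^ CARD('n) :: real"
  have "(1 / 2 :: real) ^ CARD('n) \<le> 1 / 2"
    using power_decreasing[of 1 "CARD('n)" "1 / 2 :: real"] by (simp add: Suc_le_eq)
  then have e: "0 < ?e" by simp
  \<comment> \<open>Bounds the mass of a dilate by that of the shell left after removing the
    previous dilate. The maximum with 2 keeps \<open>\<gamma>\<close> strictly between 0 and
    1.\<close>
  define M where "M = max 2 (K powr (1 / a) * (1 / ?e) powr (1 + (b + 1) / a))"
  have M: "2 \<le> M" by (simp add: M_def)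
  define \<gamma> where "\<gamma> = 1 - 1 / M"
  have \<gamma>: "0 < \<gamma>" "\<gamma> < 1" using M by (auto simp: \<gamma>_def field_simps)
  define \<delta> where "\<delta> = - log 2 \<gamma>"
  have \<delta>: "0 < \<delta>" "2 powr - \<delta> = \<gamma>" using \<gamma> by (auto simp: \<delta>_def)
  show thesis
  proof (rule that[OF \<delta>(1)])
    fix c :: "real ^ 'n" and l :: real and i k :: nat assume l: "0 < l" and ik: "i \<le> k"
    let ?D = "dilate c l"
    let ?m = "\<lambda>i. measure lebesgue (?D i)"
    have m: "0 < ?m i" for i using l by (simp add: cubes_measure_pos)
    define R where "R i = enn2real (wmeas ?W (?D i))" for i
    have R: "wmeas ?W (?D i) = ennreal (R i)" "0 < R i" for i
      using wmeas_class_finite[OF w a(1) dilate_cubes[OF l, of c i]] by (auto simp: R_def enn2real_positive_iff)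
    have rd: "R i \<le> \<gamma> * R (Suc i)" for i
    proof -
      let ?E = "?D (Suc i) - ?D i"
      have sub: "?D i \<subseteq> ?D (Suc i)" using l by (intro dilate_mono) auto
      have "?D i \<in> lmeasurable" "?D (Suc i) \<in> lmeasurable" by (simp_all add: dilate_def cb_def)
      then have "measure lebesgue ?E = ?m (Suc i) - ?m i" using sub by (intro measurable_measure_Diff) auto
      also have "?m i = (1 / 2) ^ CARD('n) * ?m (Suc i)"
        using l by (simp add: measure_dilate power_mult_distrib[symmetric])
      finally have mE: "measure lebesgue ?E = ?e * ?m (Suc i)" by (simp add: algebra_simps)
      have "wmeas ?W (?D (Suc i)) \<le> ennreal (K powr (1 / a) * (?m (Suc i) / measure lebesgue ?E) powr (1 + (b + 1) / a)) * wmeas ?W ?E"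
        using w' a b l e m[of "Suc i"] by (intro weight_class_subset) (auto simp: mE)
      also have "?m (Suc i) / measure lebesgue ?E = 1 / ?e" using m[of "Suc i"] e by (simp add: mE)
      also have "ennreal (K powr (1 / a) * (1 / ?e) powr (1 + (b + 1) / a)) * wmeas ?W ?E \<le> ennreal M * wmeas ?W ?E"
        by (intro mult_right_mono ennreal_leI) (auto simp: M_def)
      also have "wmeas ?W ?E = ennreal (R (Suc i) - R i)"
      proof -
        have "wmeas ?W ?E + wmeas ?W (?D i) = wmeas ?W (?D (Suc i))"
          unfolding wmeas_def using sub
          by (subst nn_integral_add[symmetric]) (auto intro!: nn_integral_cong simp: indicator_def)
        then have "wmeas ?W ?E + ennreal (R i) = ennreal (R (Suc i))" by (simp add: R(1))
        then show ?thesis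
          using R(2)[of i] by (metis ennreal_add_diff_cancel_right ennreal_minus ennreal_neq_top less_imp_le)
      qed
      also have "ennreal M * ennreal (R (Suc i) - R i) = ennreal (M * (R (Suc i) - R i))"
        using M by (simp add: ennreal_mult')
      finally have "R (Suc i) \<le> M * (R (Suc i) - R i)"
        unfolding R(1) using R(2)[of "Suc i"] by (meson ennreal_le_iff2 not_le)
      then have "M * R i \<le> (M - 1) * R (Suc i)" by (simp add: algebra_simps)
      then show ?thesis using M by (simp add: \<gamma>_def field_simps)
    qed
    have chain: "R i \<le> \<gamma> ^ (k - i) * R k"
      using ik
    proof (induction k rule: dec_induct)
      case (step k)
      have "R i \<le> \<gamma> ^ (k - i) * (\<gamma> * R (Suc k))"
        using \<gamma> by (intro order_trans[OF step.IH mult_left_mono[OF rd]]) simp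
      also have "\<dots> = \<gamma> ^ (Suc k - i) * R (Suc k)" using step.hyps by (simp add: Suc_diff_le)
      finally show ?case .
    qed simp
    obtain y t where y: "avg w (?D i) = ennreal y" "0 < y"
      by (rule weight_class_average[OF w a b dilate_cubes[OF l]])
    obtain z t where z: "avg w (?D k) = ennreal z" "0 < z" "avg ?W (?D k) \<le> ennreal ((K * z) powr (1 / a))"
      by (rule weight_class_average[OF w a b dilate_cubes[OF l]])
    \<comment> \<open>The normalised L^(1/a) norm of \<open>w\<close> on the inner dilate. It
      dominates the plain average, and it is the quantity on which the chain of reverse doubling
      steps acts.\<close>
    let ?s = "(R i / ?m i) powr a"
    have "mean_bound a w (?D i) ?s"
      using a l R(2)[of i] m[of i] by (simp add: mean_bound_def avg_le_iff R(1) powr_powr)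
    then have "mean_bound 1 w (?D i) ?s"
      using w0 a l R(2)[of i] m[of i]
      by (intro mean_bound_mono_exponent[of "?D i" w a ?s 1]) (auto simp: less_imp_le)
    then have "y \<le> ?s" using w0 y by (simp add: mean_bound_def less_imp_le)
    also have "\<dots> \<le> (2 powr (real (k - i) * (real CARD('n) - \<delta>)) * (K * z) powr (1 / a)) powr a"
    proof (intro powr_mono2)
      have Rk: "R k \<le> (K * z) powr (1 / a) * ?m k"
        using z(3) l by (simp add: avg_le_iff R(1))
      have "R i \<le> \<gamma> ^ (k - i) * ((K * z) powr (1 / a) * ?m k)"
        using \<gamma> by (intro order_trans[OF chain mult_left_mono[OF Rk]]) simp
      also have "\<gamma> ^ (k - i) = 2 powr - (real (k - i) * \<delta>)"
        by (simp add: \<delta>(2)[symmetric] powr_realpow[symmetric] powr_powr mult.commute)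
      also have "?m k = 2 powr (real (k - i) * CARD('n)) * ?m i" using l ik by (rule measure_dilate_diff)
      finally have "R i / ?m i \<le> 2 powr - (real (k - i) * \<delta>) * 2 powr (real (k - i) * CARD('n)) * (K * z) powr (1 / a)"
        using m[of i] by (simp add: divide_le_eq mult_ac)
      also have "2 powr - (real (k - i) * \<delta>) * 2 powr (real (k - i) * CARD('n)) = (2 :: real) powr (real (k - i) * (real CARD('n) - \<delta>))"
        by (simp add: powr_add[symmetric] algebra_simps)
      finally show "R i / ?m i \<le> 2 powr (real (k - i) * (real CARD('n) - \<delta>)) * (K * z) powr (1 / a)" .
    qed (use a R(2)[of i] m[of i] in auto)
    also have "\<dots> = K * 2 powr (real (k - i) * (real CARD('n) - \<delta>) * a) * z"
      using a K z by (simp add: powr_mult powr_powr mult_ac)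
    finally show "enn2real (avg w (?D i)) \<le> K * 2 powr (real (k - i) * (real CARD('n) - \<delta>) * a) * enn2real (avg w (?D k))"
      using y z by simp
  qed
qed


text \<open>The weight has reverse Hoelder exponent \<open>1 / s\<close>, while the class of the
  global inequality asks only for \<open>1 / a\<close>; the surplus \<open>a - s\<close> is what the
  cutoff may spend. In terms of Lebesgue measure the decay exponent per dilation step is n \<theta>
  + (n - \<delta>) s - n a.\<close>

lemma morrey_lambda_bound:
  fixes w :: "real ^ 'n \<Rightarrow> real"
  assumes F: "\<And>f g. (f, g) \<in> F \<Longrightarrow>
        f \<in> borel_measurable lebesgue \<and> g \<in> borel_measurable lebesgue \<and>
        (\<forall>x. 0 \<le> f x) \<and> (\<forall>x. 0 \<le> g x)"
    and WI: "weighted_ineq F p a b"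
    and w: "w \<in> weight_class s b K" and s: "0 < s" "s \<le> a" and a: "a \<le> 1" and b: "0 \<le> b"
    and \<eta>: "0 \<le> \<eta>" "\<eta> \<le> a - s"
  obtains C where "0 < C" "\<And>f g N Q. (f, g) \<in> F \<Longrightarrow> 0 \<le> N \<Longrightarrow>
    (\<And>Q. Q \<in> cubes \<Longrightarrow> (\<integral>\<^sup>+x\<in>Q. ennreal (f x powr p * w x) \<partial>lebesgue) \<le> ennreal (N * measure lebesgue Q powr \<eta>)) \<Longrightarrow>
    Q \<in> cubes \<Longrightarrow> (\<integral>\<^sup>+x\<in>Q. ennreal (g x powr p * w x) \<partial>lebesgue) \<le> ennreal (C * N * measure lebesgue Q powr \<eta>)"
proof -
  have K: "0 < K" using w by (rule weight_class_const_pos)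
  have a0: "0 < a" and s1: "s \<le> 1" using s a by auto
  have wa: "w \<in> weight_class a b K" by (rule weight_class_mono[OF w]) (use s b in auto)
  let ?n = "real CARD('n)"
  have n: "0 < ?n" by simp
  obtain \<delta> where \<delta>: "0 < \<delta>" and growth: "\<And>c l i k. 0 < l \<Longrightarrow> i \<le> k \<Longrightarrow> enn2real (avg w (dilate c l i))
    \<le> K * 2 powr (real (k - i) * (?n - \<delta>) * s) * enn2real (avg w (dilate c l k))"
    using average_dilate_growth[OF w s(1) s1 b] by blast
  \<comment> \<open>Half of the gain \<open>\<delta> * s\<close> pushes \<open>\<theta>\<close>
    beyond \<open>a - s\<close>, so that \<open>\<eta> = a - s\<close> is admissible; the other half
    remains as the decay \<open>\<epsilon>\<close>.\<close>
  define \<theta> where "\<theta> = a - s + \<delta> * s / (2 * ?n)"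
  define \<epsilon> where "\<epsilon> = \<delta> * s / 2"
  have \<epsilon>: "0 < \<epsilon>" using \<delta> s by (simp add: \<epsilon>_def)
  have "0 < \<delta> * s / (2 * ?n)" using \<delta> s by simp
  then have \<theta>: "\<eta> < \<theta>" using \<eta> unfolding \<theta>_def by linarith
  show thesis
  proof (rule cutoff_morrey_bound[where \<psi> = "measure lebesgue" and D = "2 powr ?n" and \<theta> = \<theta> and \<epsilon> = \<epsilon>
      and ?C1.0 = K and ?C2.0 = 1 and \<kappa> = ?n, OF F WI wa a0 a b])
    fix c :: "real ^ 'n" and l :: real and i :: nat assume l: "0 < l"
    have Suc: "measure lebesgue (dilate c l (Suc i)) = 2 powr ?n * measure lebesgue (dilate c l i)"
      using measure_dilate_diff[OF l, of i "Suc i" c] by simp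
    then show "measure lebesgue (dilate c l (Suc i)) \<le> 2 powr ?n * measure lebesgue (dilate c l i)" by simp
    have "(1 :: real) \<le> 2 powr ?n" by (simp add: ge_one_powr_ge_zero)
    then show "measure lebesgue (dilate c l i) \<le> measure lebesgue (dilate c l (Suc i))"
      unfolding Suc using mult_right_mono[of 1 "2 powr ?n" "measure lebesgue (dilate c l i)"] by simp
    have m: "0 < measure lebesgue (dilate c l j)" for j using l by (simp add: cubes_measure_pos)
    show "measure lebesgue (dilate c l 0) / measure lebesgue (dilate c l i) \<le> 1 * 2 powr - (real i * ?n)"
      using measure_dilate_diff[OF l, of 0 i c] m[of 0] by (simp add: powr_minus field_simps)
    fix k assume ik: "i \<le> k"
    let ?j = "real (k - i)"
    have "(measure lebesgue (dilate c l k) / measure lebesgue (dilate c l i)) powr \<theta> = 2 powr (?j * ?n * \<theta>)"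
      using measure_dilate_diff[OF l ik, of c] m[of i] by (simp add: powr_powr)
    then have "(measure lebesgue (dilate c l k) / measure lebesgue (dilate c l i)) powr \<theta> * enn2real (avg w (dilate c l i))
        * 2 powr - (?j * ?n * a)
      \<le> 2 powr (?j * ?n * \<theta>) * (K * 2 powr (?j * (?n - \<delta>) * s) * enn2real (avg w (dilate c l k))) * 2 powr - (?j * ?n * a)"
      using growth[OF l ik, of c] by (simp add: mult_right_mono mult_left_mono)
    also have "\<dots> = K * (2 powr (?j * ?n * \<theta>) * 2 powr (?j * (?n - \<delta>) * s) * 2 powr - (?j * ?n * a)) * enn2real (avg w (dilate c l k))"
      by (simp only: mult_ac)
    also have "2 powr (?j * ?n * \<theta>) * 2 powr (?j * (?n - \<delta>) * s) * 2 powr - (?j * ?n * a)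
        = (2 :: real) powr (?j * ?n * \<theta> + ?j * (?n - \<delta>) * s + - (?j * ?n * a))"
      by (simp only: powr_add)
    also have "?j * ?n * \<theta> + ?j * (?n - \<delta>) * s + - (?j * ?n * a) = - (?j * \<epsilon>)"
      using n by (simp add: \<theta>_def \<epsilon>_def field_simps)
    finally show "(measure lebesgue (dilate c l k) / measure lebesgue (dilate c l i)) powr \<theta> * enn2real (avg w (dilate c l i))
        * 2 powr - (?j * ?n * a) \<le> K * 2 powr - (?j * \<epsilon>) * enn2real (avg w (dilate c l k))" .
  qed (use that K \<epsilon> \<eta> \<theta> cubes_measure_pos in auto)
qed

text \<open>When size is measured by \<open>w\<close> itself, the average over an inner dilate is
  the ratio of the w-masses times a power of 2 times the outer average. The cutoff leaves the power
  1 - \<theta> of that ratio, which must outweigh the factor 2^(n(1-a)) per step.\<close>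

lemma morrey_weighted_bound:
  fixes w :: "real ^ 'n \<Rightarrow> real"
  assumes F: "\<And>f g. (f, g) \<in> F \<Longrightarrow>
        f \<in> borel_measurable lebesgue \<and> g \<in> borel_measurable lebesgue \<and>
        (\<forall>x. 0 \<le> f x) \<and> (\<forall>x. 0 \<le> g x)"
    and WI: "weighted_ineq F p a b"
    and w: "w \<in> weight_class s b K" and s: "0 < s" "s \<le> a" and a: "a < 1" and b: "0 \<le> b"
    and \<eta>: "0 \<le> \<eta>" "\<eta> \<le> 1 - (1 - a) / (1 - s)"
  obtains C where "0 < C" "\<And>f g N Q. (f, g) \<in> F \<Longrightarrow> 0 \<le> N \<Longrightarrow>
    (\<And>Q. Q \<in> cubes \<Longrightarrow> (\<integral>\<^sup>+x\<in>Q. ennreal (f x powr p * w x) \<partial>lebesgue) \<le> ennreal (N * enn2real (wmeas w Q) powr \<eta>)) \<Longrightarrow>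
    Q \<in> cubes \<Longrightarrow> (\<integral>\<^sup>+x\<in>Q. ennreal (g x powr p * w x) \<partial>lebesgue) \<le> ennreal (C * N * enn2real (wmeas w Q) powr \<eta>)"
proof -
  note [measurable] = weight_classD(1)[OF w]
  note w0 = weight_classD(2)[OF w]
  have K: "0 < K" using w by (rule weight_class_const_pos)
  have a0: "0 < a" and s1: "s \<le> 1" and a1: "a \<le> 1" using s a by auto
  have wa: "w \<in> weight_class a b K" by (rule weight_class_mono[OF w]) (use s b in auto)
  have w1: "w \<in> weight_class 1 (b + 1) K" by (rule weight_class_mono[OF w]) (use s s1 b in auto)
  have ww: "weight w" by (rule weight_class_weight[OF w]) (use s s1 b in auto)
  let ?n = "real CARD('n)"
  have n: "0 < ?n" by simp
  let ?\<psi> = "\<lambda>Q. enn2real (wmeas w Q)"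
  have pw: "(\<lambda>x. w x powr (1 / 1)) = w" using w0 by (auto simp: less_imp_le)
  have \<psi>: "wmeas w Q = ennreal (?\<psi> Q)" "0 < ?\<psi> Q" if "Q \<in> cubes" for Q
    using wmeas_class_finite[OF w1 zero_less_one that, unfolded pw] by (auto simp: enn2real_positive_iff)
  have avg: "?\<psi> Q = enn2real (avg w Q) * measure lebesgue Q" if "Q \<in> cubes" for Q
    using wmeas_avg[OF that, of w] by (simp add: enn2real_mult)
  obtain \<delta> where \<delta>: "0 < \<delta>" and growth: "\<And>c l i k. 0 < l \<Longrightarrow> i \<le> k \<Longrightarrow> enn2real (avg w (dilate c l i))
    \<le> K * 2 powr (real (k - i) * (?n - \<delta>) * s) * enn2real (avg w (dilate c l k))"
    using average_dilate_growth[OF w s(1) s1 b] by blast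
  \<comment> \<open>Decay rate of the w-mass over concentric dilates; the gain
    \<open>\<delta>\<close> lifts it strictly above \<open>?n * (1 - s)\<close>.\<close>
  define \<kappa> where "\<kappa> = ?n - (?n - \<delta>) * s"
  have ns: "?n * (1 - s) < \<kappa>" using \<delta> s by (simp add: \<kappa>_def algebra_simps)
  then have \<kappa>: "0 < \<kappa>" using n s a by (meson less_trans mult_pos_pos diff_gt_0_iff_gt order_le_less_trans)
  \<comment> \<open>Midpoint of an interval for \<open>1 - \<theta>\<close>: above its lower end the
    cutoff weights decay, below its upper end \<open>\<theta>\<close> exceeds \<open>\<eta>\<close>.
    The interval is nonempty because \<open>\<kappa>\<close> is strictly larger than
    \<open>?n * (1 - s)\<close>.\<close>
  define u where "u = (?n * (1 - a) / \<kappa> + (1 - a) / (1 - s)) / 2"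
  have lt: "?n * (1 - a) / \<kappa> < (1 - a) / (1 - s)"
  proof -
    have "(1 - a) * (?n * (1 - s)) < (1 - a) * \<kappa>" using ns a by (intro mult_strict_left_mono) auto
    then show ?thesis using \<kappa> s a by (simp add: field_simps)
  qed
  have "x < y \<Longrightarrow> x < (x + y) / 2 \<and> (x + y) / 2 < y" for x y :: real by auto
  from this[OF lt] have u: "?n * (1 - a) / \<kappa> < u" "u < (1 - a) / (1 - s)" unfolding u_def by blast+
  have "0 < u" using u(1) n a \<kappa> by (meson diff_gt_0_iff_gt divide_pos_pos less_trans mult_pos_pos)
  define \<theta> where "\<theta> = 1 - u"
  define \<epsilon> where "\<epsilon> = u * \<kappa> - ?n * (1 - a)"
  have \<epsilon>: "0 < \<epsilon>" using u(1) \<kappa> by (simp add: \<epsilon>_def divide_less_eq)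
  have \<theta>: "\<eta> < \<theta>" using \<eta> u(2) by (simp add: \<theta>_def)
  define D where "D = K powr (1 / 1) * (2 powr ?n) powr (1 + (b + 1) / 1)"
  have wgrowth: "?\<psi> (dilate c l i) / ?\<psi> (dilate c l k) \<le> K * 2 powr - (real (k - i) * \<kappa>)"
    if l: "0 < l" and ik: "i \<le> k" for c l i k
  proof -
    let ?j = "real (k - i)"
    let ?y = "\<lambda>i. enn2real (avg w (dilate c l i))" and ?m = "\<lambda>i. measure lebesgue (dilate c l i)"
    have m: "0 < ?m i" for i using l by (simp add: cubes_measure_pos)
    have \<psi>k: "0 < ?\<psi> (dilate c l k)" using l by (intro \<psi>) simp
    have "?\<psi> (dilate c l i) = ?y i * ?m i" using l by (intro avg) simp
    also have "\<dots> \<le> (K * 2 powr (?j * (?n - \<delta>) * s) * ?y k) * ?m i"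
      using growth[OF l ik, of c] by (intro mult_right_mono) auto
    also have "?m i = 2 powr - (?j * ?n) * ?m k"
      using measure_dilate_diff[OF l ik, of c] m[of i] by (simp add: powr_minus)
    also have "(K * 2 powr (?j * (?n - \<delta>) * s) * ?y k) * (2 powr - (?j * ?n) * ?m k)
        = K * (2 powr (?j * (?n - \<delta>) * s) * 2 powr - (?j * ?n)) * (?y k * ?m k)" by (simp only: mult_ac)
    also have "2 powr (?j * (?n - \<delta>) * s) * 2 powr - (?j * ?n) = (2 :: real) powr (?j * (?n - \<delta>) * s + - (?j * ?n))"
      by (simp only: powr_add)
    also have "?j * (?n - \<delta>) * s + - (?j * ?n) = - (?j * \<kappa>)" by (simp add: \<kappa>_def algebra_simps)
    also have "?y k * ?m k = ?\<psi> (dilate c l k)" using l by (intro avg[symmetric]) simp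
    finally show ?thesis using \<psi>k by (simp add: divide_le_eq)
  qed
  show thesis
  proof (rule cutoff_morrey_bound[where \<psi> = ?\<psi> and D = D and \<theta> = \<theta> and \<epsilon> = \<epsilon>
      and ?C1.0 = "K powr u" and ?C2.0 = K and \<kappa> = \<kappa>, OF F WI wa a0 a1 b])
    fix c :: "real ^ 'n" and l :: real and i :: nat assume l: "0 < l"
    let ?y = "\<lambda>i. enn2real (avg w (dilate c l i))" and ?m = "\<lambda>i. measure lebesgue (dilate c l i)"
    have Q: "dilate c l i \<in> cubes" for i using l by simp
    have sub: "dilate c l i \<subseteq> dilate c l (Suc i)" using l by (intro dilate_mono) auto
    have m: "0 < ?m i" for i using l by (simp add: cubes_measure_pos)
    have Suc: "?m (Suc i) = 2 powr ?n * ?m i"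
      using measure_dilate_diff[OF l, of i "Suc i" c] by simp
    show "?\<psi> (dilate c l i) \<le> ?\<psi> (dilate c l (Suc i))"
      using wmeas_mono[OF sub, of w] \<psi>[OF Q[of "Suc i"]] \<psi>[OF Q[of i]] by (metis ennreal_le_iff less_imp_le)
    have "wmeas w (dilate c l (Suc i)) \<le> ennreal (K powr (1 / 1) * (?m (Suc i) / ?m i) powr (1 + (b + 1) / 1)) * wmeas w (dilate c l i)"
      using b m[of i] by (intro weight_class_subset[OF w1, unfolded pw] Q sub) auto
    also have "?m (Suc i) / ?m i = 2 powr ?n" using m[of i] by (simp add: Suc)
    finally have "ennreal (?\<psi> (dilate c l (Suc i))) \<le> ennreal (D * ?\<psi> (dilate c l i))"
      using \<psi>(1)[OF Q[of "Suc i"]] \<psi>(1)[OF Q[of i]] K by (simp add: D_def ennreal_mult)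
    then show "?\<psi> (dilate c l (Suc i)) \<le> D * ?\<psi> (dilate c l i)"
      using \<psi>(2)[OF Q[of i]] K by (subst (asm) ennreal_le_iff) (auto simp: D_def)
    show "?\<psi> (dilate c l 0) / ?\<psi> (dilate c l i) \<le> K * 2 powr - (real i * \<kappa>)"
      using wgrowth[OF l, of 0 i c] by simp
    fix k assume ik: "i \<le> k"
    let ?j = "real (k - i)"
    let ?r = "?\<psi> (dilate c l i) / ?\<psi> (dilate c l k)"
    have r: "0 < ?r" using \<psi>(2)[OF Q] by simp
    have yk: "0 < ?y k" using \<psi>(2)[OF Q[of k]] avg[OF Q[of k]] m[of k] by (simp add: zero_less_mult_iff)
    have mk: "?m k = 2 powr (?j * ?n) * ?m i" using l ik by (rule measure_dilate_diff)
    have "?r * 2 powr (?j * ?n) * ?y k = ?y i * ?m i / (?y k * (2 powr (?j * ?n) * ?m i)) * 2 powr (?j * ?n) * ?y k"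
      by (simp only: avg[OF Q] mk)
    also have "\<dots> = ?y i" using yk m[of i] by simp
    finally have yi: "?y i = ?r * 2 powr (?j * ?n) * ?y k" by (rule sym)
    have "(?\<psi> (dilate c l k) / ?\<psi> (dilate c l i)) powr \<theta> = ?r powr - \<theta>"
      using \<psi>(2)[OF Q[of k]] \<psi>(2)[OF Q[of i]] by (simp add: powr_minus powr_divide)
    then have "(?\<psi> (dilate c l k) / ?\<psi> (dilate c l i)) powr \<theta> * ?y i * 2 powr - (?j * ?n * a)
        = (?r powr - \<theta> * ?r powr 1) * (2 powr (?j * ?n) * 2 powr - (?j * ?n * a)) * ?y k"
      using r by (simp add: yi)
    also have "?r powr - \<theta> * ?r powr 1 = ?r powr u"
    proof -
      have "- \<theta> + 1 = u" by (simp add: \<theta>_def)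
      then show ?thesis by (simp only: powr_add[symmetric])
    qed
    also have "2 powr (?j * ?n) * 2 powr - (?j * ?n * a) = (2 :: real) powr (?j * ?n * (1 - a))"
      by (simp add: powr_add[symmetric] algebra_simps)
    also have "?r powr u * 2 powr (?j * ?n * (1 - a)) * ?y k \<le> (K * 2 powr - (?j * \<kappa>)) powr u * 2 powr (?j * ?n * (1 - a)) * ?y k"
      using wgrowth[OF l ik, of c] r \<open>0 < u\<close> by (intro mult_right_mono powr_mono2) auto
    also have "\<dots> = K powr u * (2 powr (- (?j * \<kappa>) * u) * 2 powr (?j * ?n * (1 - a))) * ?y k"
      using K by (simp add: powr_mult powr_powr)
    also have "2 powr (- (?j * \<kappa>) * u) * 2 powr (?j * ?n * (1 - a)) = (2 :: real) powr (- (?j * \<kappa>) * u + ?j * ?n * (1 - a))"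
      by (simp only: powr_add)
    also have "- (?j * \<kappa>) * u + ?j * ?n * (1 - a) = - (?j * \<epsilon>)" by (simp add: \<epsilon>_def algebra_simps)
    finally show "(?\<psi> (dilate c l k) / ?\<psi> (dilate c l i)) powr \<theta> * ?y i * 2 powr - (?j * ?n * a)
      \<le> K powr u * 2 powr - (?j * \<epsilon>) * ?y k" .
  qed (use that K \<epsilon> \<eta> \<theta> \<kappa> \<psi> in auto)
qed

section \<open>From integral estimates to Morrey quasinorms\<close>

lemma scaled_norm_le_iff:
  assumes p: "0 < p" and \<psi>: "0 < \<psi>" and T: "0 \<le> T"
  shows "ennreal \<psi> epowr - e * I epowr (1 / p) \<le> ennreal T \<longleftrightarrow> I \<le> ennreal (T powr p * \<psi> powr (e * p))"
proof -
  have c: "ennreal \<psi> epowr - e = ennreal (\<psi> powr - e)"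
    using \<psi> by (auto simp: ennreal_powr_def)
  have inv:
    "ennreal (\<psi> powr e) * (ennreal (\<psi> powr - e) * x) = x" "ennreal (\<psi> powr - e) * (ennreal (\<psi> powr e) * x) = x" for x
    using \<psi> by (simp_all add: mult.assoc[symmetric] powr_add[symmetric] flip: ennreal_mult)
  have pow: "ennreal (T * \<psi> powr e) epowr p = ennreal (T powr p * \<psi> powr (e * p))"
    using p \<psi> T by (simp add: epowr_ennreal powr_mult powr_powr)
  have root: "(I epowr (1 / p)) epowr p = I" using p by (simp add: epowr_epowr)
  have split: "ennreal (T * \<psi> powr e) = ennreal (\<psi> powr e) * ennreal T"
    using T by (simp add: ennreal_mult mult.commute)
  show ?thesis
  proof
    assume "ennreal \<psi> epowr - e * I epowr (1 / p) \<le> ennreal T"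
    then have "ennreal (\<psi> powr e) * (ennreal (\<psi> powr - e) * I epowr (1 / p)) \<le> ennreal (\<psi> powr e) * ennreal T"
      unfolding c by (rule mult_left_mono) simp
    then have "(I epowr (1 / p)) epowr p \<le> ennreal (T * \<psi> powr e) epowr p"
      unfolding inv split[symmetric] using p by (rule epowr_mono)
    then show "I \<le> ennreal (T powr p * \<psi> powr (e * p))" by (simp only: root pow)
  next
    assume "I \<le> ennreal (T powr p * \<psi> powr (e * p))"
    then have "I epowr (1 / p) \<le> (ennreal (T * \<psi> powr e) epowr p) epowr (1 / p)"
      unfolding pow using p by (intro epowr_mono) auto
    also have "\<dots> = ennreal (\<psi> powr e) * ennreal T" using p by (simp add: epowr_epowr split)
    finally have "ennreal (\<psi> powr - e) * I epowr (1 / p) \<le> ennreal (\<psi> powr - e) * (ennreal (\<psi> powr e) * ennreal T)"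
      by (rule mult_left_mono) simp
    then show "ennreal \<psi> epowr - e * I epowr (1 / p) \<le> ennreal T" by (simp only: inv c)
  qed
qed

text \<open>\<open>V\<close> and \<open>\<psi>\<close> stand for either normalisation of the Morrey
  norm. If the norm \<open>T\<close> of \<open>f\<close> is finite, then \<open>T powr p\<close> is
  the constant \<open>N\<close> in the integral bounds; taking roots turns \<open>C\<close> into
  \<open>C powr (1 / p)\<close>.\<close>

lemma morrey_norm_bound:
  fixes w :: "real ^ 'n \<Rightarrow> real"
  assumes p: "0 < p" and V: "\<And>Q. Q \<in> cubes \<Longrightarrow> V Q = ennreal (\<psi> Q) \<and> 0 < \<psi> Q"
    and F: "\<And>f g. (f, g) \<in> F \<Longrightarrow> (\<forall>x. 0 \<le> f x) \<and> (\<forall>x. 0 \<le> g x)"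
    and C: "0 < C" and bound: "\<And>f g N Q. (f, g) \<in> F \<Longrightarrow> 0 \<le> N \<Longrightarrow>
    (\<And>Q. Q \<in> cubes \<Longrightarrow> (\<integral>\<^sup>+x\<in>Q. ennreal (f x powr p * w x) \<partial>lebesgue) \<le> ennreal (N * \<psi> Q powr (e * p))) \<Longrightarrow>
    Q \<in> cubes \<Longrightarrow> (\<integral>\<^sup>+x\<in>Q. ennreal (g x powr p * w x) \<partial>lebesgue) \<le> ennreal (C * N * \<psi> Q powr (e * p))"
  shows "\<exists>c>0. \<forall>(f, g)\<in>F. (SUP Q\<in>cubes. V Q epowr - e * Lpw_norm p w Q g)
    \<le> ennreal c * (SUP Q\<in>cubes. V Q epowr - e * Lpw_norm p w Q f)"
proof (intro exI[of _ "C powr (1 / p)"] conjI)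
  show "0 < C powr (1 / p)" using C by simp
  show "\<forall>(f, g)\<in>F. (SUP Q\<in>cubes. V Q epowr - e * Lpw_norm p w Q g)
    \<le> ennreal (C powr (1 / p)) * (SUP Q\<in>cubes. V Q epowr - e * Lpw_norm p w Q f)"
  proof (intro ballI, clarify)
    fix f g :: "real ^ 'n \<Rightarrow> real" assume fg: "(f, g) \<in> F"
    have f0: "\<And>x. 0 \<le> f x" and g0: "\<And>x. 0 \<le> g x" using F[OF fg] by auto
    let ?T = "SUP Q\<in>cubes. V Q epowr - e * Lpw_norm p w Q f"
    show "(SUP Q\<in>cubes. V Q epowr - e * Lpw_norm p w Q g) \<le> ennreal (C powr (1 / p)) * ?T"
    proof (cases "?T")
      case (real T)
      have fT: "(\<integral>\<^sup>+x\<in>Q. ennreal (f x powr p * w x) \<partial>lebesgue) \<le> ennreal (T powr p * \<psi> Q powr (e * p))" if Q: "Q \<in> cubes" for Q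
      proof -
        have "V Q epowr - e * Lpw_norm p w Q f \<le> ennreal T" unfolding real(2)[symmetric] using Q by (rule SUP_upper)
        then show ?thesis using V[OF Q] p real(1) by (simp add: Lpw_norm_nonneg[OF f0] scaled_norm_le_iff)
      qed
      have "V Q epowr - e * Lpw_norm p w Q g \<le> ennreal (C powr (1 / p) * T)" if Q: "Q \<in> cubes" for Q
      proof -
        have "(C powr (1 / p) * T) powr p = C * T powr p" using C p real(1) by (simp add: powr_mult powr_powr)
        then show ?thesis
          using bound[OF fg _ fT Q] V[OF Q] p C real(1)
          by (simp add: Lpw_norm_nonneg[OF g0] scaled_norm_le_iff)
      qed
      then show ?thesis using C real by (auto intro!: SUP_least simp: ennreal_mult)
    next
      case top
      show ?thesis unfolding top using C by (simp add: ennreal_mult_top)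
    qed
  qed
qed

section \<open>Everywhere positive representatives of Muckenhoupt weights\<close>

lemma muckenhoupt_cong_AE:
  assumes eq: "AE x in lebesgue. w x = w' x" and q: "1 \<le> q"
    and w: "w \<in> muckenhoupt q" and w': "\<And>x. 0 < w' x" "w' \<in> borel_measurable lebesgue"
  shows "weight w'" "muckenhoupt_const q w' < top"
proof -
  have avg: "avg (\<lambda>x. w' x powr t) Q = avg (\<lambda>x. w x powr t) Q" "avg w' Q = avg w Q" for t Q
    unfolding avg_def wmeas_def
    by (intro arg_cong2[where f = "(/)"] nn_integral_cong_AE refl; use eq in \<open>auto elim!: eventually_mono\<close>)+
  have ww: "weight w" using w by (simp add: muckenhoupt_def)
  note [measurable] = w'(2)
  have [measurable]: "w \<in> borel_measurable lebesgue" using ww by (simp add: weight_def)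
  show "weight w'"
    unfolding weight_def
  proof (intro conjI allI impI)
    fix S :: "(real ^ 'a) set" assume S: "compact S"
    have [measurable]: "S \<in> sets lebesgue" using S by (simp add: borel_compact)
    have "set_integrable lebesgue S w" using ww S by (simp add: weight_def)
    then show "set_integrable lebesgue S w'"
      unfolding set_integrable_def
      by (rule integrable_cong_AE_imp) (use eq in \<open>auto elim!: eventually_mono\<close>)
  qed (use w' in \<open>auto simp: less_imp_le\<close>)
  show "muckenhoupt_const q w' < top"
  proof (cases "q = 1")
    case True
    then obtain c where c: "0 \<le> c" "A1_bound w c" using w by (auto simp: muckenhoupt_def)
    have "A1_bound w' c"
      unfolding A1_bound_def
    proof
      fix Q :: "(real ^ 'a) set" assume "Q \<in> cubes"
      then have "AE x in lebesgue. x \<in> Q \<longrightarrow> avg w Q \<le> ennreal (c * w x)" using c(2) by (auto simp: A1_bound_def)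
      with eq show "AE x in lebesgue. x \<in> Q \<longrightarrow> avg w' Q \<le> ennreal (c * w' x)"
        by eventually_elim (simp add: avg)
    qed
    then have "muckenhoupt_const q w' \<le> ennreal c"
      using True c(1) by (auto simp: muckenhoupt_const_def intro!: INF_lower)
    then show ?thesis by (rule le_less_trans) simp
  next
    case False
    then show ?thesis using w by (simp add: muckenhoupt_def muckenhoupt_const_def avg)
  qed
qed

text \<open>A weight class demands positivity at every point, a Muckenhoupt class only a.e.; setting
  the weight to 1 on the exceptional null set changes no integral.\<close>

lemma muckenhoupt_reverse_holder_representative:
  fixes w :: "real ^ 'n \<Rightarrow> real"
  assumes w: "w \<in> muckenhoupt q \<inter> reverse_holder (ereal s)" and q: "1 \<le> q" and s: "0 < s"
  obtains w' K where "w' \<in> weight_class (1 / s) (q - 1) K" "AE x in lebesgue. w x = w' x"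
proof -
  have ww: "weight w" and pos: "AE x in lebesgue. 0 < w x" using w by (auto simp: muckenhoupt_def)
  have [measurable]: "w \<in> borel_measurable lebesgue" using ww by (simp add: weight_def)
  define w' where "w' x = (if 0 < w x then w x else 1)" for x
  have [measurable]: "w' \<in> borel_measurable lebesgue" unfolding w'_def by measurable
  have w'0: "0 < w' x" for x by (simp add: w'_def)
  have eq: "AE x in lebesgue. w x = w' x" using pos by eventually_elim (simp add: w'_def)
  have "w \<in> muckenhoupt q" using w by simp
  note m = muckenhoupt_cong_AE[OF eq q this w'0 \<open>w' \<in> borel_measurable lebesgue\<close>]
  obtain K where K: "muckenhoupt_const (1 + (q - 1)) w' < ennreal K"
    using m(2) by (cases "muckenhoupt_const q w'") (auto intro: that[of "enn2real (muckenhoupt_const q w') + 1"] simp: ennreal_less_iff)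
  obtain c where c: "0 \<le> c" "\<And>Q. Q \<in> cubes \<Longrightarrow> avg (\<lambda>x. w x powr s) Q epowr (1 / s) \<le> ennreal c * avg w Q"
    using w by (auto simp: reverse_holder_def)
  have avg: "avg (\<lambda>x. w' x powr t) Q = avg (\<lambda>x. w x powr t) Q" "avg w' Q = avg w Q" for t Q
    unfolding avg_def wmeas_def
    by (intro arg_cong2[where f = "(/)"] nn_integral_cong_AE refl; use eq in \<open>auto elim!: eventually_mono\<close>)+
  \<comment> \<open>The reverse Hoelder constant is only known to be nonnegative;
    \<open>c + 1\<close> is positive.\<close>
  have "avg (\<lambda>x. w' x powr (1 / (1 / s))) Q epowr (1 / s) \<le> ennreal (c + 1) * avg w' Q" if "Q \<in> cubes" for Q
  proof -
    have "ennreal c * avg w Q \<le> ennreal (c + 1) * avg w Q" by (intro mult_right_mono ennreal_leI) auto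
    then show ?thesis using c(2)[OF that] by (simp add: avg)
  qed
  then have "w' \<in> weight_class (1 / s) (q - 1) ((c + 1) * K)"
    using m(1) w'0 q s K c(1) by (intro muckenhoupt_reverse_holder_weight_class) auto
  then show thesis using eq by (rule that)
qed

section \<open>The case in which the Morrey norms reduce to the global norm\<close>

lemma Lpw_norm_UNIV_le:
  fixes f :: "real ^ 'n \<Rightarrow> real"
  assumes [measurable]: "f \<in> borel_measurable lebesgue" "w \<in> borel_measurable lebesgue" and p: "0 < p"
  shows "Lpw_norm p w UNIV f \<le> (SUP Q\<in>cubes. Lpw_norm p w Q f)"
proof -
  let ?T = "SUP Q\<in>cubes. Lpw_norm p w Q f"
  let ?u = "\<lambda>x. ennreal (norm (f x) powr p * w x)"
  let ?D = "dilate (0 :: real ^ 'n) 1"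
  have le: "(\<integral>\<^sup>+x\<in>Q. ?u x \<partial>lebesgue) \<le> ?T epowr p" if Q: "Q \<in> cubes" for Q
  proof -
    have "Lpw_norm p w Q f epowr p \<le> ?T epowr p" using Q p by (intro epowr_mono SUP_upper)
    then show ?thesis using p by (simp add: Lpw_norm_def epowr_epowr)
  qed
  have "(\<integral>\<^sup>+x. ?u x \<partial>lebesgue) = (\<integral>\<^sup>+x. (SUP i. ?u x * indicator (?D i) x) \<partial>lebesgue)"
  proof (rule nn_integral_cong)
    fix x
    have "x \<in> ?D (layer 0 1 x)" by (rule mem_layer) simp
    then show "?u x = (SUP i. ?u x * indicator (?D i) x)"
      by (intro antisym SUP_least SUP_upper2[of "layer 0 1 x"]) (auto simp: indicator_def)
  qed
  also have "\<dots> = (SUP i. \<integral>\<^sup>+x\<in>?D i. ?u x \<partial>lebesgue)"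
  proof (rule nn_integral_monotone_convergence_SUP)
    show "incseq (\<lambda>i x. ?u x * indicator (?D i) x)"
    proof (intro incseq_SucI le_funI mult_left_mono)
      fix i and x :: "real ^ 'n"
      have "?D i \<subseteq> ?D (Suc i)" by (rule dilate_mono) auto
      then show "indicator (?D i) x \<le> (indicator (?D (Suc i)) x :: ennreal)" by (auto simp: indicator_def)
    qed simp
  qed simp
  also have "\<dots> \<le> ?T epowr p" by (intro SUP_least le) simp
  finally have "(\<integral>\<^sup>+x. ?u x \<partial>lebesgue) epowr (1 / p) \<le> (?T epowr p) epowr (1 / p)" using p by (intro epowr_mono) auto
  then show ?thesis using p by (simp add: Lpw_norm_def epowr_epowr)
qed

text \<open>For r = -n/p the normalising exponent vanishes and both Morrey norms are suprema of
  local norms, which exhaust the global norm; a global inequality for the weight itself then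
  suffices.\<close>

lemma global_morrey_bound:
  fixes F :: "((real ^ 'n \<Rightarrow> real) \<times> (real ^ 'n \<Rightarrow> real)) set"
  assumes F: "\<And>f g. (f, g) \<in> F \<Longrightarrow> f \<in> borel_measurable lebesgue"
    and w: "w \<in> borel_measurable lebesgue" and p: "0 < p"
    and ineq: "\<And>f g. (f, g) \<in> F \<Longrightarrow> Lpw_norm p w UNIV g \<le> ennreal c * Lpw_norm p w UNIV f"
    and c: "0 < c"
  shows "\<exists>c>0. \<forall>(f, g)\<in>F. (SUP Q\<in>cubes. Lpw_norm p w Q g) \<le> ennreal c * (SUP Q\<in>cubes. Lpw_norm p w Q f)"
proof (intro exI[of _ c] conjI c ballI, clarify)
  fix f g assume fg: "(f, g) \<in> F"
  have "(SUP Q\<in>cubes. Lpw_norm p w Q g) \<le> Lpw_norm p w UNIV g"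
    using p unfolding Lpw_norm_def
    by (intro SUP_least epowr_mono nn_integral_mono) (auto simp: indicator_def)
  also have "\<dots> \<le> ennreal c * Lpw_norm p w UNIV f" by (rule ineq[OF fg])
  also have "\<dots> \<le> ennreal c * (SUP Q\<in>cubes. Lpw_norm p w Q f)"
    by (intro mult_left_mono Lpw_norm_UNIV_le F[OF fg] w p) simp
  finally show "(SUP Q\<in>cubes. Lpw_norm p w Q g) \<le> ennreal c * (SUP Q\<in>cubes. Lpw_norm p w Q f)" .
qed




theorem theorem4p8:
  fixes p_minus p_zero p_plus p :: real
    and \<sigma> :: ereal
    and F :: "((real ^ 'n \<Rightarrow> real) \<times> (real ^ 'n \<Rightarrow> real)) set"
    and w :: "real ^ 'n \<Rightarrow> real"
    and c1 :: "ennreal \<Rightarrow> real"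
  assumes exponents: "1 \<le> p_minus" "p_minus \<le> p_zero" "p_zero \<le> p_plus"
    and F_functions: "\<And>f g. (f, g) \<in> F \<Longrightarrow>
        f \<in> borel_measurable lebesgue \<and> g \<in> borel_measurable lebesgue \<and>
        (\<forall>x. 0 \<le> f x) \<and> (\<forall>x. 0 \<le> g x)"
    and c1_pos: "\<And>t. c1 t > 0"
    and hyp: "\<And>f g v. (f, g) \<in> F \<Longrightarrow>
        v \<in> muckenhoupt (p_zero / p_minus) \<inter>
             reverse_holder (conj_exponent (ereal (p_plus / p_zero))) \<Longrightarrow>
        Lpw_norm p_zero v UNIV g
          \<le> ennreal (c1 (muckenhoupt_const p_zero v)) * Lpw_norm p_zero v UNIV f"
    and p_range: "(p_minus < p \<and> p < p_plus) \<or> (p = p_minus \<and> p_zero = p_minus)"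
    and sigma: "conj_exponent (ereal (p_plus / p)) \<le> \<sigma>" "\<sigma> = \<infinity> \<Longrightarrow> p = p_plus"
    and w: "w \<in> muckenhoupt (p / p_minus) \<inter> reverse_holder \<sigma>"
  shows "(\<forall>r::real. - real CARD('n) / p \<le> r \<and>
            ereal r \<le> - (ereal (real CARD('n)) * conj_exponent \<sigma> / ereal p_plus) \<longrightarrow>
            (\<exists>c2::real. c2 > 0 \<and> (\<forall>(f, g)\<in>F.
               morrey_norm r p w g \<le> ennreal c2 * morrey_norm r p w f))) \<and>
         (\<forall>r::real. - real CARD('n) / p \<le> r \<and>
            ereal r \<le> - (ereal (real CARD('n)) / (ereal p * \<sigma>))
                       - ereal (real CARD('n) / p_plus) \<longrightarrow>
            (\<exists>c3::real. c3 > 0 \<and> (\<forall>(f, g)\<in>F.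
               morrey_lambda_norm r p w g \<le> ennreal c3 * morrey_lambda_norm r p w f)))"
proof -
  let ?n = "real CARD('n)"
  have n: "0 < ?n" by simp
  define q where "q = p / p_minus"
  have p: "0 < p" "p_minus \<le> p" "p \<le> p_plus" "0 < p_plus" using exponents p_range by auto
  have q: "1 \<le> q" using p exponents by (simp add: q_def)
  have w_meas: "w \<in> borel_measurable lebesgue" using w by (simp add: muckenhoupt_def weight_def)
  show ?thesis
  proof (cases "p = p_plus")
    case True
    \<comment> \<open>At \<open>p = p_plus\<close> the range condition leaves only the alternative
      in which all exponents coincide. Then \<open>\<sigma>\<close> is infinite, with conjugate
      exponent 1 and reciprocal 0, and both ranges of \<open>r\<close> shrink to the single value
      -n/p.\<close>
    then have eq: "p = p_minus" "p_zero = p_minus" "p_plus = p_minus" using p_range by auto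
    have \<sigma>: "\<sigma> = \<infinity>" using sigma(1) conj_exponent_real[of p p_plus] p True by simp
    have glob: "\<exists>c>0. \<forall>(f, g)\<in>F. (SUP Q\<in>cubes. Lpw_norm p w Q g) \<le> ennreal c * (SUP Q\<in>cubes. Lpw_norm p w Q f)"
    proof (rule global_morrey_bound)
      fix f g assume fg: "(f, g) \<in> F"
      show "f \<in> borel_measurable lebesgue" using F_functions[OF fg] by simp
      have "w \<in> muckenhoupt (p_zero / p_minus) \<inter> reverse_holder (conj_exponent (ereal (p_plus / p_zero)))"
        using w \<sigma> eq exponents by (simp add: conj_exponent_def one_ereal_def)
      from hyp[OF fg this] show "Lpw_norm p w UNIV g \<le> ennreal (c1 (muckenhoupt_const p w)) * Lpw_norm p w UNIV f"
        by (simp add: eq)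
    qed (use w_meas p c1_pos in auto)
    have zero: "1 / p + r / ?n = 0" if "- ?n / p \<le> r" "r \<le> - ?n / p" for r
    proof -
      have "r = - ?n / p" using that by simp
      then show ?thesis using p by (simp add: field_simps)
    qed
    have m: "morrey_norm r p w h = (SUP Q\<in>cubes. Lpw_norm p w Q h)"
      "morrey_lambda_norm r p w h = (SUP Q\<in>cubes. Lpw_norm p w Q h)"
      if "- ?n / p \<le> r" "r \<le> - ?n / p" for r and h :: "real ^ 'n \<Rightarrow> real"
      using zero[OF that] by (simp_all add: morrey_norm_def morrey_lambda_norm_def ennreal_powr_def)
    have r1: "r \<le> - ?n / p" if "ereal r \<le> - (ereal ?n * conj_exponent \<sigma> / ereal p_plus)" for r
      using that p True by (simp add: \<sigma> conj_exponent_def)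
    have r2: "r \<le> - ?n / p" if "ereal r \<le> - (ereal ?n / (ereal p * \<sigma>)) - ereal (?n / p_plus)" for r
      using that p True by (simp add: \<sigma>)
    show ?thesis
    proof (intro conjI allI impI; elim conjE)
      fix r assume r: "- ?n / p \<le> r"
      show "\<exists>c2>0. \<forall>(f, g)\<in>F. morrey_norm r p w g \<le> ennreal c2 * morrey_norm r p w f"
        if "ereal r \<le> - (ereal ?n * conj_exponent \<sigma> / ereal p_plus)"
        using glob by (simp only: m(1)[OF r r1[OF that]])
      show "\<exists>c3>0. \<forall>(f, g)\<in>F. morrey_lambda_norm r p w g \<le> ennreal c3 * morrey_lambda_norm r p w f"
        if "ereal r \<le> - (ereal ?n / (ereal p * \<sigma>)) - ereal (?n / p_plus)"
        using glob by (simp only: m(2)[OF r r2[OF that]])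
    qed
  next
    case False
    then have pP: "p < p_plus" using p by simp
    \<comment> \<open>Reciprocal of the reverse Hoelder exponent that the global inequality
      requires; the assumption on \<open>\<sigma>\<close> then reads
      \<open>1 / s \<le> a\<close>.\<close>
    define a where "a = 1 - p / p_plus"
    have a: "0 < a" "a < 1" using p pP by (auto simp: a_def)
    have conj: "conj_exponent (ereal (p_plus / p)) = ereal (1 / a)"
      using conj_exponent_real[of p p_plus] p a by (simp add: a_def)
    obtain s where s: "\<sigma> = ereal s" "1 / a \<le> s"
      using sigma False by (cases \<sigma>) (auto simp: conj)
    have s1: "1 < s" using s(2) a by (meson less_le_trans less_divide_eq_1_pos)
    have sa: "1 / s \<le> a" using s(2) s1 a by (simp add: field_simps)
    obtain w' K where w': "w' \<in> weight_class (1 / s) (q - 1) K" and eq: "AE x in lebesgue. w x = w' x"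
      using muckenhoupt_reverse_holder_representative[OF _ q, of w s] w s1 by (auto simp: q_def s(1))
    have F0: "\<And>f g. (f, g) \<in> F \<Longrightarrow> (\<forall>x. 0 \<le> f x) \<and> (\<forall>x. 0 \<le> g x)" using F_functions by blast
    have WI: "weighted_ineq F p a (q - 1)"
      unfolding a_def q_def
      by (rule limited_range_extrapolation[OF exponents _ F_functions weighted_ineq_base[OF exponents F_functions c1_pos hyp]])
        (use p_range pP in auto)
    have wm: "wmeas w Q = wmeas w' Q" for Q
      unfolding wmeas_def by (rule nn_integral_cong_AE) (use eq in \<open>auto elim!: eventually_mono\<close>)
    have wn: "Lpw_norm p w Q h = Lpw_norm p w' Q h" for Q and h :: "real ^ 'n \<Rightarrow> real"
      unfolding Lpw_norm_def
      by (intro arg_cong2[where f = "(epowr)"] nn_integral_cong_AE refl) (use eq in \<open>auto elim!: eventually_mono\<close>)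
    have w1: "w' \<in> weight_class 1 (q - 1) K" by (rule weight_class_mono[OF w']) (use s1 q in auto)
    have pw: "(\<lambda>x. w' x powr (1 / 1)) = w'" using weight_classD(2)[OF w'] by (auto simp: less_imp_le)
    have wpos: "wmeas w' Q = ennreal (enn2real (wmeas w' Q)) \<and> 0 < enn2real (wmeas w' Q)" if "Q \<in> cubes" for Q
      using wmeas_class_finite[OF w1 zero_less_one that, unfolded pw] by (auto simp: enn2real_positive_iff)
    have e: "(1 / p + r / ?n) * p = 1 + r * p / ?n" for r using p by (simp add: field_simps)
    have e0: "0 \<le> (1 / p + r / ?n) * p" if "- ?n / p \<le> r" for r
    proof -
      have "- ?n \<le> r * p" using mult_right_mono[OF that, of p] p by simp
      then have "- 1 \<le> r * p / ?n" using n by (simp add: le_divide_eq)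
      then show ?thesis by (simp add: e)
    qed
    have first: "\<exists>c2>0. \<forall>(f, g)\<in>F. morrey_norm r p w g \<le> ennreal c2 * morrey_norm r p w f"
      if r: "- ?n / p \<le> r" "ereal r \<le> - (ereal ?n * conj_exponent \<sigma> / ereal p_plus)" for r
    proof -
      have "conj_exponent \<sigma> = ereal (s / (s - 1))" using s1 by (simp add: s(1) conj_exponent_def one_ereal_def)
      then have "r \<le> - (?n * (s / (s - 1)) / p_plus)" using r(2) p(4) by simp
      \<comment> \<open>The conjugate of \<open>s\<close> is 1 / (1 - 1/s) and
        \<open>p / p_plus\<close> is \<open>1 - a\<close>, so the upper limit for \<open>r\<close>
        matches the limit for \<open>\<eta>\<close> in \<open>morrey_weighted_bound\<close>
        exactly.\<close>
      then have "r * p / ?n \<le> - (?n * (s / (s - 1)) / p_plus) * p / ?n" using p n by (intro divide_right_mono mult_right_mono) auto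
      also have "\<dots> = - ((1 - a) / (1 - 1 / s))" using s1 n p by (simp add: a_def field_simps)
      finally have "(1 / p + r / ?n) * p \<le> 1 - (1 - a) / (1 - 1 / s)" by (simp add: e)
      then obtain C where C: "0 < C" "\<And>f g N Q. (f, g) \<in> F \<Longrightarrow> 0 \<le> N \<Longrightarrow>
        (\<And>Q. Q \<in> cubes \<Longrightarrow> (\<integral>\<^sup>+x\<in>Q. ennreal (f x powr p * w' x) \<partial>lebesgue) \<le> ennreal (N * enn2real (wmeas w' Q) powr ((1 / p + r / ?n) * p))) \<Longrightarrow>
        Q \<in> cubes \<Longrightarrow> (\<integral>\<^sup>+x\<in>Q. ennreal (g x powr p * w' x) \<partial>lebesgue) \<le> ennreal (C * N * enn2real (wmeas w' Q) powr ((1 / p + r / ?n) * p))"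
        using morrey_weighted_bound[OF F_functions WI w' _ sa a(2) _ e0[OF r(1)]] s1 q by auto
      show ?thesis
        unfolding morrey_norm_def wm wn by (rule morrey_norm_bound[OF p(1) wpos F0 C])
    qed
    have second: "\<exists>c3>0. \<forall>(f, g)\<in>F. morrey_lambda_norm r p w g \<le> ennreal c3 * morrey_lambda_norm r p w f"
      if r: "- ?n / p \<le> r" "ereal r \<le> - (ereal ?n / (ereal p * \<sigma>)) - ereal (?n / p_plus)" for r
    proof -
      have "r \<le> - (?n / (p * s)) - ?n / p_plus" using r(2) p s1 by (simp add: s(1))
      \<comment> \<open>Since \<open>p / p_plus\<close> is \<open>1 - a\<close>, the upper limit for
        \<open>r\<close> becomes the limit \<open>a - 1 / s\<close> for \<open>\<eta>\<close> in
        \<open>morrey_lambda_bound\<close>.\<close>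
      then have "r * p / ?n \<le> (- (?n / (p * s)) - ?n / p_plus) * p / ?n" using p n by (intro divide_right_mono mult_right_mono) auto
      also have "\<dots> = a - 1 / s - 1" using s1 n p by (simp add: a_def field_simps)
      finally have "(1 / p + r / ?n) * p \<le> a - 1 / s" by (simp add: e)
      then obtain C where C: "0 < C" "\<And>f g N Q. (f, g) \<in> F \<Longrightarrow> 0 \<le> N \<Longrightarrow>
        (\<And>Q. Q \<in> cubes \<Longrightarrow> (\<integral>\<^sup>+x\<in>Q. ennreal (f x powr p * w' x) \<partial>lebesgue) \<le> ennreal (N * measure lebesgue Q powr ((1 / p + r / ?n) * p))) \<Longrightarrow>
        Q \<in> cubes \<Longrightarrow> (\<integral>\<^sup>+x\<in>Q. ennreal (g x powr p * w' x) \<partial>lebesgue) \<le> ennreal (C * N * measure lebesgue Q powr ((1 / p + r / ?n) * p))"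
        using morrey_lambda_bound[OF F_functions WI w' _ sa _ _ e0[OF r(1)]] s1 q a by auto
      have V: "emeasure lebesgue Q = ennreal (measure lebesgue Q) \<and> 0 < measure lebesgue Q" if "Q \<in> cubes" for Q
        using cubes_emeasure[OF that] cubes_measure_pos[OF that] by blast
      show ?thesis
        unfolding morrey_lambda_norm_def wn by (rule morrey_norm_bound[OF p(1) V F0 C])
    qed
    show ?thesis using first second by blast
  qed
qed

end
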